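(* Let $\mu \in \mathfrak{M}_{x}(\mathcal{G})$ be definable, invariantly supported and idempotent. Let $I \subseteq S(\mu)$ be a closed (non-empty) two-sided ideal of the semigroup $(S(\mu), * )$. Then $I = S(\mu)$.
   Context: Setting: $T$ is a first-order theory in a language $\mathcal{L}$ expanding a group, $\mathcal{G}$ is a sufficiently saturated (monster) model of $T$, and "small" means small relative to the saturation of $\mathcal{G}$. The variable $x$ (and $y$ in convolutions) is a singleton variable of the sort on which the group is defined. Keisler measures: for $A\subseteq\mathcal{G}$, $\mathcal{L}_x(A)$ is the Boolean algebra of formulas in $x$ with parameters from $A$ (up to equivalence), $S_x(A)$ is the space of types over $A$, and $\mathfrak{M}_x(A)$ is the set of Keisler measures over $A$, i.e. finitely additive probability measures on $\mathcal{L}_x(A)$; each is identified with the corresponding regular Borel probability measure on $S_x(A)$. $\mu|_A$ denotes restriction. The support of $\mu\in\mathfrak{M}_x(A)$ is $S(\mu)=\{p\in S_x(A):\mu(\varphi(x))>0 \text{ for all }\varphi(x)\in p\}$, a closed non-empty set. $\mu\in\mathfrak{M}_x(\mathcal{G})$ is definable if there is a small $M\prec\mathcal{G}$ such that for every $\mathcal{L}(M)$-formula $\varphi(x;y)$ ($y$ any finite tuple of variables), $\mu(\varphi(x;b))$ depends only on $\mathrm{tp}(b/M)$ and the map $S_y(M)\to[0,1]$, $\mathrm{tp}(b/M)\mapsto\mu(\varphi(x;b))$ is continuous. $\mu$ is invariantly supported if there is a small $M\prec\mathcal{G}$ such that every $p\in S(\mu)$ is $M$-invariant. Convolution: for $\mu,\nu\in\mathfrak{M}_x(\mathcal{G})$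 let $\nu_y$ be $\nu$ viewed as a measure in the variable $y$. The pair $(\mu,\nu)$ is $*$-Borel if for every $\varphi(x,\bar c)\in\mathcal{L}_x(\mathcal{G})$ there is a small $N\prec\mathcal{G}$ containing $\bar c$ such that for every $q\in S(\nu_y|_N)$ the value $F(q):=\mu(\varphi(x\cdot d,\bar c))$ is the same for all $d\models q$ in $\mathcal{G}$, and $F:S(\nu_y|_N)\to[0,1]$ is Borel. Then $(\mu*\nu)(\varphi(x,\bar c)):=\int_{S(\nu_y|_N)}F\,d\nu_N$, where $\nu_N$ is the Borel measure $\nu_y|_N$ restricted to its support (this does not depend on $N$). $\mu$ is idempotent if $(\mu,\mu)$ is $*$-Borel and $\mu*\mu=\mu$. Product of types: if $p,q\in S_x(\mathcal{G})$ are invariant over a small model $M$, then $p*q:=\mathrm{tp}(a\cdot b/\mathcal{G})$, where (in a larger monster model) $b\models q$ and $a$ realizes the restriction to $\mathcal{G}b$ of the unique $M$-invariant extension of $p$. For $\mu$ as in the claim, $S(\mu)$ is closed under $*$, so $(S(\mu),* )$ is a semigroup. A two-sided ideal is a non-empty subset $I$ with $S(\mu)*I\subseteq I$ and $I*S(\mu)\subseteq I$. *)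

theory Defs
  imports "HOL-Probability.Probability" "HOL-Algebra.Group"
begin

unbundle cardinal_syntax

section \<open>Many-sorted languages, formulas and structures\<close>

text \<open>
  The language of an expansion of a group: sorts \<open>'s\<close>, function symbols \<open>'f\<close>, relation
  symbols \<open>'r\<close>, together with the sort of the group and the symbol for its multiplication.
\<close>

record ('s, 'f, 'r) language =
  farity :: "'f \<Rightarrow> 's list"
  fsort :: "'f \<Rightarrow> 's"
  rarity :: "'r \<Rightarrow> 's list"
  gsort :: "'s"
  mul :: "'f"

text \<open>A variable carries its sort, and each sort has countably many variables.\<close>

type_synonym 's var = "'s \<times> nat"

text \<open>\<open>Cst a\<close> is the parameter \<open>a\<close>; formulas of the language itself contain no \<open>Cst\<close>.\<close>

datatype ('s, 'f, 'm) tm = Var "'s var" | Cst 'm | App 'f "('s, 'f, 'm) tm list"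

datatype ('s, 'f, 'r, 'm) fm =
    Eq "('s, 'f, 'm) tm" "('s, 'f, 'm) tm"
  | Rel 'r "('s, 'f, 'm) tm list"
  | Neg "('s, 'f, 'r, 'm) fm"
  | Conj "('s, 'f, 'r, 'm) fm" "('s, 'f, 'r, 'm) fm"
  | Ex "'s var" "('s, 'f, 'r, 'm) fm"

abbreviation Disj :: "('s, 'f, 'r, 'm) fm \<Rightarrow> ('s, 'f, 'r, 'm) fm \<Rightarrow> ('s, 'f, 'r, 'm) fm" where
  "Disj \<phi> \<psi> \<equiv> Neg (Conj (Neg \<phi>) (Neg \<psi>))"

text \<open>
  The universes of the sorts of a structure are kept disjoint: every element of \<open>univ\<close> has a
  sort, so that a set of parameters is just a set of elements.
\<close>

record ('s, 'f, 'r, 'm) model =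
  univ :: "'m set"
  sort_of :: "'m \<Rightarrow> 's"
  fint :: "'f \<Rightarrow> 'm list \<Rightarrow> 'm"
  rint :: "'r \<Rightarrow> 'm list \<Rightarrow> bool"

definition sort_elems :: "('s, 'f, 'r, 'm) model \<Rightarrow> 's \<Rightarrow> 'm set" where
  "sort_elems G s = {a \<in> univ G. sort_of G a = s}"

definition tuples :: "('s, 'f, 'r, 'm) model \<Rightarrow> 's list \<Rightarrow> 'm list set" where
  "tuples G ss = {as. list_all2 (\<lambda>a s. a \<in> sort_elems G s) as ss}"

definition is_structure :: "('s, 'f, 'r) language \<Rightarrow> ('s, 'f, 'r, 'm) model \<Rightarrow> bool" where
  "is_structure L G \<longleftrightarrow>
     (\<forall>s. sort_elems G s \<noteq> {}) \<and>
     (\<forall>f. \<forall>as \<in> tuples G (farity L f). fint G f as \<in> sort_elems G (fsort L f))"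

fun tm_fv :: "('s, 'f, 'm) tm \<Rightarrow> 's var set" where
  "tm_fv (Var v) = {v}"
| "tm_fv (Cst a) = {}"
| "tm_fv (App f ts) = (\<Union>t \<in> set ts. tm_fv t)"

fun tm_params :: "('s, 'f, 'm) tm \<Rightarrow> 'm set" where
  "tm_params (Var v) = {}"
| "tm_params (Cst a) = {a}"
| "tm_params (App f ts) = (\<Union>t \<in> set ts. tm_params t)"

fun has_sort :: "('s, 'f, 'r) language \<Rightarrow> ('m \<Rightarrow> 's) \<Rightarrow> ('s, 'f, 'm) tm \<Rightarrow> 's \<Rightarrow> bool" where
  "has_sort L so (Var v) s \<longleftrightarrow> fst v = s"
| "has_sort L so (Cst a) s \<longleftrightarrow> so a = s"
| "has_sort L so (App f ts) s \<longleftrightarrow> fsort L f = s \<and> list_all2 (has_sort L so) ts (farity L f)"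

fun fv :: "('s, 'f, 'r, 'm) fm \<Rightarrow> 's var set" where
  "fv (Eq t u) = tm_fv t \<union> tm_fv u"
| "fv (Rel r ts) = (\<Union>t \<in> set ts. tm_fv t)"
| "fv (Neg \<phi>) = fv \<phi>"
| "fv (Conj \<phi> \<psi>) = fv \<phi> \<union> fv \<psi>"
| "fv (Ex v \<phi>) = fv \<phi> - {v}"

fun params :: "('s, 'f, 'r, 'm) fm \<Rightarrow> 'm set" where
  "params (Eq t u) = tm_params t \<union> tm_params u"
| "params (Rel r ts) = (\<Union>t \<in> set ts. tm_params t)"
| "params (Neg \<phi>) = params \<phi>"
| "params (Conj \<phi> \<psi>) = params \<phi> \<union> params \<psi>"
| "params (Ex v \<phi>) = params \<phi>"

fun well_sorted :: "('s, 'f, 'r) language \<Rightarrow> ('m \<Rightarrow> 's) \<Rightarrow> ('s, 'f, 'r, 'm) fm \<Rightarrow> bool" where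
  "well_sorted L so (Eq t u) \<longleftrightarrow> (\<exists>s. has_sort L so t s \<and> has_sort L so u s)"
| "well_sorted L so (Rel r ts) \<longleftrightarrow> list_all2 (has_sort L so) ts (rarity L r)"
| "well_sorted L so (Neg \<phi>) \<longleftrightarrow> well_sorted L so \<phi>"
| "well_sorted L so (Conj \<phi> \<psi>) \<longleftrightarrow> well_sorted L so \<phi> \<and> well_sorted L so \<psi>"
| "well_sorted L so (Ex v \<phi>) \<longleftrightarrow> well_sorted L so \<phi>"

text \<open>The formulas with free variables in \<open>Y\<close> and parameters in \<open>A\<close>.\<close>

definition formulas :: "('s, 'f, 'r) language \<Rightarrow> ('s, 'f, 'r, 'm) model \<Rightarrow> 's var set \<Rightarrow> 'm set
    \<Rightarrow> ('s, 'f, 'r, 'm) fm set" where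
  "formulas L G Y A = {\<phi>. well_sorted L (sort_of G) \<phi> \<and> fv \<phi> \<subseteq> Y \<and> params \<phi> \<subseteq> A}"

fun tm_val :: "('s, 'f, 'r, 'm) model \<Rightarrow> ('s var \<Rightarrow> 'm) \<Rightarrow> ('s, 'f, 'm) tm \<Rightarrow> 'm" where
  "tm_val G e (Var v) = e v"
| "tm_val G e (Cst a) = a"
| "tm_val G e (App f ts) = fint G f (map (tm_val G e) ts)"

fun sat :: "('s, 'f, 'r, 'm) model \<Rightarrow> ('s var \<Rightarrow> 'm) \<Rightarrow> ('s, 'f, 'r, 'm) fm \<Rightarrow> bool" where
  "sat G e (Eq t u) \<longleftrightarrow> tm_val G e t = tm_val G e u"
| "sat G e (Rel r ts) \<longleftrightarrow> rint G r (map (tm_val G e) ts)"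
| "sat G e (Neg \<phi>) \<longleftrightarrow> \<not> sat G e \<phi>"
| "sat G e (Conj \<phi> \<psi>) \<longleftrightarrow> sat G e \<phi> \<and> sat G e \<psi>"
| "sat G e (Ex v \<phi>) \<longleftrightarrow> (\<exists>a \<in> sort_elems G (fst v). sat G (e(v := a)) \<phi>)"

definition assignments :: "('s, 'f, 'r, 'm) model \<Rightarrow> ('s var \<Rightarrow> 'm) set" where
  "assignments G = {e. \<forall>v. e v \<in> sort_elems G (fst v)}"

definition elementary_sub :: "('s, 'f, 'r) language \<Rightarrow> ('s, 'f, 'r, 'm) model
    \<Rightarrow> ('s, 'f, 'r, 'm) model \<Rightarrow> bool" where
  "elementary_sub L A B \<longleftrightarrow>
     is_structure L A \<and> is_structure L B \<and> univ A \<subseteq> univ B \<and>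
     (\<forall>a \<in> univ A. sort_of A a = sort_of B a) \<and>
     (\<forall>f. \<forall>as \<in> tuples A (farity L f). fint A f as = fint B f as) \<and>
     (\<forall>r. \<forall>as \<in> tuples A (rarity L r). rint A r as = rint B r as) \<and>
     (\<forall>\<phi> \<in> formulas L A UNIV {}. \<forall>e \<in> assignments A. sat A e \<phi> \<longleftrightarrow> sat B e \<phi>)"

text \<open>
  Simultaneous substitution. It is not capture avoiding in general, but below the substituted
  terms contain no variable other than the one they replace, so that no capture can occur.
\<close>

fun tm_subst :: "('s var \<Rightarrow> ('s, 'f, 'm) tm) \<Rightarrow> ('s, 'f, 'm) tm \<Rightarrow> ('s, 'f, 'm) tm" where
  "tm_subst \<sigma> (Var v) = \<sigma> v"
| "tm_subst \<sigma> (Cst a) = Cst a"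
| "tm_subst \<sigma> (App f ts) = App f (map (tm_subst \<sigma>) ts)"

fun subst :: "('s var \<Rightarrow> ('s, 'f, 'm) tm) \<Rightarrow> ('s, 'f, 'r, 'm) fm \<Rightarrow> ('s, 'f, 'r, 'm) fm" where
  "subst \<sigma> (Eq t u) = Eq (tm_subst \<sigma> t) (tm_subst \<sigma> u)"
| "subst \<sigma> (Rel r ts) = Rel r (map (tm_subst \<sigma>) ts)"
| "subst \<sigma> (Neg \<phi>) = Neg (subst \<sigma> \<phi>)"
| "subst \<sigma> (Conj \<phi> \<psi>) = Conj (subst \<sigma> \<phi>) (subst \<sigma> \<psi>)"
| "subst \<sigma> (Ex v \<phi>) = Ex v (subst (\<sigma>(v := Var v)) \<phi>)"


section \<open>Types and monster models\<close>

definition xvar :: "('s, 'f, 'r) language \<Rightarrow> 's var" where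
  "xvar L = (gsort L, 0)"

abbreviation gelems :: "('s, 'f, 'r) language \<Rightarrow> ('s, 'f, 'r, 'm) model \<Rightarrow> 'm set" where
  "gelems L G \<equiv> sort_elems G (gsort L)"

text \<open>
  \<open>S_Y(A)\<close>: the complete types over \<open>A\<close>, computed in \<open>G\<close>, in the variables \<open>Y\<close> (a finite
  set \<open>Y\<close> represents a finite tuple of variables).
\<close>

definition types :: "('s, 'f, 'r) language \<Rightarrow> ('s, 'f, 'r, 'm) model \<Rightarrow> 's var set \<Rightarrow> 'm set
    \<Rightarrow> ('s, 'f, 'r, 'm) fm set set" where
  "types L G Y A = {p. p \<subseteq> formulas L G Y A \<and>
     (\<forall>\<Phi>. finite \<Phi> \<and> \<Phi> \<subseteq> p \<longrightarrow> (\<exists>e \<in> assignments G. \<forall>\<phi> \<in> \<Phi>. sat G e \<phi>)) \<and>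
     (\<forall>\<phi> \<in> formulas L G Y A. \<phi> \<in> p \<or> Neg \<phi> \<in> p)}"

text \<open>
  The type over \<open>A\<close> of the tuple that \<open>e\<close> assigns to \<open>Y\<close>. In the single variable
  \<open>xvar L\<close> the assignment \<open>\<lambda>_. a\<close> represents the element \<open>a\<close>.
\<close>

definition tp :: "('s, 'f, 'r) language \<Rightarrow> ('s, 'f, 'r, 'm) model \<Rightarrow> 's var set \<Rightarrow> 'm set
    \<Rightarrow> ('s var \<Rightarrow> 'm) \<Rightarrow> ('s, 'f, 'r, 'm) fm set" where
  "tp L G Y A e = {\<phi> \<in> formulas L G Y A. sat G e \<phi>}"

definition realizes :: "('s, 'f, 'r, 'm) model \<Rightarrow> ('s var \<Rightarrow> 'm) \<Rightarrow> ('s, 'f, 'r, 'm) fm set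
    \<Rightarrow> bool" where
  "realizes G e p \<longleftrightarrow> (\<forall>\<phi> \<in> p. sat G e \<phi>)"

abbreviation xtypes :: "('s, 'f, 'r) language \<Rightarrow> ('s, 'f, 'r, 'm) model \<Rightarrow> 'm set
    \<Rightarrow> ('s, 'f, 'r, 'm) fm set set" where
  "xtypes L G A \<equiv> types L G {xvar L} A"

definition type_topology :: "('s, 'f, 'r) language \<Rightarrow> ('s, 'f, 'r, 'm) model \<Rightarrow> 's var set
    \<Rightarrow> 'm set \<Rightarrow> ('s, 'f, 'r, 'm) fm set topology" where
  "type_topology L G Y A =
     topology_generated_by ((\<lambda>\<phi>. {p \<in> types L G Y A. \<phi> \<in> p}) ` formulas L G Y A)"

definition saturated :: "'k rel \<Rightarrow> ('s, 'f, 'r) language \<Rightarrow> ('s, 'f, 'r, 'm) model \<Rightarrow> bool" where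
  "saturated \<kappa> L G \<longleftrightarrow>
     (\<forall>A Y p. A \<subseteq> univ G \<and> |A| <o \<kappa> \<and> finite Y \<and> p \<in> types L G Y A
        \<longrightarrow> (\<exists>e \<in> assignments G. realizes G e p))"

text \<open>
  \<open>G\<close> is a \<open>\<kappa>\<close>-saturated model of \<open>T\<close>, where \<open>\<kappa>\<close> is larger than the number of
  formulas of the language (hence uncountable). A set is small if it has fewer than \<open>\<kappa>\<close>
  elements. Homogeneity is not required: invariance below is expressed through equality of
  types over \<open>M\<close> rather than through automorphisms.
\<close>

definition monster :: "('s, 'f, 'r) language \<Rightarrow> ('s, 'f, 'r, 'm) fm set \<Rightarrow> 'k rel
    \<Rightarrow> ('s, 'f, 'r, 'm) model \<Rightarrow> bool" where
  "monster L T \<kappa> G \<longleftrightarrow>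
     is_structure L G \<and>
     T \<subseteq> formulas L G {} {} \<and> (\<forall>\<phi> \<in> T. \<forall>e \<in> assignments G. sat G e \<phi>) \<and>
     Card_order \<kappa> \<and> |formulas L G UNIV {}| <o \<kappa> \<and> saturated \<kappa> L G"

definition gmul :: "('s, 'f, 'r) language \<Rightarrow> ('s, 'f, 'r, 'm) model \<Rightarrow> 'm \<Rightarrow> 'm \<Rightarrow> 'm" where
  "gmul L G a b = fint G (mul L) [a, b]"

definition group_expansion :: "('s, 'f, 'r) language \<Rightarrow> ('s, 'f, 'r, 'm) model \<Rightarrow> bool" where
  "group_expansion L G \<longleftrightarrow>
     farity L (mul L) = [gsort L, gsort L] \<and> fsort L (mul L) = gsort L \<and>
     (\<exists>e. Group.group \<lparr>carrier = gelems L G, mult = gmul L G, one = e\<rparr>)"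

text \<open>The small elementary submodels \<open>M\<close> of \<open>G\<close>, given by their universes.\<close>

definition small_model :: "'k rel \<Rightarrow> ('s, 'f, 'r) language \<Rightarrow> ('s, 'f, 'r, 'm) model \<Rightarrow> 'm set
    \<Rightarrow> bool" where
  "small_model \<kappa> L G M \<longleftrightarrow> elementary_sub L (G\<lparr>univ := M\<rparr>) G \<and> |M| <o \<kappa>"

text \<open>\<open>\<phi>(x; b)\<close> and \<open>\<phi>(x \<cdot> d)\<close>.\<close>

definition plug :: "('s, 'f, 'r) language \<Rightarrow> ('s var \<Rightarrow> 'm) \<Rightarrow> ('s, 'f, 'r, 'm) fm
    \<Rightarrow> ('s, 'f, 'r, 'm) fm" where
  "plug L b \<phi> = subst (\<lambda>v. if v = xvar L then Var v else Cst (b v)) \<phi>"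

definition shift :: "('s, 'f, 'r) language \<Rightarrow> 'm \<Rightarrow> ('s, 'f, 'r, 'm) fm
    \<Rightarrow> ('s, 'f, 'r, 'm) fm" where
  "shift L d \<phi> = subst (\<lambda>v. if v = xvar L then App (mul L) [Var v, Cst d] else Var v) \<phi>"

definition invariant :: "('s, 'f, 'r) language \<Rightarrow> ('s, 'f, 'r, 'm) model \<Rightarrow> 'm set
    \<Rightarrow> ('s, 'f, 'r, 'm) fm set \<Rightarrow> bool" where
  "invariant L G M p \<longleftrightarrow>
     (\<forall>Y. finite Y \<and> xvar L \<notin> Y \<longrightarrow>
       (\<forall>\<phi> \<in> formulas L G (insert (xvar L) Y) {}.
         \<forall>b \<in> assignments G. \<forall>b' \<in> assignments G.
           tp L G Y M b = tp L G Y M b' \<longrightarrow> (plug L b \<phi> \<in> p \<longleftrightarrow> plug L b' \<phi> \<in> p)))"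


section \<open>Keisler measures\<close>

definition solutions :: "('s, 'f, 'r) language \<Rightarrow> ('s, 'f, 'r, 'm) model \<Rightarrow> ('s, 'f, 'r, 'm) fm
    \<Rightarrow> 'm set" where
  "solutions L G \<phi> = {a \<in> gelems L G. sat G (\<lambda>_. a) \<phi>}"

text \<open>
  A measure is a function on formulas; only its values on formulas in the variable
  \<open>xvar L\<close> over \<open>A\<close> matter, and these depend on the formula only up to equivalence. Hence
  the restriction of a measure to a smaller parameter set is represented by the same function.
\<close>

definition keisler_measure :: "('s, 'f, 'r) language \<Rightarrow> ('s, 'f, 'r, 'm) model \<Rightarrow> 'm set
    \<Rightarrow> (('s, 'f, 'r, 'm) fm \<Rightarrow> real) \<Rightarrow> bool" where
  "keisler_measure L G A \<mu> \<longleftrightarrow>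
     (\<forall>\<phi> \<in> formulas L G {xvar L} A. 0 \<le> \<mu> \<phi>) \<and>
     (\<forall>\<phi> \<in> formulas L G {xvar L} A. solutions L G \<phi> = gelems L G \<longrightarrow> \<mu> \<phi> = 1) \<and>
     (\<forall>\<phi> \<in> formulas L G {xvar L} A. \<forall>\<psi> \<in> formulas L G {xvar L} A.
        solutions L G \<phi> = solutions L G \<psi> \<longrightarrow> \<mu> \<phi> = \<mu> \<psi>) \<and>
     (\<forall>\<phi> \<in> formulas L G {xvar L} A. \<forall>\<psi> \<in> formulas L G {xvar L} A.
        solutions L G \<phi> \<inter> solutions L G \<psi> = {} \<longrightarrow> \<mu> (Disj \<phi> \<psi>) = \<mu> \<phi> + \<mu> \<psi>)"

definition supp :: "('s, 'f, 'r) language \<Rightarrow> ('s, 'f, 'r, 'm) model \<Rightarrow> 'm set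
    \<Rightarrow> (('s, 'f, 'r, 'm) fm \<Rightarrow> real) \<Rightarrow> ('s, 'f, 'r, 'm) fm set set" where
  "supp L G A \<mu> = {p \<in> xtypes L G A. \<forall>\<phi> \<in> p. 0 < \<mu> \<phi>}"

definition definable :: "'k rel \<Rightarrow> ('s, 'f, 'r) language \<Rightarrow> ('s, 'f, 'r, 'm) model
    \<Rightarrow> (('s, 'f, 'r, 'm) fm \<Rightarrow> real) \<Rightarrow> bool" where
  "definable \<kappa> L G \<mu> \<longleftrightarrow>
     (\<exists>M. small_model \<kappa> L G M \<and>
       (\<forall>Y. finite Y \<and> xvar L \<notin> Y \<longrightarrow>
         (\<forall>\<phi> \<in> formulas L G (insert (xvar L) Y) M.
           (\<forall>b \<in> assignments G. \<forall>b' \<in> assignments G.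
              tp L G Y M b = tp L G Y M b' \<longrightarrow> \<mu> (plug L b \<phi>) = \<mu> (plug L b' \<phi>)) \<and>
           continuous_map (type_topology L G Y M) (top_of_set {0..1})
             (\<lambda>q. \<mu> (plug L (SOME b. b \<in> assignments G \<and> tp L G Y M b = q) \<phi>)))))"

definition invariantly_supported :: "'k rel \<Rightarrow> ('s, 'f, 'r) language
    \<Rightarrow> ('s, 'f, 'r, 'm) model \<Rightarrow> (('s, 'f, 'r, 'm) fm \<Rightarrow> real) \<Rightarrow> bool" where
  "invariantly_supported \<kappa> L G \<mu> \<longleftrightarrow>
     (\<exists>M. small_model \<kappa> L G M \<and> (\<forall>p \<in> supp L G (univ G) \<mu>. invariant L G M p))"


section \<open>Convolution\<close>

definition borel_types :: "('s, 'f, 'r) language \<Rightarrow> ('s, 'f, 'r, 'm) model \<Rightarrow> 'm set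
    \<Rightarrow> ('s, 'f, 'r, 'm) fm set measure" where
  "borel_types L G A = sigma (xtypes L G A) {U. openin (type_topology L G {xvar L} A) U}"

definition regular :: "'a topology \<Rightarrow> 'a measure \<Rightarrow> bool" where
  "regular X m \<longleftrightarrow>
     (\<forall>B \<in> sets m.
        emeasure m B = (SUP K \<in> {K. closedin X K \<and> K \<subseteq> B}. emeasure m K) \<and>
        emeasure m B = (INF U \<in> {U. openin X U \<and> B \<subseteq> U}. emeasure m U))"

definition borel_measure :: "('s, 'f, 'r) language \<Rightarrow> ('s, 'f, 'r, 'm) model \<Rightarrow> 'm set
    \<Rightarrow> (('s, 'f, 'r, 'm) fm \<Rightarrow> real) \<Rightarrow> ('s, 'f, 'r, 'm) fm set measure" where
  "borel_measure L G A \<mu> =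
     (THE m. prob_space m \<and> sets m = sets (borel_types L G A) \<and>
        regular (type_topology L G {xvar L} A) m \<and>
        (\<forall>\<phi> \<in> formulas L G {xvar L} A. measure m {p \<in> xtypes L G A. \<phi> \<in> p} = \<mu> \<phi>))"

definition fiber_value :: "('s, 'f, 'r) language \<Rightarrow> ('s, 'f, 'r, 'm) model
    \<Rightarrow> (('s, 'f, 'r, 'm) fm \<Rightarrow> real) \<Rightarrow> ('s, 'f, 'r, 'm) fm \<Rightarrow> ('s, 'f, 'r, 'm) fm set
    \<Rightarrow> real" where
  "fiber_value L G \<mu> \<phi> q =
     \<mu> (shift L (SOME d. d \<in> gelems L G \<and> realizes G (\<lambda>_. d) q) \<phi>)"

text \<open>
  \<open>N\<close> witnesses that \<open>(\<mu>, \<nu>)\<close> is \<open>*\<close>-Borel at \<open>\<phi>\<close>. Types in the variable of \<open>\<nu>\<close> are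
  written in the variable \<open>xvar L\<close> as well.
\<close>

definition star_borel_at :: "'k rel \<Rightarrow> ('s, 'f, 'r) language \<Rightarrow> ('s, 'f, 'r, 'm) model
    \<Rightarrow> (('s, 'f, 'r, 'm) fm \<Rightarrow> real) \<Rightarrow> (('s, 'f, 'r, 'm) fm \<Rightarrow> real) \<Rightarrow> ('s, 'f, 'r, 'm) fm
    \<Rightarrow> 'm set \<Rightarrow> bool" where
  "star_borel_at \<kappa> L G \<mu> \<nu> \<phi> N \<longleftrightarrow>
     small_model \<kappa> L G N \<and> params \<phi> \<subseteq> N \<and>
     (\<forall>q \<in> supp L G N \<nu>. \<forall>d \<in> gelems L G. \<forall>d' \<in> gelems L G.
        realizes G (\<lambda>_. d) q \<and> realizes G (\<lambda>_. d') q \<longrightarrow>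
        \<mu> (shift L d \<phi>) = \<mu> (shift L d' \<phi>)) \<and>
     fiber_value L G \<mu> \<phi> \<in>
       borel_measurable (restrict_space (borel_types L G N) (supp L G N \<nu>))"

definition star_borel :: "'k rel \<Rightarrow> ('s, 'f, 'r) language \<Rightarrow> ('s, 'f, 'r, 'm) model
    \<Rightarrow> (('s, 'f, 'r, 'm) fm \<Rightarrow> real) \<Rightarrow> (('s, 'f, 'r, 'm) fm \<Rightarrow> real) \<Rightarrow> bool" where
  "star_borel \<kappa> L G \<mu> \<nu> \<longleftrightarrow>
     (\<forall>\<phi> \<in> formulas L G {xvar L} (univ G). \<exists>N. star_borel_at \<kappa> L G \<mu> \<nu> \<phi> N)"

text \<open>The value does not depend on the choice of the model \<open>N\<close>.\<close>

definition convolution :: "'k rel \<Rightarrow> ('s, 'f, 'r) language \<Rightarrow> ('s, 'f, 'r, 'm) model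
    \<Rightarrow> (('s, 'f, 'r, 'm) fm \<Rightarrow> real) \<Rightarrow> (('s, 'f, 'r, 'm) fm \<Rightarrow> real) \<Rightarrow> ('s, 'f, 'r, 'm) fm
    \<Rightarrow> real" where
  "convolution \<kappa> L G \<mu> \<nu> \<phi> =
     (let N = (SOME N. star_borel_at \<kappa> L G \<mu> \<nu> \<phi> N)
      in \<integral>q. fiber_value L G \<mu> \<phi> q \<partial>restrict_space (borel_measure L G N \<nu>) (supp L G N \<nu>))"

definition idempotent :: "'k rel \<Rightarrow> ('s, 'f, 'r) language \<Rightarrow> ('s, 'f, 'r, 'm) model
    \<Rightarrow> (('s, 'f, 'r, 'm) fm \<Rightarrow> real) \<Rightarrow> bool" where
  "idempotent \<kappa> L G \<mu> \<longleftrightarrow>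
     star_borel \<kappa> L G \<mu> \<mu> \<and>
     (\<forall>\<phi> \<in> formulas L G {xvar L} (univ G). convolution \<kappa> L G \<mu> \<mu> \<phi> = \<mu> \<phi>)"


section \<open>Product of invariant types\<close>

text \<open>
  \<open>U\<close> is a larger monster model extending \<open>G\<close>, and \<open>p'\<close> is the extension of \<open>p\<close> to an
  \<open>M\<close>-invariant type over \<open>U\<close>. The resulting type over \<open>G\<close> depends only on \<open>p\<close> and
  \<open>q\<close>, which justifies the definite description.
\<close>

definition type_prod :: "'k rel \<Rightarrow> ('s, 'f, 'r) language \<Rightarrow> ('s, 'f, 'r, 'm) model
    \<Rightarrow> ('s, 'f, 'r, 'm) model \<Rightarrow> ('s, 'f, 'r, 'm) fm set \<Rightarrow> ('s, 'f, 'r, 'm) fm set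
    \<Rightarrow> ('s, 'f, 'r, 'm) fm set" where
  "type_prod \<kappa> L G U p q =
     (THE r. \<exists>M p' a b.
        small_model \<kappa> L G M \<and> invariant L G M p \<and> invariant L G M q \<and>
        p' \<in> xtypes L U (univ U) \<and> invariant L U M p' \<and> p \<subseteq> p' \<and>
        b \<in> gelems L U \<and> realizes U (\<lambda>_. b) q \<and>
        a \<in> gelems L U \<and>
        realizes U (\<lambda>_. a) (p' \<inter> formulas L U {xvar L} (insert b (univ G))) \<and>
        r = tp L U {xvar L} (univ G) (\<lambda>_. gmul L U a b))"

definition two_sided_ideal :: "('a \<Rightarrow> 'a \<Rightarrow> 'a) \<Rightarrow> 'a set \<Rightarrow> 'a set \<Rightarrow> bool" where
  "two_sided_ideal f S I \<longleftrightarrow>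
     I \<noteq> {} \<and> I \<subseteq> S \<and> (\<forall>p \<in> S. \<forall>q \<in> I. f p q \<in> I \<and> f q p \<in> I)"

end

theory Submission
  imports Defs
begin

text \<open>
  The support \<open>S(\<mu>)\<close> is treated as in Glicksberg's theorem on idempotent measures on compact semigroups.
  For a formula \<open>\<phi>\<close>, idempotence says that \<open>\<mu> \<phi>\<close> is the average over \<open>S(\<mu>)\<close> of the values
  \<open>f q = \<mu> (\<phi>(x \<cdot> d))\<close>, where \<open>d\<close> realizes \<open>q\<close>. Applied to the formula \<open>\<phi>(x \<cdot> d)\<close> it says that \<open>f q\<close> is the
  average of \<open>f (p * q)\<close> over \<open>p\<close> in \<open>S(\<mu>)\<close>. By definability \<open>f\<close> is continuous, so if \<open>f\<close> is maximal at \<open>q\<close>,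
  then \<open>f (p * q) = f q\<close> for every \<open>p\<close> in \<open>S(\<mu>)\<close>.

  Let \<open>I\<close> be a closed two-sided ideal different from \<open>S(\<mu>)\<close>. There is a formula \<open>\<phi>\<close> of positive measure that
  belongs to no type in \<open>I\<close>. As \<open>f\<close> has the positive average \<open>\<mu> \<phi>\<close>, its maximum \<open>f q\<close> is positive. For \<open>p\<close> in
  \<open>I\<close> the product \<open>p * q\<close> is in \<open>I\<close>, and so is \<open>p1 * (p * q)\<close> for every \<open>p1\<close> in \<open>S(\<mu>)\<close>; hence \<open>\<phi>\<close> is in no
  \<open>p1 * (p * q)\<close>, which means \<open>f (p * q) = 0\<close>, a contradiction. This is \<open>closed_ideal_eq_support\<close>.

  The argument is carried out with generic elements, the realizations in \<open>G\<close> of types of the support over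
  small sets: \<open>f (p * q)\<close> becomes \<open>\<mu> (\<phi>(x \<cdot> e \<cdot> d))\<close>. Three facts make this possible. A Keisler measure has
  exactly one regular Borel extension to the type space (\<open>stone_premeasure.stone_measure_unique\<close>), so the
  integral defining the convolution can be evaluated; the outcome is \<open>ex_averages\<close>. The formulas \<open>\<phi>(x \<cdot> d)\<close>
  are instances of one formula without parameters (\<open>ex_shift_family\<close>), which brings definability and
  invariance to bear on them. Finally membership in a product of types can be decided in \<open>G\<close>
  (\<open>type_prod_mem\<close>), for which the invariant extension of a type to the larger model has to be constructed.
\<close>



section \<open>Finitely additive measures on Stone spaces\<close>

lemma (in algebra) openin_generated_iff:
  "openin (topology_generated_by M) V \<longleftrightarrow> V \<subseteq> \<Omega> \<and> (\<forall>x\<in>V. \<exists>b\<in>M. x \<in> b \<and> b \<subseteq> V)"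
proof
  assume "openin (topology_generated_by M) V"
  then have "generate_topology_on M V"
    by (rule openin_topology_generated_by)
  then show "V \<subseteq> \<Omega> \<and> (\<forall>x\<in>V. \<exists>b\<in>M. x \<in> b \<and> b \<subseteq> V)"
  proof induction
    case (Int a b)
    have "\<exists>c\<in>M. x \<in> c \<and> c \<subseteq> a \<inter> b" if x: "x \<in> a \<inter> b" for x
    proof -
      from x Int obtain c d where "c \<in> M" "d \<in> M" "x \<in> c" "x \<in> d" "c \<subseteq> a" "d \<subseteq> b"
        by blast
      then show ?thesis by (intro bexI[of _ "c \<inter> d"]) auto
    qed
    with Int show ?case by auto
  next
    case (UN K)
    then show ?case by (meson Sup_least Union_upper UnionE order_trans)
  next
    case (Basis s)
    then show ?case using space_closed by blast
  qed simp
next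
  assume V: "V \<subseteq> \<Omega> \<and> (\<forall>x\<in>V. \<exists>b\<in>M. x \<in> b \<and> b \<subseteq> V)"
  then have "V = \<Union>{b \<in> M. b \<subseteq> V}" by blast
  moreover have "openin (topology_generated_by M) (\<Union>{b \<in> M. b \<subseteq> V})"
    by (intro openin_Union) (auto simp: topology_generated_by_Basis)
  ultimately show "openin (topology_generated_by M) V" by simp
qed

text \<open>
  The situation of a Stone space \<open>\<Omega>\<close>: the clopen algebra \<open>\<B>\<close> is a basis of the topology.
  As every open cover is refined by one consisting of basic sets, \<open>compact\<close> speaks of those.
\<close>
locale stone_premeasure = algebra \<Omega> \<B> for \<Omega> :: "'a set" and \<B> +
  fixes \<mu> :: "'a set \<Rightarrow> real"
  assumes compact: "\<And>\<C>. \<C> \<subseteq> \<B> \<Longrightarrow> \<Omega> \<subseteq> \<Union>\<C> \<Longrightarrow> \<exists>\<D>\<subseteq>\<C>. finite \<D> \<and> \<Omega> \<subseteq> \<Union>\<D>"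
    and nonneg: "\<And>b. b \<in> \<B> \<Longrightarrow> 0 \<le> \<mu> b"
    and add: "\<And>a b. a \<in> \<B> \<Longrightarrow> b \<in> \<B> \<Longrightarrow> a \<inter> b = {} \<Longrightarrow> \<mu> (a \<union> b) = \<mu> a + \<mu> b"
    and total: "\<mu> \<Omega> = 1"
begin

abbreviation X :: "'a topology" where "X \<equiv> topology_generated_by \<B>"

lemmas openin_X_iff = openin_generated_iff

lemma topspace_X: "topspace X = \<Omega>"
  unfolding topology_generated_by_topspace using space_closed top by blast

lemma openin_basic: "b \<in> \<B> \<Longrightarrow> openin X b"
  by (rule topology_generated_by_Basis)

lemma closedin_basic: "b \<in> \<B> \<Longrightarrow> closedin X b"
  unfolding closedin_def topspace_X using space_closed openin_basic compl_sets by auto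

text \<open>A cover of \<open>K\<close> together with the basic sets that miss \<open>K\<close> covers \<open>\<Omega>\<close>.\<close>
lemma closed_cover:
  assumes K: "closedin X K" and C: "\<C> \<subseteq> \<B>" "K \<subseteq> \<Union>\<C>"
  shows "\<exists>\<D>\<subseteq>\<C>. finite \<D> \<and> K \<subseteq> \<Union>\<D>"
proof -
  let ?V = "\<Omega> - K"
  have V: "openin X ?V" using K topspace_X by (simp add: closedin_def)
  let ?\<E> = "\<C> \<union> {b \<in> \<B>. b \<subseteq> ?V}"
  have "\<Omega> \<subseteq> \<Union>?\<E>"
  proof
    fix x assume "x \<in> \<Omega>"
    show "x \<in> \<Union>?\<E>"
    proof (cases "x \<in> K")
      case True
      then show ?thesis using C(2) by auto
    next
      case False
      then obtain b where "b \<in> \<B>" "x \<in> b" "b \<subseteq> ?V"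
        using V \<open>x \<in> \<Omega>\<close> unfolding openin_X_iff by blast
      then show ?thesis by blast
    qed
  qed
  moreover have "?\<E> \<subseteq> \<B>" using C(1) by blast
  ultimately obtain \<D> where D: "\<D> \<subseteq> ?\<E>" "finite \<D>" "\<Omega> \<subseteq> \<Union>\<D>"
    using compact[of ?\<E>] by auto
  have "K \<subseteq> \<Omega>" using K topspace_X closedin_subset by metis
  then have "K \<subseteq> \<Union>(\<D> \<inter> \<C>)" using D by blast
  with D show ?thesis by (intro exI[of _ "\<D> \<inter> \<C>"]) auto
qed

lemma closed_in_open:
  assumes K: "closedin X K" and V: "openin X V" and "K \<subseteq> V"
  shows "\<exists>b\<in>\<B>. K \<subseteq> b \<and> b \<subseteq> V"
proof -
  have "K \<subseteq> \<Union>{b \<in> \<B>. b \<subseteq> V}"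
    using V \<open>K \<subseteq> V\<close> unfolding openin_X_iff by blast
  from closed_cover[OF K _ this] obtain \<D>
    where D: "\<D> \<subseteq> {b \<in> \<B>. b \<subseteq> V}" "finite \<D>" "K \<subseteq> \<Union>\<D>" by auto
  then have "\<Union>\<D> \<in> \<B>" by (intro finite_Union) auto
  with D show ?thesis by blast
qed

lemma mono: "a \<in> \<B> \<Longrightarrow> b \<in> \<B> \<Longrightarrow> a \<subseteq> b \<Longrightarrow> \<mu> a \<le> \<mu> b"
  using add[of a "b - a"] nonneg[of "b - a"] Diff[of b a] by (simp add: Un_absorb1)

lemma empty: "\<mu> {} = 0"
  using add[of "{}" "{}"] by simp

lemma subadd: "a \<in> \<B> \<Longrightarrow> b \<in> \<B> \<Longrightarrow> \<mu> (a \<union> b) \<le> \<mu> a + \<mu> b"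
  using add[of a "b - a"] mono[of "b - a" b] Diff[of b a] by simp

lemma subadd_finite:
  assumes "\<And>i. i \<in> J \<Longrightarrow> b i \<in> \<B>" "finite J"
  shows "\<mu> (\<Union>i\<in>J. b i) \<le> (\<Sum>i\<in>J. \<mu> (b i))"
  using assms(2,1)
proof (induction J)
  case (insert j J)
  have "\<mu> (\<Union>i\<in>insert j J. b i) \<le> \<mu> (b j) + \<mu> (\<Union>i\<in>J. b i)"
    using subadd[of "b j" "\<Union>i\<in>J. b i"] insert by auto
  with insert show ?case by auto
qed (simp add: empty)

text \<open>
  In a regular extension of \<open>\<mu>\<close> the measure of an open set is the supremum over the basic sets inside
  it, because a compact subset of an open set lies in a basic one; outer regularity then fixes the
  measure of every other set. These forced values are taken as the definition.
\<close>
definition inner :: "'a set \<Rightarrow> ennreal" where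
  "inner V = (SUP b\<in>{b\<in>\<B>. b \<subseteq> V}. ennreal (\<mu> b))"

definition outer :: "'a set \<Rightarrow> ennreal" where
  "outer E = (INF V\<in>{V. openin X V \<and> E \<subseteq> V}. inner V)"

lemma inner_upper: "b \<in> \<B> \<Longrightarrow> b \<subseteq> V \<Longrightarrow> ennreal (\<mu> b) \<le> inner V"
  unfolding inner_def by (rule SUP_upper) auto

lemma inner_mono: "V \<subseteq> W \<Longrightarrow> inner V \<le> inner W"
  unfolding inner_def by (rule SUP_subset_mono) auto

lemma inner_basic: "b \<in> \<B> \<Longrightarrow> inner b = ennreal (\<mu> b)"
  by (rule antisym) (auto simp: inner_def intro!: SUP_least SUP_upper ennreal_leI mono)

lemma outer_open: "openin X V \<Longrightarrow> outer V = inner V"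
  unfolding outer_def by (rule antisym) (auto intro!: INF_lower INF_greatest inner_mono)

lemma outer_mono: "E \<subseteq> F \<Longrightarrow> outer E \<le> outer F"
  unfolding outer_def by (rule INF_superset_mono) auto

text \<open>
  A basic set inside the union is compact, so it is covered by finitely many basic sets, each inside
  one \<open>V i\<close>; collecting those that belong to the same index reduces the claim to finite subadditivity.
\<close>
lemma inner_countable_subadditive:
  assumes V: "\<And>i::nat. openin X (V i)"
  shows "inner (\<Union>i. V i) \<le> (\<Sum>i. inner (V i))"
  unfolding inner_def[of "\<Union>i. V i"]
proof (rule SUP_least)
  fix b assume "b \<in> {b \<in> \<B>. b \<subseteq> (\<Union>i. V i)}"
  then have b: "b \<in> \<B>" "b \<subseteq> (\<Union>i. V i)" by auto
  let ?\<C> = "{c \<in> \<B>. \<exists>i. c \<subseteq> V i}"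
  have "b \<subseteq> \<Union>?\<C>"
  proof
    fix x assume "x \<in> b"
    then obtain i where "x \<in> V i" using b by auto
    then show "x \<in> \<Union>?\<C>" using V[of i] unfolding openin_X_iff by blast
  qed
  from closed_cover[OF closedin_basic[OF b(1)] _ this] obtain \<D>
    where D: "\<D> \<subseteq> ?\<C>" "finite \<D>" "b \<subseteq> \<Union>\<D>" by auto
  then have "\<forall>c\<in>\<D>. \<exists>i. c \<subseteq> V i" by auto
  then obtain k where k: "\<And>c. c \<in> \<D> \<Longrightarrow> c \<subseteq> V (k c)" by metis
  define d where "d i = \<Union>{c \<in> \<D>. k c = i}" for i
  have d: "d i \<in> \<B>" "d i \<subseteq> V i" for i
  proof -
    show "d i \<in> \<B>" using D unfolding d_def by (intro finite_Union) auto
    show "d i \<subseteq> V i" unfolding d_def using k by blast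
  qed
  have bd: "b \<subseteq> (\<Union>i\<in>k ` \<D>. d i)"
  proof
    fix x assume "x \<in> b"
    then obtain c where "c \<in> \<D>" "x \<in> c" using D(3) by auto
    then show "x \<in> (\<Union>i\<in>k ` \<D>. d i)" by (auto simp: d_def intro!: bexI[of _ c])
  qed
  have "\<mu> b \<le> \<mu> (\<Union>i\<in>k ` \<D>. d i)"
    using bd b d D by (intro mono) auto
  also have "\<dots> \<le> (\<Sum>i\<in>k ` \<D>. \<mu> (d i))"
    using d D by (intro subadd_finite) auto
  finally have "ennreal (\<mu> b) \<le> ennreal (\<Sum>i\<in>k ` \<D>. \<mu> (d i))"
    by (rule ennreal_leI)
  also have "\<dots> = (\<Sum>i\<in>k ` \<D>. ennreal (\<mu> (d i)))"
    using nonneg d by (simp add: sum_ennreal)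
  also have "\<dots> \<le> (\<Sum>i\<in>k ` \<D>. inner (V i))"
    using d by (intro sum_mono inner_upper) auto
  also have "\<dots> \<le> (\<Sum>i. inner (V i))"
    using D by (intro sum_le_suminf) auto
  finally show "ennreal (\<mu> b) \<le> (\<Sum>i. inner (V i))" .
qed

lemma inner_finite: "inner V \<le> 1" if "V \<subseteq> \<Omega>"
  unfolding inner_def
proof (rule SUP_least)
  fix b assume "b \<in> {b \<in> \<B>. b \<subseteq> V}"
  then have "\<mu> b \<le> \<mu> \<Omega>" using that by (intro mono) auto
  then show "ennreal (\<mu> b) \<le> 1" using total by simp
qed

lemma outer_approx:
  assumes "E \<subseteq> \<Omega>" "0 < \<epsilon>"
  shows "\<exists>V. openin X V \<and> E \<subseteq> V \<and> inner V \<le> outer E + ennreal \<epsilon>"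
proof -
  have "outer E \<le> inner \<Omega>"
    unfolding outer_def using assms openin_basic[OF top] by (intro INF_lower) simp
  also have "\<dots> \<le> 1" by (rule inner_finite) simp
  finally have fin: "outer E < \<infinity>" using order_le_less_trans by force
  then have "outer E < outer E + ennreal \<epsilon>"
    using assms(2) by (simp add: ennreal_add_left_cancel_less[of _ 0, simplified])
  then obtain V where "openin X V" "E \<subseteq> V" "inner V < outer E + ennreal \<epsilon>"
    unfolding outer_def[of E] by (auto simp: INF_less_iff)
  then show ?thesis by (intro exI[of _ V]) auto
qed

lemma outer_measure_space_outer: "outer_measure_space (Pow \<Omega>) outer"
  unfolding outer_measure_space_def
proof (intro conjI)
  have "outer {} = ennreal (\<mu> {})"
    using outer_open[of "{}"] inner_basic[of "{}"] by simp
  then show "positive (Pow \<Omega>) outer" by (simp add: positive_def empty)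
  show "increasing (Pow \<Omega>) outer" by (auto simp: increasing_def outer_mono)
  show "countably_subadditive (Pow \<Omega>) outer"
    unfolding countably_subadditive_def
  proof safe
    fix E :: "nat \<Rightarrow> 'a set" assume E: "range E \<subseteq> Pow \<Omega>"
    show "outer (\<Union>i. E i) \<le> (\<Sum>i. outer (E i))"
    proof (rule ennreal_le_epsilon)
      fix \<epsilon> :: real assume e: "0 < \<epsilon>"
      have "\<exists>V. openin X V \<and> E i \<subseteq> V \<and> inner V \<le> outer (E i) + ennreal (\<epsilon> * (1/2) ^ Suc i)" for i
        using E e by (intro outer_approx) auto
      then obtain V where V: "\<And>i. openin X (V i)" "\<And>i. E i \<subseteq> V i"
        "\<And>i. inner (V i) \<le> outer (E i) + ennreal (\<epsilon> * (1/2) ^ Suc i)" by metis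
      have "outer (\<Union>i. E i) \<le> outer (\<Union>i. V i)"
        using V by (intro outer_mono) blast
      also have "\<dots> = inner (\<Union>i. V i)"
        using V by (intro outer_open) auto
      also have "\<dots> \<le> (\<Sum>i. inner (V i))"
        using V by (intro inner_countable_subadditive)
      also have "\<dots> \<le> (\<Sum>i. outer (E i) + ennreal (\<epsilon> * (1/2) ^ Suc i))"
        using V by (intro suminf_le) auto
      also have "\<dots> = (\<Sum>i. outer (E i)) + (\<Sum>i. ennreal (\<epsilon> * (1/2) ^ Suc i))"
        by (rule suminf_add[symmetric]) auto
      also have "(\<Sum>i. ennreal (\<epsilon> * (1/2) ^ Suc i)) = ennreal \<epsilon>"
        using sums_mult[OF power_half_series, of \<epsilon>] e
        by (intro suminf_ennreal_eq) auto
      finally show "outer (\<Union>i. E i) \<le> (\<Sum>i. outer (E i)) + ennreal \<epsilon>" .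
    qed
  qed
qed

text \<open>
  If a basic set \<open>b\<close> inside \<open>V \<inter> W\<close> nearly exhausts it, then \<open>V - b\<close> is open since \<open>b\<close> is clopen, and
  it contains \<open>V - W\<close>; so additivity of \<open>\<mu>\<close> on basic sets applies.
\<close>
lemma inner_split:
  assumes V: "openin X V" and W: "openin X W"
  shows "outer (V \<inter> W) + outer (V - W) \<le> inner V"
proof -
  have VW: "openin X (V \<inter> W)" using V W by auto
  have *: "ennreal (\<mu> b) + outer (V - W) \<le> inner V" if b: "b \<in> \<B>" "b \<subseteq> V \<inter> W" for b
  proof -
    have op: "openin X (V - b)"
      using V b by (intro openin_diff closedin_basic) auto
    have "ennreal (\<mu> b) + ennreal (\<mu> c) \<le> inner V" if c: "c \<in> \<B>" "c \<subseteq> V - b" for c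
    proof -
      have "ennreal (\<mu> b) + ennreal (\<mu> c) = ennreal (\<mu> (b \<union> c))"
        using b c add[of b c] nonneg[of b] nonneg[of c]
        by (metis Diff_disjoint disjoint_iff ennreal_plus subsetD)
      also have "\<dots> \<le> inner V" using b c by (intro inner_upper) auto
      finally show ?thesis .
    qed
    then have "ennreal (\<mu> b) + inner (V - b) \<le> inner V"
      unfolding inner_def[of "V - b"]
      by (subst ennreal_SUP_add_right) (auto intro!: SUP_least)
    moreover have "outer (V - W) \<le> inner (V - b)"
      using outer_mono[of "V - W" "V - b"] b outer_open[OF op] by auto
    ultimately show ?thesis by (meson add_left_mono order_trans)
  qed
  then have "inner (V \<inter> W) + outer (V - W) \<le> inner V"
    unfolding inner_def[of "V \<inter> W"]
    by (subst ennreal_SUP_add_left[symmetric]) (auto intro!: SUP_least)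
  then show ?thesis using outer_open[OF VW] by simp
qed

lemma open_lambda_system:
  assumes W: "openin X W"
  shows "W \<in> lambda_system \<Omega> (Pow \<Omega>) outer"
proof -
  interpret P: sigma_algebra \<Omega> "Pow \<Omega>" by (rule sigma_algebra_Pow)
  have "outer (E \<inter> W) + outer (E - W) = outer E" if E: "E \<subseteq> \<Omega>" for E
  proof (rule antisym)
    show "outer (E \<inter> W) + outer (E - W) \<le> outer E"
      unfolding outer_def[of E]
    proof (rule INF_greatest)
      fix V assume "V \<in> {V. openin X V \<and> E \<subseteq> V}"
      then have V: "openin X V" "E \<subseteq> V" by auto
      have "outer (E \<inter> W) + outer (E - W) \<le> outer (V \<inter> W) + outer (V - W)"
        using V by (intro add_mono outer_mono) auto
      also have "\<dots> \<le> inner V" using V W by (intro inner_split)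
      finally show "outer (E \<inter> W) + outer (E - W) \<le> inner V" .
    qed
    have "subadditive (Pow \<Omega>) outer"
      using outer_measure_space_outer P.countably_subadditive_subadditive
      unfolding outer_measure_space_def by blast
    then show "outer E \<le> outer (E \<inter> W) + outer (E - W)"
      using E subadditiveD[of "Pow \<Omega>" outer "E \<inter> W" "E - W"]
      by (auto simp: Int_Diff_Un Int_Diff_disjoint)
  qed
  then show ?thesis
    using W openin_subset[OF W] topspace_X
    by (auto simp: P.lambda_system_eq)
qed

abbreviation opens :: "'a set set" where "opens \<equiv> {V. openin X V}"

definition stone_measure :: "'a measure" where
  "stone_measure = measure_of \<Omega> opens outer"

lemma opens_Pow: "opens \<subseteq> Pow \<Omega>"
  using openin_subset topspace_X by fastforce

lemma sets_stone_measure: "sets stone_measure = sigma_sets \<Omega> opens"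
  and space_stone_measure: "space stone_measure = \<Omega>"
  using opens_Pow by (auto simp: stone_measure_def)

lemma emeasure_stone_measure:
  assumes "E \<in> sigma_sets \<Omega> opens"
  shows "emeasure stone_measure E = outer E"
proof -
  have mls: "measure_space \<Omega> (lambda_system \<Omega> (Pow \<Omega>) outer) outer"
    by (rule sigma_algebra.caratheodory_lemma[OF sigma_algebra_Pow outer_measure_space_outer])
  then have "sigma_algebra \<Omega> (lambda_system \<Omega> (Pow \<Omega>) outer)" by (simp add: measure_space_def)
  then have "sigma_sets \<Omega> opens \<subseteq> lambda_system \<Omega> (Pow \<Omega>) outer"
    by (rule sigma_algebra.sigma_sets_subset) (auto simp: open_lambda_system)
  then have "measure_space \<Omega> (sigma_sets \<Omega> opens) outer"
    by (rule measure_down[OF mls sigma_algebra_sigma_sets[OF opens_Pow]])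
  then show ?thesis
    using assms opens_Pow unfolding measure_space_def
    by (subst emeasure_measure_of[OF stone_measure_def])
      (auto simp: sets_stone_measure)
qed

lemma emeasure_open: "openin X V \<Longrightarrow> emeasure stone_measure V = inner V"
  by (simp add: emeasure_stone_measure outer_open)

lemma emeasure_basic: "b \<in> \<B> \<Longrightarrow> emeasure stone_measure b = ennreal (\<mu> b)"
  by (simp add: emeasure_open openin_basic inner_basic)

lemma prob_space_stone_measure: "prob_space stone_measure"
  using emeasure_basic[OF top] total by (intro prob_spaceI) (simp add: space_stone_measure)

text \<open>Inner regularity at \<open>B\<close> is outer regularity at the complement of \<open>B\<close>.\<close>
lemma regular_stone_measure: "regular X stone_measure"
  unfolding regular_def
proof (intro ballI conjI)
  interpret S: prob_space stone_measure by (rule prob_space_stone_measure)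
  have outer_reg: "emeasure stone_measure B = (INF V \<in> {V. openin X V \<and> B \<subseteq> V}. emeasure stone_measure V)"
    if "B \<in> sigma_sets \<Omega> opens" for B
    unfolding emeasure_stone_measure[OF that] outer_def
    by (intro INF_cong) (auto simp: emeasure_open)
  fix B assume B: "B \<in> sets stone_measure"
  then show "emeasure stone_measure B = (INF V \<in> {V. openin X V \<and> B \<subseteq> V}. emeasure stone_measure V)"
    using outer_reg by (simp add: sets_stone_measure)
  have B\<Omega>: "B \<subseteq> \<Omega>" using B sets.sets_into_space space_stone_measure by metis
  show "emeasure stone_measure B = (SUP K \<in> {K. closedin X K \<and> K \<subseteq> B}. emeasure stone_measure K)"
  proof (rule antisym)
    show "(SUP K \<in> {K. closedin X K \<and> K \<subseteq> B}. emeasure stone_measure K) \<le> emeasure stone_measure B"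
      using B by (auto intro!: SUP_least emeasure_mono)
    show "emeasure stone_measure B \<le> (SUP K \<in> {K. closedin X K \<and> K \<subseteq> B}. emeasure stone_measure K)"
    proof (rule ennreal_le_epsilon)
      fix \<epsilon> :: real assume e: "0 < \<epsilon>"
      have CB: "\<Omega> - B \<in> sets stone_measure"
        using B space_stone_measure by (metis sets.compl_sets)
      obtain V where V: "openin X V" "\<Omega> - B \<subseteq> V" "inner V \<le> outer (\<Omega> - B) + ennreal \<epsilon>"
        using outer_approx[of "\<Omega> - B" \<epsilon>] e by auto
      define K where "K = \<Omega> - V"
      have V\<Omega>: "V \<subseteq> \<Omega>" using V(1) openin_X_iff by blast
      have K: "closedin X K" "K \<subseteq> B"
        using V topspace_X V\<Omega> by (auto simp: K_def closedin_def double_diff)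
      have Vs: "V \<in> sets stone_measure" using V by (simp add: sets_stone_measure)
      have "emeasure stone_measure V \<le> emeasure stone_measure (\<Omega> - B) + ennreal \<epsilon>"
        using V CB by (simp add: emeasure_open emeasure_stone_measure sets_stone_measure)
      then have "measure stone_measure V \<le> measure stone_measure (\<Omega> - B) + \<epsilon>"
        using e by (simp add: S.emeasure_eq_measure flip: ennreal_plus)
      moreover have "measure stone_measure (\<Omega> - B) = 1 - measure stone_measure B"
        using S.prob_compl[OF B] by (simp add: space_stone_measure)
      moreover have "measure stone_measure K = 1 - measure stone_measure V"
        using S.prob_compl[OF Vs] by (simp add: space_stone_measure K_def)
      ultimately have "measure stone_measure B \<le> measure stone_measure K + \<epsilon>" by simp
      then have "emeasure stone_measure B \<le> emeasure stone_measure K + ennreal \<epsilon>"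
        using e by (simp add: S.emeasure_eq_measure flip: ennreal_plus)
      also have "\<dots> \<le> (SUP K \<in> {K. closedin X K \<and> K \<subseteq> B}. emeasure stone_measure K) + ennreal \<epsilon>"
        using K by (intro add_right_mono SUP_upper) auto
      finally show "emeasure stone_measure B \<le> (SUP K \<in> {K. closedin X K \<and> K \<subseteq> B}. emeasure stone_measure K) + ennreal \<epsilon>" .
    qed
  qed
qed

lemma regular_open:
  assumes m: "prob_space m" "sets m = sigma_sets \<Omega> opens" "regular X m"
    "\<And>b. b \<in> \<B> \<Longrightarrow> measure m b = \<mu> b" and V: "openin X V"
  shows "emeasure m V = inner V"
proof -
  interpret m: prob_space m by fact
  have bs: "b \<in> sets m" "emeasure m b = ennreal (\<mu> b)" if "b \<in> \<B>" for b
    using that m openin_basic by (auto simp: m.emeasure_eq_measure)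
  have "emeasure m V = (SUP K \<in> {K. closedin X K \<and> K \<subseteq> V}. emeasure m K)"
    using m(2,3) V unfolding regular_def by auto
  also have "\<dots> = inner V"
  proof (rule antisym)
    show "(SUP K \<in> {K. closedin X K \<and> K \<subseteq> V}. emeasure m K) \<le> inner V"
    proof (rule SUP_least)
      fix K assume "K \<in> {K. closedin X K \<and> K \<subseteq> V}"
      then have "\<exists>b\<in>\<B>. K \<subseteq> b \<and> b \<subseteq> V" using V by (intro closed_in_open) auto
      then obtain b where b: "b \<in> \<B>" "K \<subseteq> b" "b \<subseteq> V" by auto
      then have "emeasure m K \<le> emeasure m b" using bs by (intro emeasure_mono) auto
      also have "\<dots> \<le> inner V" using b bs inner_upper by simp
      finally show "emeasure m K \<le> inner V" .
    qed
    show "inner V \<le> (SUP K \<in> {K. closedin X K \<and> K \<subseteq> V}. emeasure m K)"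
      unfolding inner_def
    proof (rule SUP_mono)
      fix b assume "b \<in> {b \<in> \<B>. b \<subseteq> V}"
      then show "\<exists>K\<in>{K. closedin X K \<and> K \<subseteq> V}. ennreal (\<mu> b) \<le> emeasure m K"
        using bs closedin_basic by (intro bexI[of _ b]) auto
    qed
  qed
  finally show ?thesis .
qed

lemma stone_measure_unique:
  assumes m: "prob_space m" "sets m = sets (sigma \<Omega> opens)" "regular X m"
    "\<And>b. b \<in> \<B> \<Longrightarrow> measure m b = \<mu> b"
  shows "m = stone_measure"
proof (rule measure_eqI)
  have s: "sets m = sigma_sets \<Omega> opens"
    using m(2) opens_Pow by simp
  then show "sets m = sets stone_measure" by (simp add: sets_stone_measure)
  fix B assume B: "B \<in> sets m"
  have "emeasure m B = (INF V \<in> {V. openin X V \<and> B \<subseteq> V}. emeasure m V)"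
    using m(3) B unfolding regular_def by blast
  also have "\<dots> = outer B"
    unfolding outer_def using m s by (intro INF_cong) (auto intro!: regular_open)
  also have "\<dots> = emeasure stone_measure B"
    using B s by (intro emeasure_stone_measure[symmetric]) auto
  finally show "emeasure m B = emeasure stone_measure B" .
qed

lemma measure_basic: "b \<in> \<B> \<Longrightarrow> measure stone_measure b = \<mu> b"
  by (simp add: measure_def emeasure_basic nonneg)

end



section \<open>Substitution and change of variables\<close>

lemma tm_val_cong: "(\<And>v. v \<in> tm_fv t \<Longrightarrow> e v = e' v) \<Longrightarrow> tm_val H e t = tm_val H e' t"
proof (induction t)
  case (App f ts)
  then have "map (tm_val H e) ts = map (tm_val H e') ts" by (intro map_cong) auto
  then show ?case by (simp only: tm_val.simps)
qed auto

lemma sat_cong: "(\<And>v. v \<in> fv \<phi> \<Longrightarrow> e v = e' v) \<Longrightarrow> sat H e \<phi> \<longleftrightarrow> sat H e' \<phi>"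
proof (induction \<phi> arbitrary: e e')
  case (Eq t u)
  have "tm_val H e t = tm_val H e' t" using Eq.prems by (intro tm_val_cong) auto
  moreover have "tm_val H e u = tm_val H e' u" using Eq.prems by (intro tm_val_cong) auto
  ultimately show ?case by simp
next
  case (Rel r ts)
  then have "map (tm_val H e) ts = map (tm_val H e') ts"
    by (intro map_cong tm_val_cong) auto
  then show ?case by (simp only: sat.simps)
next
  case (Conj \<phi> \<psi>)
  have "sat H e \<phi> \<longleftrightarrow> sat H e' \<phi>" using Conj.prems by (intro Conj.IH(1)) auto
  moreover have "sat H e \<psi> \<longleftrightarrow> sat H e' \<psi>" using Conj.prems by (intro Conj.IH(2)) auto
  ultimately show ?case by simp
next
  case (Ex v \<phi>)
  have "sat H (e(v := a)) \<phi> \<longleftrightarrow> sat H (e'(v := a)) \<phi>" for a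
    using Ex.prems by (intro Ex.IH) auto
  then show ?case by simp
next
  case (Neg \<phi>)
  have "sat H e \<phi> \<longleftrightarrow> sat H e' \<phi>" using Neg.prems by (intro Neg.IH) auto
  then show ?case by simp
qed

lemma tm_val_subst: "tm_val H e (tm_subst \<sigma> t) = tm_val H (\<lambda>v. tm_val H e (\<sigma> v)) t"
  by (induction t) (auto simp: comp_def cong: map_cong)

text \<open>No variable is captured, since the term put for a variable contains no other variable.\<close>
lemma sat_subst:
  assumes "\<And>v. tm_fv (\<sigma> v) \<subseteq> {v}"
  shows "sat H e (subst \<sigma> \<phi>) \<longleftrightarrow> sat H (\<lambda>v. tm_val H e (\<sigma> v)) \<phi>"
  using assms
proof (induction \<phi> arbitrary: e \<sigma>)
  case (Ex w \<phi>)
  have eq: "(\<lambda>v. tm_val H (e(w := a)) ((\<sigma>(w := Var w)) v)) = (\<lambda>v. tm_val H e (\<sigma> v))(w := a)" for a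
  proof
    fix v
    show "tm_val H (e(w := a)) ((\<sigma>(w := Var w)) v) = ((\<lambda>v. tm_val H e (\<sigma> v))(w := a)) v"
      using Ex.prems[of v] by (auto intro!: tm_val_cong)
  qed
  have "tm_fv ((\<sigma>(w := Var w)) v) \<subseteq> {v}" for v using Ex.prems by auto
  from Ex.IH[OF this] have "sat H (e(w := a)) (subst (\<sigma>(w := Var w)) \<phi>)
      \<longleftrightarrow> sat H ((\<lambda>v. tm_val H e (\<sigma> v))(w := a)) \<phi>" for a
    by (simp only: eq)
  then show ?case by simp
qed (simp_all add: tm_val_subst comp_def)

lemma has_sort_subst:
  "has_sort L so t s \<Longrightarrow> (\<And>v. has_sort L so (\<sigma> v) (fst v)) \<Longrightarrow> has_sort L so (tm_subst \<sigma> t) s"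
proof (induction t arbitrary: s)
  case (App f ts)
  then show ?case by (auto simp: list_all2_conv_all_nth)
qed auto

lemma well_sorted_subst:
  "well_sorted L so \<phi> \<Longrightarrow> (\<And>v. has_sort L so (\<sigma> v) (fst v)) \<Longrightarrow> well_sorted L so (subst \<sigma> \<phi>)"
proof (induction \<phi> arbitrary: \<sigma>)
  case (Eq t u)
  then show ?case using has_sort_subst[of L so _ _ \<sigma>] by (simp only: well_sorted.simps subst.simps) blast
next
  case (Rel r ts)
  then show ?case by (auto simp: list_all2_conv_all_nth intro: has_sort_subst)
qed auto

lemma tm_fv_subst: "tm_fv (tm_subst \<sigma> t) = (\<Union>v\<in>tm_fv t. tm_fv (\<sigma> v))"
  by (induction t) auto

lemma tm_params_subst: "tm_params (tm_subst \<sigma> t) = tm_params t \<union> (\<Union>v\<in>tm_fv t. tm_params (\<sigma> v))"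
  by (induction t) auto

lemma fv_subst: "(\<And>v. tm_fv (\<sigma> v) \<subseteq> {v}) \<Longrightarrow> fv (subst \<sigma> \<phi>) \<subseteq> (\<Union>v\<in>fv \<phi>. tm_fv (\<sigma> v))"
proof (induction \<phi> arbitrary: \<sigma>)
  case (Conj \<phi>1 \<phi>2)
  then show ?case by fastforce
next
  case (Ex w \<phi>)
  then have "fv (subst (\<sigma>(w := Var w)) \<phi>) \<subseteq> (\<Union>v\<in>fv \<phi>. tm_fv ((\<sigma>(w := Var w)) v))"
    by (intro Ex.IH) auto
  also have "\<dots> \<subseteq> insert w (\<Union>v\<in>fv \<phi> - {w}. tm_fv (\<sigma> v))"
    by (auto split: if_splits)
  finally show ?case unfolding subst.simps fv.simps by blast
qed (auto simp: tm_fv_subst)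

lemma params_subst: "params (subst \<sigma> \<phi>) \<subseteq> params \<phi> \<union> (\<Union>v\<in>fv \<phi>. tm_params (\<sigma> v))"
proof (induction \<phi> arbitrary: \<sigma>)
  case (Conj \<phi>1 \<phi>2)
  then show ?case by fastforce
next
  case (Ex w \<phi>)
  have "(\<Union>v\<in>fv \<phi>. tm_params ((\<sigma>(w := Var w)) v)) \<subseteq> (\<Union>v\<in>fv \<phi> - {w}. tm_params (\<sigma> v))"
    by (auto split: if_splits)
  then show ?case using Ex.IH[of "\<sigma>(w := Var w)"] unfolding subst.simps params.simps fv.simps by blast
qed (auto simp: tm_params_subst)

lemma finite_tm_params: "finite (tm_params t)" by (induction t) auto
lemma finite_params: "finite (params \<phi>)" by (induction \<phi>) (auto simp: finite_tm_params)
lemma finite_tm_fv: "finite (tm_fv t)" by (induction t) auto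
lemma finite_fv: "finite (fv \<phi>)" by (induction \<phi>) (auto simp: finite_tm_fv)

fun bv :: "('s, 'f, 'r, 'm) fm \<Rightarrow> 's var set" where
  "bv (Eq t u) = {}"
| "bv (Rel r ts) = {}"
| "bv (Neg \<phi>) = bv \<phi>"
| "bv (Conj \<phi> \<psi>) = bv \<phi> \<union> bv \<psi>"
| "bv (Ex v \<phi>) = insert v (bv \<phi>)"

lemma finite_bv: "finite (bv \<phi>)" by (induction \<phi>) auto

text \<open>
  \<open>abstract k\<close> replaces every parameter \<open>a\<close> by the variable \<open>k a\<close>. Plugging \<open>a\<close> back in for \<open>k a\<close>
  undoes this as long as the new variables are not bound in the formula.
\<close>
fun tm_abstract :: "('m \<Rightarrow> 's var) \<Rightarrow> ('s, 'f, 'm) tm \<Rightarrow> ('s, 'f, 'm) tm" where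
  "tm_abstract k (Var v) = Var v"
| "tm_abstract k (Cst a) = Var (k a)"
| "tm_abstract k (App f ts) = App f (map (tm_abstract k) ts)"

fun abstract :: "('m \<Rightarrow> 's var) \<Rightarrow> ('s, 'f, 'r, 'm) fm \<Rightarrow> ('s, 'f, 'r, 'm) fm" where
  "abstract k (Eq t u) = Eq (tm_abstract k t) (tm_abstract k u)"
| "abstract k (Rel r ts) = Rel r (map (tm_abstract k) ts)"
| "abstract k (Neg \<phi>) = Neg (abstract k \<phi>)"
| "abstract k (Conj \<phi> \<psi>) = Conj (abstract k \<phi>) (abstract k \<psi>)"
| "abstract k (Ex v \<phi>) = Ex v (abstract k \<phi>)"

lemma tm_abstract_simps:
  "tm_params (tm_abstract k t) = {}"
  "tm_fv (tm_abstract k t) = tm_fv t \<union> k ` tm_params t"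
  by (induction t) auto

lemma params_abstract: "params (abstract k \<phi>) = {}"
  by (induction \<phi>) (auto simp: tm_abstract_simps)

lemma fv_abstract: "fv (abstract k \<phi>) \<subseteq> fv \<phi> \<union> k ` params \<phi>"
  by (induction \<phi>) (auto simp: tm_abstract_simps)

lemma has_sort_abstract:
  "has_sort L so t s \<Longrightarrow> (\<And>c. fst (k c) = so c) \<Longrightarrow> has_sort L so' (tm_abstract k t) s"
proof (induction t arbitrary: s)
  case (App f ts)
  then show ?case by (auto simp: list_all2_conv_all_nth)
qed auto

lemma well_sorted_abstract:
  "well_sorted L so \<phi> \<Longrightarrow> (\<And>c. fst (k c) = so c) \<Longrightarrow> well_sorted L so' (abstract k \<phi>)"
proof (induction \<phi>)
  case (Eq t u)
  then show ?case by (auto intro: has_sort_abstract)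
next
  case (Rel r ts)
  then show ?case using has_sort_abstract[of L so _ _ k so']
    by (auto simp: list_all2_conv_all_nth)
qed auto

lemma tm_val_abstract:
  "(\<And>c. c \<in> tm_params t \<Longrightarrow> e (k c) = c) \<Longrightarrow> tm_val H e (tm_abstract k t) = tm_val H e t"
proof (induction t)
  case (App f ts)
  then have "map (tm_val H e) (map (tm_abstract k) ts) = map (tm_val H e) ts"
    unfolding map_map comp_def by (intro map_cong) auto
  then show ?case by (simp only: tm_val.simps tm_abstract.simps)
qed auto

lemma sat_abstract:
  "(\<And>c. c \<in> params \<phi> \<Longrightarrow> e (k c) = c) \<Longrightarrow> k ` params \<phi> \<inter> bv \<phi> = {} \<Longrightarrow>
    sat H e (abstract k \<phi>) \<longleftrightarrow> sat H e \<phi>"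
proof (induction \<phi> arbitrary: e)
  case (Eq t u)
  then show ?case by (simp add: tm_val_abstract)
next
  case (Rel r ts)
  then have "map (tm_val H e) (map (tm_abstract k) ts) = map (tm_val H e) ts"
    unfolding map_map comp_def by (intro map_cong) (auto intro!: tm_val_abstract)
  then show ?case by (simp only: sat.simps abstract.simps)
next
  case (Conj \<phi>1 \<phi>2)
  have "sat H e (abstract k \<phi>1) \<longleftrightarrow> sat H e \<phi>1" using Conj.prems by (intro Conj.IH(1)) auto
  moreover have "sat H e (abstract k \<phi>2) \<longleftrightarrow> sat H e \<phi>2" using Conj.prems by (intro Conj.IH(2)) auto
  ultimately show ?case by simp
next
  case (Ex v \<phi>)
  have "sat H (e(v := a)) (abstract k \<phi>) \<longleftrightarrow> sat H (e(v := a)) \<phi>" for a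
    using Ex.prems by (intro Ex.IH) auto
  then show ?case by simp
qed auto

lemma ex_fresh_naming:
  fixes V :: "'s var set" and so :: "'m \<Rightarrow> 's"
  assumes "finite F" "finite V"
  shows "\<exists>k. inj_on k F \<and> k ` F \<inter> V = {} \<and> (\<forall>c. fst (k c) = so c)"
proof -
  obtain f :: "'m \<Rightarrow> nat" where f: "inj_on f F"
    using finite_imp_inj_to_nat_seg[OF assms(1)] by blast
  have "\<exists>n. \<forall>i\<in>snd ` V. i < n"
    using finite_nat_set_iff_bounded[of "snd ` V"] assms(2) by auto
  then obtain n where n: "\<And>v. v \<in> V \<Longrightarrow> snd v < n" by auto
  define k where "k c = (so c, n + f c)" for c
  have "inj_on k F" using f by (auto simp: inj_on_def k_def)
  moreover have "k ` F \<inter> V = {}" using n by (fastforce simp: k_def)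
  moreover have "fst (k c) = so c" for c by (simp add: k_def)
  ultimately show ?thesis by blast
qed

lemma ex_fresh_var:
  fixes V :: "'s var set"
  assumes "finite V" shows "\<exists>v. v \<notin> V \<and> fst v = s"
proof -
  obtain k :: "unit \<Rightarrow> 's var" where "k ` {()} \<inter> V = {}" "\<forall>c. fst (k c) = s"
    using ex_fresh_naming[OF _ assms, of "{()}" "\<lambda>_. s"] by blast
  then show ?thesis by (intro exI[of _ "k ()"]) blast
qed

lemma ex_naming_assignment:
  assumes k: "inj_on k F" "\<And>u. fst (k u) = sort_of K u" and F: "F \<subseteq> univ K"
    and e: "e \<in> assignments K"
  shows "\<exists>c\<in>assignments K. (\<forall>u\<in>F. c (k u) = u) \<and> (\<forall>v. v \<notin> k ` F \<longrightarrow> c v = e v)"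
proof -
  define c where "c v = (if v \<in> k ` F then inv_into F k v else e v)" for v
  have ck: "c (k u) = u" if "u \<in> F" for u using that k(1) by (auto simp: c_def)
  have "c \<in> assignments K"
    unfolding assignments_def
  proof safe
    fix s n
    show "c (s, n) \<in> sort_elems K (fst (s, n))"
    proof (cases "(s, n) \<in> k ` F")
      case True
      then obtain u where "(s, n) = k u" "u \<in> F" by auto
      then show ?thesis using ck[of u] F k(2)[of u] by (auto simp: sort_elems_def)
    next
      case False
      then show ?thesis using e by (simp add: c_def assignments_def)
    qed
  qed
  then show ?thesis using ck by (intro bexI[of _ c]) (auto simp: c_def)
qed

lemma formulasI: "well_sorted L (sort_of G) \<phi> \<Longrightarrow> fv \<phi> \<subseteq> Y \<Longrightarrow> params \<phi> \<subseteq> A \<Longrightarrow> \<phi> \<in> formulas L G Y A"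
  by (simp add: formulas_def)

lemma formulas_mono: "\<phi> \<in> formulas L G Y A \<Longrightarrow> Y \<subseteq> Y' \<Longrightarrow> A \<subseteq> A' \<Longrightarrow> \<phi> \<in> formulas L G Y' A'"
  by (auto simp: formulas_def)

lemma formulas_Neg [simp]: "Neg \<phi> \<in> formulas L G Y A \<longleftrightarrow> \<phi> \<in> formulas L G Y A"
  and formulas_Conj [simp]: "Conj \<phi> \<psi> \<in> formulas L G Y A \<longleftrightarrow> \<phi> \<in> formulas L G Y A \<and> \<psi> \<in> formulas L G Y A"
  and formulas_Ex: "Ex v \<phi> \<in> formulas L G Y A \<longleftrightarrow> \<phi> \<in> formulas L G (insert v Y) A"
  by (auto simp: formulas_def)

text \<open>A sentence that holds in every structure, since no sort is empty.\<close>
definition truth :: "('s, 'f, 'r) language \<Rightarrow> ('s, 'f, 'r, 'm) fm" where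
  "truth L = Ex (xvar L) (Eq (Var (xvar L)) (Var (xvar L)))"

lemma truth_formulas [simp]: "truth L \<in> formulas L G Y A"
  by (auto simp: formulas_def truth_def)

lemma sat_truth [simp]: "is_structure L H \<Longrightarrow> sat H e (truth L)"
  by (auto simp: truth_def is_structure_def)

lemma ex_finite_conj:
  assumes "finite \<Phi>" "\<Phi> \<subseteq> formulas L G Y A"
  shows "\<exists>\<psi>\<in>formulas L G Y A. \<forall>(H :: ('s, 'f, 'r, 'm) model) e.
    is_structure L H \<longrightarrow> (sat H e \<psi> \<longleftrightarrow> (\<forall>\<phi>\<in>\<Phi>. sat H e \<phi>))"
  using assms
proof (induction \<Phi>)
  case empty
  show ?case by (intro bexI[of _ "truth L"]) auto
next
  case (insert \<phi> \<Phi>)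
  then obtain \<psi> where "\<psi>\<in>formulas L G Y A" "\<And>(H :: ('s, 'f, 'r, 'm) model) e.
    is_structure L H \<Longrightarrow> (sat H e \<psi> \<longleftrightarrow> (\<forall>\<phi>\<in>\<Phi>. sat H e \<phi>))" by auto
  with insert.prems show ?case by (intro bexI[of _ "Conj \<phi> \<psi>"]) auto
qed

text \<open>
  Substituting \<open>g y\<close> for \<open>y\<close> could capture. Binding \<open>y\<close> and equating it with \<open>g y\<close> has the intended
  meaning whatever variables are bound further inside.
\<close>
lemma ex_rename:
  fixes \<phi> :: "('s, 'f, 'r, 'm) fm"
  assumes "finite Y" "\<And>y. y \<in> Y \<Longrightarrow> fst (g y) = fst y" "\<And>y. y \<in> Y \<Longrightarrow> g y \<notin> Y"
    and "\<phi> \<in> formulas L G Z A"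
  shows "\<exists>\<psi>\<in>formulas L G ((Z - Y) \<union> g ` Y) A. \<forall>(H :: ('s, 'f, 'r, 'm) model) e.
    e \<in> assignments H \<longrightarrow> (sat H e \<psi> \<longleftrightarrow> sat H (\<lambda>v. if v \<in> Y then e (g v) else e v) \<phi>)"
  using assms
proof (induction Y)
  case empty
  then show ?case by auto
next
  case (insert y Y)
  then obtain \<psi> where \<psi>: "\<psi> \<in> formulas L G ((Z - Y) \<union> g ` Y) A" "\<And>(H :: ('s, 'f, 'r, 'm) model) e.
    e \<in> assignments H \<Longrightarrow> (sat H e \<psi> \<longleftrightarrow> sat H (\<lambda>v. if v \<in> Y then e (g v) else e v) \<phi>)"
    by auto
  let ?\<theta> = "Ex y (Conj (Eq (Var y) (Var (g y))) \<psi>)"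
  have "?\<theta> \<in> formulas L G ((Z - insert y Y) \<union> g ` insert y Y) A"
    using \<psi>(1) insert.prems(1)[of y] by (auto simp: formulas_def)
  moreover have "sat H e ?\<theta> \<longleftrightarrow> sat H (\<lambda>v. if v \<in> insert y Y then e (g v) else e v) \<phi>"
    if e: "e \<in> assignments H" for H :: "('s, 'f, 'r, 'm) model" and e
  proof -
    have y: "y \<noteq> g y" using insert.prems(2)[of y] by auto
    have gy: "e (g y) \<in> sort_elems H (fst y)"
      using e insert.prems(1)[of y] unfolding assignments_def by (metis (mono_tags, lifting) insertI1 mem_Collect_eq)
    have e': "e(y := e (g y)) \<in> assignments H"
      using e gy by (auto simp: assignments_def)
    have "sat H e ?\<theta> \<longleftrightarrow> sat H (e(y := e (g y))) \<psi>" using gy y by auto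
    also have "\<dots> \<longleftrightarrow> sat H (\<lambda>v. if v \<in> Y then (e(y := e (g y))) (g v) else (e(y := e (g y))) v) \<phi>"
      by (rule \<psi>(2)[OF e'])
    also have "(\<lambda>v. if v \<in> Y then (e(y := e (g y))) (g v) else (e(y := e (g y))) v)
      = (\<lambda>v. if v \<in> insert y Y then e (g v) else e v)"
      using insert.prems(2) insert.hyps by (auto simp: fun_eq_iff)
    finally show ?thesis .
  qed
  ultimately show ?case by blast
qed

text \<open>The same device puts the value of a term in place of a variable.\<close>
lemma ex_term_for_var:
  fixes \<phi> :: "('s, 'f, 'r, 'm) fm"
  assumes \<phi>: "\<phi> \<in> formulas L G Z A" and t: "has_sort L (sort_of G) t (fst x)" "tm_fv t \<subseteq> W" "tm_params t \<subseteq> A"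
    and "finite W"
  shows "\<exists>\<psi>\<in>formulas L G ((Z - {x}) \<union> W) A. \<forall>(H :: ('s, 'f, 'r, 'm) model) e.
    e \<in> assignments H \<longrightarrow> tm_val H e t \<in> sort_elems H (fst x) \<longrightarrow>
      (sat H e \<psi> \<longleftrightarrow> sat H (e(x := tm_val H e t)) \<phi>)"
proof -
  obtain x' where x': "x' \<notin> insert x W \<union> fv \<phi>" "fst x' = fst x"
    using ex_fresh_var[of "insert x W \<union> fv \<phi>" "fst x"] \<open>finite W\<close> finite_fv by blast
  let ?\<psi> = "Ex x' (Conj (Eq (Var x') t) (Ex x (Conj (Eq (Var x) (Var x')) \<phi>)))"
  have "?\<psi> \<in> formulas L G ((Z - {x}) \<union> W) A"
    using \<phi> t x' by (auto simp: formulas_def)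
  moreover have "sat H e ?\<psi> \<longleftrightarrow> sat H (e(x := tm_val H e t)) \<phi>"
    if e: "e \<in> assignments H" and val: "tm_val H e t \<in> sort_elems H (fst x)"
    for H :: "('s, 'f, 'r, 'm) model" and e
  proof -
    have *: "tm_val H (e(x' := a)) t = tm_val H e t" for a
      using t x' by (intro tm_val_cong) auto
    have "sat H e ?\<psi> \<longleftrightarrow> sat H (e(x' := tm_val H e t, x := tm_val H e t)) \<phi>"
      using val x' * by auto
    also have "\<dots> \<longleftrightarrow> sat H (e(x := tm_val H e t)) \<phi>"
      using x' by (intro sat_cong) auto
    finally show ?thesis .
  qed
  ultimately show ?thesis by blast
qed

section \<open>Types and saturation\<close>

definition finitely_satisfiable :: "('s, 'f, 'r, 'm) model \<Rightarrow> ('s, 'f, 'r, 'm) fm set \<Rightarrow> bool" where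
  "finitely_satisfiable H \<Gamma> \<longleftrightarrow>
    (\<forall>\<Phi>. finite \<Phi> \<and> \<Phi> \<subseteq> \<Gamma> \<longrightarrow> (\<exists>e \<in> assignments H. \<forall>\<phi> \<in> \<Phi>. sat H e \<phi>))"

lemma types_iff: "p \<in> types L G Y A \<longleftrightarrow> p \<subseteq> formulas L G Y A \<and> finitely_satisfiable G p \<and>
    (\<forall>\<phi> \<in> formulas L G Y A. \<phi> \<in> p \<or> Neg \<phi> \<in> p)"
  by (simp add: types_def finitely_satisfiable_def)

lemma finitely_satisfiableD:
  "finitely_satisfiable H \<Gamma> \<Longrightarrow> finite \<Phi> \<Longrightarrow> \<Phi> \<subseteq> \<Gamma> \<Longrightarrow> \<exists>e\<in>assignments H. \<forall>\<phi>\<in>\<Phi>. sat H e \<phi>"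
  by (simp add: finitely_satisfiable_def)

lemma not_finitely_satisfiableE:
  assumes "\<not> finitely_satisfiable H \<Gamma>"
  obtains \<Phi> where "finite \<Phi>" "\<Phi> \<subseteq> \<Gamma>" "\<forall>e\<in>assignments H. \<exists>\<theta>\<in>\<Phi>. \<not> sat H e \<theta>"
proof -
  from assms obtain \<Phi> where "finite \<Phi>" "\<Phi> \<subseteq> \<Gamma>" "\<not> (\<exists>e\<in>assignments H. \<forall>\<phi>\<in>\<Phi>. sat H e \<phi>)"
    by (auto simp: finitely_satisfiable_def)
  then show thesis by (intro that[of \<Phi>]) auto
qed

lemma finitely_satisfiable_insert:
  assumes \<Delta>: "finitely_satisfiable H \<Delta>"
  shows "finitely_satisfiable H (insert \<phi> \<Delta>) \<or> finitely_satisfiable H (insert (Neg \<phi>) \<Delta>)"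
proof (rule ccontr)
  assume neg: "\<not> ?thesis"
  then have *: "\<not> finitely_satisfiable H (insert \<phi> \<Delta>)" "\<not> finitely_satisfiable H (insert (Neg \<phi>) \<Delta>)"
    by auto
  obtain \<Phi> where 1: "finite \<Phi>" "\<Phi> \<subseteq> insert \<phi> \<Delta>" "\<forall>e\<in>assignments H. \<exists>\<theta>\<in>\<Phi>. \<not> sat H e \<theta>"
    using *(1) by (rule not_finitely_satisfiableE)
  obtain \<Psi> where 2: "finite \<Psi>" "\<Psi> \<subseteq> insert (Neg \<phi>) \<Delta>"
      "\<forall>e\<in>assignments H. \<exists>\<theta>\<in>\<Psi>. \<not> sat H e \<theta>"
    using *(2) by (rule not_finitely_satisfiableE)
  let ?\<Delta> = "(\<Phi> - {\<phi>}) \<union> (\<Psi> - {Neg \<phi>})"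
  have "finite ?\<Delta>" using 1(1) 2(1) by simp
  moreover have "?\<Delta> \<subseteq> \<Delta>" using 1(2) 2(2) by blast
  ultimately have "\<exists>e\<in>assignments H. \<forall>\<theta>\<in>?\<Delta>. sat H e \<theta>"
    using \<Delta> unfolding finitely_satisfiable_def by (elim allE[of _ ?\<Delta>]) simp
  then obtain e where e: "e \<in> assignments H" "\<forall>\<theta>\<in>?\<Delta>. sat H e \<theta>" by (rule bexE)
  show False
  proof (cases "sat H e \<phi>")
    case True
    obtain \<theta> where "\<theta> \<in> \<Phi>" "\<not> sat H e \<theta>" using bspec[OF 1(3) e(1)] by blast
    then show False using e(2) True by (cases "\<theta> = \<phi>") auto
  next
    case False
    obtain \<theta> where "\<theta> \<in> \<Psi>" "\<not> sat H e \<theta>" using bspec[OF 2(3) e(1)] by blast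
    then show False using e(2) False by (cases "\<theta> = Neg \<phi>") auto
  qed
qed

lemma finitely_satisfiable_mono: "finitely_satisfiable H \<Delta> \<Longrightarrow> \<Gamma> \<subseteq> \<Delta> \<Longrightarrow> finitely_satisfiable H \<Gamma>"
  unfolding finitely_satisfiable_def by (meson subset_trans)

text \<open>
  A maximal finitely satisfiable set of formulas is complete, because one of \<open>\<phi>\<close> and \<open>Neg \<phi>\<close> can
  always be added.
\<close>
lemma ex_type_extending:
  assumes "\<Gamma> \<subseteq> formulas L H Y A" "finitely_satisfiable H \<Gamma>"
  shows "\<exists>p\<in>types L H Y A. \<Gamma> \<subseteq> p"
proof -
  let ?\<A> = "{\<Delta>. \<Gamma> \<subseteq> \<Delta> \<and> \<Delta> \<subseteq> formulas L H Y A \<and> finitely_satisfiable H \<Delta>}"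
  have "\<exists>M\<in>?\<A>. \<forall>X\<in>?\<A>. M \<subseteq> X \<longrightarrow> X = M"
  proof (rule subset_Zorn_nonempty)
    show "?\<A> \<noteq> {}" using assms by blast
    fix \<C> assume C: "\<C> \<noteq> {}" "subset.chain ?\<A> \<C>"
    then have sub: "\<C> \<subseteq> ?\<A>" by (simp add: subset_chain_def)
    have "finitely_satisfiable H (\<Union>\<C>)"
      unfolding finitely_satisfiable_def
    proof safe
      fix \<Phi> assume "finite \<Phi>" "\<Phi> \<subseteq> \<Union>\<C>"
      then obtain \<Delta> where "\<Delta> \<in> \<C>" "\<Phi> \<subseteq> \<Delta>"
        using finite_subset_Union_chain[of \<Phi> \<C> ?\<A>] C by blast
      then show "\<exists>e\<in>assignments H. \<forall>\<phi>\<in>\<Phi>. sat H e \<phi>"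
        using sub \<open>finite \<Phi>\<close> unfolding finitely_satisfiable_def by blast
    qed
    then show "\<Union>\<C> \<in> ?\<A>" using C(1) sub by blast
  qed
  then obtain p where p: "\<Gamma> \<subseteq> p" "p \<subseteq> formulas L H Y A" "finitely_satisfiable H p"
    and max: "\<And>X. X \<in> ?\<A> \<Longrightarrow> p \<subseteq> X \<Longrightarrow> X = p" by auto
  have "\<phi> \<in> p \<or> Neg \<phi> \<in> p" if "\<phi> \<in> formulas L H Y A" for \<phi>
    using finitely_satisfiable_insert[OF p(3), of \<phi>]
  proof
    assume "finitely_satisfiable H (insert \<phi> p)"
    then have "insert \<phi> p = p" using p that by (intro max) auto
    then show ?thesis by auto
  next
    assume "finitely_satisfiable H (insert (Neg \<phi>) p)"
    then have "insert (Neg \<phi>) p = p" using p that by (intro max) auto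
    then show ?thesis by auto
  qed
  then show ?thesis using p by (auto simp: types_iff)
qed

lemma saturated_realize:
  assumes "saturated \<kappa> L H" "A \<subseteq> univ H" "|A| <o \<kappa>" "finite Y"
    "\<Gamma> \<subseteq> formulas L H Y A" "finitely_satisfiable H \<Gamma>"
  shows "\<exists>e\<in>assignments H. \<forall>\<phi>\<in>\<Gamma>. sat H e \<phi>"
proof -
  obtain p where "p \<in> types L H Y A" "\<Gamma> \<subseteq> p"
    using ex_type_extending[OF assms(5,6)] by blast
  then show ?thesis using assms(1-4) unfolding saturated_def realizes_def by (meson subsetD)
qed

lemma types_Neg_iff:
  assumes "p \<in> types L G Y A" "\<phi> \<in> formulas L G Y A"
  shows "Neg \<phi> \<in> p \<longleftrightarrow> \<phi> \<notin> p"
proof -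
  have "\<not> (\<phi> \<in> p \<and> Neg \<phi> \<in> p)"
  proof
    assume "\<phi> \<in> p \<and> Neg \<phi> \<in> p"
    then have "{\<phi>, Neg \<phi>} \<subseteq> p" by simp
    moreover have "finitely_satisfiable G p" using assms by (simp add: types_iff)
    ultimately have "\<exists>e \<in> assignments G. \<forall>\<theta> \<in> {\<phi>, Neg \<phi>}. sat G e \<theta>"
      by (intro finitely_satisfiableD[of G p]) simp_all
    then show False by auto
  qed
  then show ?thesis using assms by (auto simp: types_def)
qed

lemma types_entails:
  assumes p: "p \<in> types L G Y A" and \<phi>: "\<phi> \<in> formulas L G Y A"
    and "finite \<Phi>" "\<Phi> \<subseteq> p" "\<And>e. e \<in> assignments G \<Longrightarrow> (\<And>\<psi>. \<psi> \<in> \<Phi> \<Longrightarrow> sat G e \<psi>) \<Longrightarrow> sat G e \<phi>"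
  shows "\<phi> \<in> p"
proof (rule ccontr)
  assume "\<phi> \<notin> p"
  then have "insert (Neg \<phi>) \<Phi> \<subseteq> p" using types_Neg_iff[OF p \<phi>] assms by auto
  moreover have "finitely_satisfiable G p" using p by (simp add: types_iff)
  ultimately have "\<exists>e\<in>assignments G. \<forall>\<theta>\<in>insert (Neg \<phi>) \<Phi>. sat G e \<theta>"
    using \<open>finite \<Phi>\<close> by (intro finitely_satisfiableD[of G p]) simp_all
  then obtain e where e: "e \<in> assignments G" "\<forall>\<theta>\<in>insert (Neg \<phi>) \<Phi>. sat G e \<theta>" by (rule bexE)
  have "sat G e \<phi>" by (rule assms(5)[OF e(1)]) (use e(2) in auto)
  then show False using e(2) by auto
qed

lemma tp_in_types: "e \<in> assignments G \<Longrightarrow> tp L G Y A e \<in> types L G Y A"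
  unfolding types_def tp_def by auto



section \<open>Formulas in one group variable\<close>

lemma sat_point:
  assumes "\<phi> \<in> formulas L G {xvar L} A"
  shows "sat H e \<phi> \<longleftrightarrow> sat H (\<lambda>_. e (xvar L)) \<phi>"
  using assms by (intro sat_cong) (auto simp: formulas_def)

lemma sat_point':
  assumes "\<phi> \<in> formulas L G {xvar L} A" "e (xvar L) = a"
  shows "sat H e \<phi> \<longleftrightarrow> sat H (\<lambda>_. a) \<phi>"
  using sat_point[OF assms(1), of H e] assms(2) by simp

lemma assignments_upd: "e \<in> assignments H \<Longrightarrow> a \<in> sort_elems H (fst v) \<Longrightarrow> e(v := a) \<in> assignments H"
  by (auto simp: assignments_def)

lemma assignments_sort: "e \<in> assignments H \<Longrightarrow> e v \<in> sort_elems H (fst v)"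
  by (simp add: assignments_def del: split_paired_All)

lemma ex_assignment:
  assumes "is_structure L H"
  shows "\<exists>e. e \<in> assignments H"
proof -
  have "\<forall>s. \<exists>a. a \<in> sort_elems H s" using assms by (auto simp: is_structure_def)
  then obtain f where "\<forall>s. f s \<in> sort_elems H s" by metis
  then have "(\<lambda>v. f (fst v)) \<in> assignments H" by (auto simp: assignments_def)
  then show ?thesis by blast
qed

lemma ex_assignment_point:
  assumes "is_structure L H" "a \<in> gelems L H"
  shows "\<exists>e\<in>assignments H. e (xvar L) = a"
proof -
  obtain e where "e \<in> assignments H" using ex_assignment[OF assms(1)] by blast
  then have "e(xvar L := a) \<in> assignments H" using assms(2) by (intro assignments_upd) (auto simp: xvar_def)
  then show ?thesis by (intro bexI[of _ "e(xvar L := a)"]) auto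
qed

lemma assignments_gelems: "e \<in> assignments H \<Longrightarrow> e (xvar L) \<in> gelems L H"
  using assignments_sort[of e H "xvar L"] by (simp add: xvar_def)

lemma sort_elems_univ: "a \<in> sort_elems H s \<Longrightarrow> a \<in> univ H"
  by (simp add: sort_elems_def)

lemma sat_plug:
  "sat H e (plug L b \<phi>) \<longleftrightarrow> sat H (b(xvar L := e (xvar L))) \<phi>"
proof -
  have "(\<lambda>v. tm_val H e (if v = xvar L then Var v else Cst (b v))) = b(xvar L := e (xvar L))"
    by auto
  then show ?thesis unfolding plug_def by (subst sat_subst) auto
qed

lemma assignments_sort_of: "e \<in> assignments H \<Longrightarrow> sort_of H (e v) = fst v"
  using assignments_sort[of e H v] by (simp add: sort_elems_def)

lemma plug_formulas:
  assumes \<phi>: "\<phi> \<in> formulas L G (insert (xvar L) Y) A" and b: "b \<in> assignments G"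
  shows "plug L b \<phi> \<in> formulas L G {xvar L} (A \<union> b ` Y)"
proof (rule formulasI)
  let ?\<sigma> = "\<lambda>v. if v = xvar L then Var v else Cst (b v) :: ('a, 'b, 'd) tm"
  show "well_sorted L (sort_of G) (plug L b \<phi>)"
    unfolding plug_def using \<phi> assignments_sort_of[OF b]
    by (intro well_sorted_subst) (auto simp: formulas_def)
  have "fv (plug L b \<phi>) \<subseteq> (\<Union>v\<in>fv \<phi>. tm_fv (?\<sigma> v))"
    unfolding plug_def by (rule fv_subst) auto
  then show "fv (plug L b \<phi>) \<subseteq> {xvar L}" by (fastforce split: if_splits)
  have "params (plug L b \<phi>) \<subseteq> params \<phi> \<union> (\<Union>v\<in>fv \<phi>. tm_params (?\<sigma> v))"
    unfolding plug_def by (rule params_subst)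
  also have "\<dots> \<subseteq> A \<union> b ` Y"
    using \<phi> by (auto simp: formulas_def split: if_splits)
  finally show "params (plug L b \<phi>) \<subseteq> A \<union> b ` Y" .
qed

lemma shift_formulas:
  assumes grp: "farity L (mul L) = [gsort L, gsort L]" "fsort L (mul L) = gsort L"
    and \<phi>: "\<phi> \<in> formulas L G {xvar L} A" and d: "d \<in> gelems L G"
  shows "shift L d \<phi> \<in> formulas L G {xvar L} (insert d A)"
proof (rule formulasI)
  let ?\<sigma> = "\<lambda>v. if v = xvar L then App (mul L) [Var v, Cst d] else Var v :: ('a, 'b, 'd) tm"
  have "sort_of G d = gsort L" using d by (simp add: sort_elems_def)
  then show "well_sorted L (sort_of G) (shift L d \<phi>)"
    unfolding shift_def using \<phi> grp
    by (intro well_sorted_subst) (auto simp: formulas_def xvar_def)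
  have "fv (shift L d \<phi>) \<subseteq> (\<Union>v\<in>fv \<phi>. tm_fv (?\<sigma> v))"
    unfolding shift_def by (rule fv_subst) auto
  then show "fv (shift L d \<phi>) \<subseteq> {xvar L}" using \<phi> by (fastforce simp: formulas_def split: if_splits)
  have "params (shift L d \<phi>) \<subseteq> params \<phi> \<union> (\<Union>v\<in>fv \<phi>. tm_params (?\<sigma> v))"
    unfolding shift_def by (rule params_subst)
  also have "\<dots> \<subseteq> insert d A"
    using \<phi> by (auto simp: formulas_def split: if_splits)
  finally show "params (shift L d \<phi>) \<subseteq> insert d A" .
qed

lemma sat_shift:
  assumes \<phi>: "\<phi> \<in> formulas L G {xvar L} A"
  shows "sat H (\<lambda>_. a) (shift L d \<phi>) \<longleftrightarrow> sat H (\<lambda>_. gmul L H a d) \<phi>"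
proof -
  have "sat H (\<lambda>_. a) (shift L d \<phi>) \<longleftrightarrow>
    sat H (\<lambda>v. tm_val H (\<lambda>_. a) (if v = xvar L then App (mul L) [Var v, Cst d] else Var v)) \<phi>"
    unfolding shift_def by (rule sat_subst) auto
  also have "\<dots> \<longleftrightarrow> sat H (\<lambda>_. gmul L H a d) \<phi>"
    using \<phi> by (intro sat_cong) (auto simp: formulas_def gmul_def)
  finally show ?thesis .
qed

lemma gmul_closed:
  assumes "farity L (mul L) = [gsort L, gsort L]" "fsort L (mul L) = gsort L" "is_structure L H"
    "a \<in> gelems L H" "b \<in> gelems L H"
  shows "gmul L H a b \<in> gelems L H"
proof -
  have "[a, b] \<in> tuples H (farity L (mul L))" using assms by (simp add: tuples_def)
  then show ?thesis using assms unfolding is_structure_def gmul_def by metis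
qed

text \<open>The formulas \<open>\<phi>(x \<cdot> d)\<close> for varying \<open>d\<close> are instances of one formula \<open>\<psi>(x; y, z)\<close> without
  parameters: \<open>y\<close> is read as \<open>d\<close>, and the fixed tuple \<open>c\<close> supplies the parameters of \<open>\<phi>\<close> for the
  remaining variables. The last clause turns conditions on the tuple \<open>(d, c)\<close> into conditions on \<open>d\<close>.\<close>
definition shift_family ::
  "('s, 'f, 'r) language \<Rightarrow> ('s, 'f, 'r, 'm) model \<Rightarrow> ('s, 'f, 'r, 'm) fm \<Rightarrow> 's var set \<Rightarrow> 's var
    \<Rightarrow> ('s, 'f, 'r, 'm) fm \<Rightarrow> ('s var \<Rightarrow> 'm) \<Rightarrow> bool" where
  "shift_family L G \<phi> Y y \<psi> c \<longleftrightarrow>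
    finite Y \<and> xvar L \<notin> Y \<and> y \<in> Y \<and> fst y = gsort L \<and>
    \<psi> \<in> formulas L G (insert (xvar L) Y) {} \<and> c \<in> assignments G \<and> c ` (Y - {y}) \<subseteq> params \<phi> \<and>
    (\<forall>H d a. is_structure L H \<longrightarrow> c \<in> assignments H \<longrightarrow> d \<in> gelems L H \<longrightarrow> a \<in> gelems L H \<longrightarrow>
      (sat H (\<lambda>_. a) (plug L (c(y := d)) \<psi>) \<longleftrightarrow> sat H (\<lambda>_. gmul L H a d) \<phi>)) \<and>
    (\<forall>B. \<forall>\<theta> \<in> formulas L G Y B. \<exists>\<theta>' \<in> formulas L G {xvar L} (B \<union> params \<phi>).
      \<forall>H d. c \<in> assignments H \<longrightarrow> d \<in> gelems L H \<longrightarrow> (sat H (\<lambda>_. d) \<theta>' \<longleftrightarrow> sat H (c(y := d)) \<theta>))"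

lemma ex_shift_family:
  fixes \<phi> :: "('s, 'f, 'r, 'm) fm" and L :: "('s, 'f, 'r) language" and G :: "('s, 'f, 'r, 'm) model"
  assumes grp: "farity L (mul L) = [gsort L, gsort L]" "fsort L (mul L) = gsort L"
    and G: "is_structure L G"
    and \<phi>: "\<phi> \<in> formulas L G {xvar L} A" and A: "A \<subseteq> univ G"
  shows "\<exists>Y y \<psi> c. shift_family L G \<phi> Y y \<psi> c"
proof -
  let ?x = "xvar L"
  define F where "F = params \<phi>"
  have F: "finite F" "F \<subseteq> univ G" using \<phi> A finite_params by (auto simp: F_def formulas_def)
  obtain k where k: "inj_on k F" "k ` F \<inter> (bv \<phi> \<union> fv \<phi> \<union> {?x}) = {}" "\<And>c. fst (k c) = sort_of G c"
    using ex_fresh_naming[of F "bv \<phi> \<union> fv \<phi> \<union> {?x}" "sort_of G"] F finite_bv finite_fv by (metis finite.emptyI finite_UnI finite_insert)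
  obtain y where y: "y \<notin> insert ?x (k ` F)" "fst y = gsort L"
    using ex_fresh_var[of "insert ?x (k ` F)" "gsort L"] F by auto
  define Y where "Y = insert y (k ` F)"
  have \<phi>1: "abstract k \<phi> \<in> formulas L G (insert ?x (k ` F)) {}"
    using \<phi> k(3) fv_abstract[of k \<phi>] by (auto simp: formulas_def params_abstract F_def intro!: well_sorted_abstract)
  let ?t = "App (mul L) [Var ?x, Var y]"
  have "\<exists>\<psi>\<in>formulas L G ((insert ?x (k ` F) - {?x}) \<union> {?x, y}) {}. \<forall>(H :: ('s, 'f, 'r, 'm) model) e.
    e \<in> assignments H \<longrightarrow> tm_val H e ?t \<in> sort_elems H (fst ?x) \<longrightarrow>
      (sat H e \<psi> \<longleftrightarrow> sat H (e(?x := tm_val H e ?t)) (abstract k \<phi>))"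
    by (rule ex_term_for_var[OF \<phi>1]) (use grp y in \<open>auto simp: xvar_def\<close>)
  then obtain \<psi> where \<psi>: "\<psi> \<in> formulas L G ((insert ?x (k ` F) - {?x}) \<union> {?x, y}) {}"
    and sat\<psi>: "\<And>(H :: ('s, 'f, 'r, 'm) model) e. e \<in> assignments H \<Longrightarrow> tm_val H e ?t \<in> sort_elems H (fst ?x) \<Longrightarrow>
      (sat H e \<psi> \<longleftrightarrow> sat H (e(?x := tm_val H e ?t)) (abstract k \<phi>))"
    by blast
  obtain c0 where c0: "c0 \<in> assignments G" using ex_assignment[OF G] by blast
  from ex_naming_assignment[OF k(1) k(3) F(2) c0]
  obtain c where c: "c \<in> assignments G" and ck': "\<forall>u\<in>F. c (k u) = u" by blast
  have ck: "c (k u) = u" if "u \<in> F" for u using ck' that by blast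
  show ?thesis
    unfolding shift_family_def
  proof (intro exI[of _ Y] exI[of _ y] exI[of _ \<psi>] exI[of _ c] conjI allI impI ballI)
    show "finite Y" "?x \<notin> Y" "y \<in> Y" "fst y = gsort L" using F y k by (auto simp: Y_def)
    show "\<psi> \<in> formulas L G (insert ?x Y) {}" using \<psi> by (rule formulas_mono) (auto simp: Y_def)
    show "c \<in> assignments G" by fact
    show "c ` (Y - {y}) \<subseteq> params \<phi>" using ck by (auto simp: Y_def F_def)
  next
    fix H :: "('s, 'f, 'r, 'm) model" and d a
    assume H: "is_structure L H" "c \<in> assignments H" and d: "d \<in> gelems L H" and a: "a \<in> gelems L H"
    let ?e = "c(y := d, ?x := a)"
    have e: "?e \<in> assignments H"
      using H d a y by (intro assignments_upd) (auto simp: xvar_def)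
    have xy: "y \<noteq> ?x" using y by auto
    have val: "tm_val H ?e ?t = gmul L H a d" using xy by (simp add: gmul_def)
    have ad: "gmul L H a d \<in> gelems L H" using grp H a d by (intro gmul_closed)
    have "sat H (\<lambda>_. a) (plug L (c(y := d)) \<psi>) \<longleftrightarrow> sat H ?e \<psi>" by (simp add: sat_plug)
    also have "\<dots> \<longleftrightarrow> sat H (?e(?x := gmul L H a d)) (abstract k \<phi>)"
      using sat\<psi>[OF e] ad unfolding val by (simp add: xvar_def)
    also have "\<dots> \<longleftrightarrow> sat H (?e(?x := gmul L H a d)) \<phi>"
    proof (rule sat_abstract)
      fix u assume u: "u \<in> params \<phi>"
      then have "k u \<in> k ` F" by (simp add: F_def)
      then have "k u \<noteq> ?x" "k u \<noteq> y" using k(2) y(1) by auto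
      then show "(?e(?x := gmul L H a d)) (k u) = u" using ck u by (simp add: F_def)
    qed (use k(2) in \<open>auto simp: F_def\<close>)
    also have "\<dots> \<longleftrightarrow> sat H (\<lambda>_. gmul L H a d) \<phi>"
      by (rule sat_point'[OF \<phi>]) simp
    finally show "sat H (\<lambda>_. a) (plug L (c(y := d)) \<psi>) \<longleftrightarrow> sat H (\<lambda>_. gmul L H a d) \<phi>" .
  next
    fix B and \<theta> :: "('s, 'f, 'r, 'm) fm" assume \<theta>: "\<theta> \<in> formulas L G Y B"
    let ?\<sigma> = "\<lambda>v. if v = y then Var v else Cst (c v) :: ('s, 'f, 'm) tm"
    let ?\<theta>1 = "subst ?\<sigma> \<theta>"
    have s1: "?\<theta>1 \<in> formulas L G {y} (B \<union> params \<phi>)"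
    proof (rule formulasI)
      show "well_sorted L (sort_of G) ?\<theta>1"
        using \<theta> assignments_sort_of[OF c] by (intro well_sorted_subst) (auto simp: formulas_def)
      have "fv ?\<theta>1 \<subseteq> (\<Union>v\<in>fv \<theta>. tm_fv (?\<sigma> v))" by (rule fv_subst) auto
      then show "fv ?\<theta>1 \<subseteq> {y}" by (fastforce split: if_splits)
      have "params ?\<theta>1 \<subseteq> params \<theta> \<union> (\<Union>v\<in>fv \<theta>. tm_params (?\<sigma> v))" by (rule params_subst)
      also have "\<dots> \<subseteq> B \<union> params \<phi>"
        using \<theta> ck by (auto simp: formulas_def Y_def F_def split: if_splits)
      finally show "params ?\<theta>1 \<subseteq> B \<union> params \<phi>" .
    qed
    have "\<exists>\<theta>'\<in>formulas L G (({y} - {y}) \<union> (\<lambda>_. ?x) ` {y}) (B \<union> params \<phi>).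
      \<forall>(H :: ('s, 'f, 'r, 'm) model) e. e \<in> assignments H \<longrightarrow>
        (sat H e \<theta>' \<longleftrightarrow> sat H (\<lambda>v. if v \<in> {y} then e ?x else e v) ?\<theta>1)"
      by (rule ex_rename[OF _ _ _ s1]) (use y in \<open>auto simp: xvar_def\<close>)
    then obtain \<theta>' where \<theta>': "\<theta>' \<in> formulas L G {?x} (B \<union> params \<phi>)"
      and sat\<theta>': "\<And>(H :: ('s, 'f, 'r, 'm) model) e. e \<in> assignments H \<Longrightarrow>
        (sat H e \<theta>' \<longleftrightarrow> sat H (\<lambda>v. if v \<in> {y} then e ?x else e v) ?\<theta>1)" by auto
    have "sat H (\<lambda>_. d) \<theta>' \<longleftrightarrow> sat H (c(y := d)) \<theta>"
      if H: "c \<in> assignments H" "d \<in> gelems L H" for H :: "('s, 'f, 'r, 'm) model" and d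
    proof -
      let ?e = "c(?x := d)"
      have e: "?e \<in> assignments H" using H by (intro assignments_upd) (auto simp: xvar_def)
      have "sat H (\<lambda>_. d) \<theta>' \<longleftrightarrow> sat H ?e \<theta>'" by (rule sat_point'[OF \<theta>', symmetric]) simp
      also have "\<dots> \<longleftrightarrow> sat H (\<lambda>v. if v \<in> {y} then ?e ?x else ?e v) ?\<theta>1" by (rule sat\<theta>'[OF e])
      also have "\<dots> \<longleftrightarrow> sat H (\<lambda>v. tm_val H (\<lambda>v. if v \<in> {y} then ?e ?x else ?e v) (?\<sigma> v)) \<theta>"
        by (rule sat_subst) auto
      also have "(\<lambda>v. tm_val H (\<lambda>v. if v \<in> {y} then ?e ?x else ?e v) (?\<sigma> v)) = c(y := d)"
        by auto
      finally show ?thesis .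
    qed
    then show "\<exists>\<theta>'\<in>formulas L G {?x} (B \<union> params \<phi>).
      \<forall>(H :: ('s, 'f, 'r, 'm) model) d. c \<in> assignments H \<longrightarrow> d \<in> gelems L H \<longrightarrow>
        (sat H (\<lambda>_. d) \<theta>' \<longleftrightarrow> sat H (c(y := d)) \<theta>)"
      using \<theta>' by blast
  qed
qed

lemma shift_familyD:
  fixes \<phi> :: "('s, 'f, 'r, 'm) fm" and H :: "('s, 'f, 'r, 'm) model"
  assumes "shift_family L G \<phi> Y y \<psi> c"
  shows "finite Y" "xvar L \<notin> Y" "y \<in> Y" "fst y = gsort L"
    and "\<psi> \<in> formulas L G (insert (xvar L) Y) {}" and "c \<in> assignments G"
    and "\<lbrakk>is_structure L H; c \<in> assignments H; d \<in> gelems L H; a \<in> gelems L H\<rbrakk> \<Longrightarrow>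
      sat H (\<lambda>_. a) (plug L (c(y := d)) \<psi>) \<longleftrightarrow> sat H (\<lambda>_. gmul L H a d) \<phi>"
    and "\<theta> \<in> formulas L G Y B \<Longrightarrow> \<exists>\<theta>'\<in>formulas L G {xvar L} (B \<union> params \<phi>).
      \<forall>(H :: ('s, 'f, 'r, 'm) model) d. c \<in> assignments H \<longrightarrow> d \<in> gelems L H \<longrightarrow>
        (sat H (\<lambda>_. d) \<theta>' \<longleftrightarrow> sat H (c(y := d)) \<theta>)"
  using assms by (simp_all add: shift_family_def)



section \<open>The type space as a Stone space\<close>

definition type_set where
  "type_set L G Y A \<phi> = {p \<in> types L G Y A. \<phi> \<in> p}"

lemma type_topology_eq:
  "type_topology L G Y A = topology_generated_by (type_set L G Y A ` formulas L G Y A)"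
  by (simp add: type_topology_def type_set_def)

lemma type_set_Neg: "\<phi> \<in> formulas L G Y A \<Longrightarrow> type_set L G Y A (Neg \<phi>) = types L G Y A - type_set L G Y A \<phi>"
  using types_Neg_iff by (fastforce simp: type_set_def)

lemma types_Conj_iff:
  assumes p: "p \<in> types L G Y A" and "\<phi> \<in> formulas L G Y A" "\<psi> \<in> formulas L G Y A"
  shows "Conj \<phi> \<psi> \<in> p \<longleftrightarrow> \<phi> \<in> p \<and> \<psi> \<in> p"
proof (intro iffI conjI)
  assume c: "Conj \<phi> \<psi> \<in> p"
  show "\<phi> \<in> p" using assms c by (intro types_entails[OF p, of \<phi> "{Conj \<phi> \<psi>}"]) auto
  show "\<psi> \<in> p" using assms c by (intro types_entails[OF p, of \<psi> "{Conj \<phi> \<psi>}"]) auto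
next
  assume "\<phi> \<in> p \<and> \<psi> \<in> p"
  then show "Conj \<phi> \<psi> \<in> p" using assms by (intro types_entails[OF p, of _ "{\<phi>, \<psi>}"]) auto
qed

lemma type_set_Conj:
  "\<phi> \<in> formulas L G Y A \<Longrightarrow> \<psi> \<in> formulas L G Y A \<Longrightarrow>
    type_set L G Y A (Conj \<phi> \<psi>) = type_set L G Y A \<phi> \<inter> type_set L G Y A \<psi>"
  by (auto simp: type_set_def types_Conj_iff)

lemma type_set_truth:
  assumes "is_structure L G"
  shows "type_set L G Y A (truth L) = types L G Y A"
proof -
  have "truth L \<in> p" if "p \<in> types L G Y A" for p
    by (rule types_entails[OF that, of _ "{}"]) (use assms in auto)
  then show ?thesis by (auto simp: type_set_def)
qed

lemma algebra_type_sets: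
  assumes "is_structure L G"
  shows "algebra (types L G Y A) (type_set L G Y A ` formulas L G Y A)"
  unfolding algebra_iff_Int
proof (intro conjI ballI)
  let ?\<B> = "type_set L G Y A ` formulas L G Y A"
  show "?\<B> \<subseteq> Pow (types L G Y A)" by (auto simp: type_set_def)
  have "type_set L G Y A (Neg (truth L)) = {}"
    by (subst type_set_Neg) (auto simp: type_set_truth[OF assms])
  then show "{} \<in> ?\<B>" by (metis formulas_Neg imageI truth_formulas)
  fix a assume "a \<in> ?\<B>"
  then obtain \<phi> where \<phi>: "\<phi> \<in> formulas L G Y A" "a = type_set L G Y A \<phi>" by auto
  then have "types L G Y A - a = type_set L G Y A (Neg \<phi>)" by (simp add: type_set_Neg)
  then show "types L G Y A - a \<in> ?\<B>" using \<phi> by auto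
  fix b assume "b \<in> ?\<B>"
  then obtain \<psi> where \<psi>: "\<psi> \<in> formulas L G Y A" "b = type_set L G Y A \<psi>" by auto
  then have "a \<inter> b = type_set L G Y A (Conj \<phi> \<psi>)" using \<phi> by (simp add: type_set_Conj)
  then show "a \<inter> b \<in> ?\<B>" using \<phi> \<psi> by auto
qed

lemma topspace_type_topology:
  assumes "is_structure L G"
  shows "topspace (type_topology L G Y A) = types L G Y A"
proof -
  have "type_set L G Y A (truth L) \<subseteq> \<Union>(type_set L G Y A ` formulas L G Y A)"
    by (intro Union_upper imageI truth_formulas)
  then show ?thesis
    unfolding type_topology_eq topology_generated_by_topspace type_set_truth[OF assms]
    by (auto simp: type_set_def)
qed

text \<open>
  If no finite subfamily covers, the negations of the formulas of the cover are finitely satisfiable,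
  and a complete type extending them is left uncovered.
\<close>
lemma compact_types:
  assumes C: "\<C> \<subseteq> type_set L G Y A ` formulas L G Y A" and cov: "types L G Y A \<subseteq> \<Union>\<C>"
  shows "\<exists>\<D>\<subseteq>\<C>. finite \<D> \<and> types L G Y A \<subseteq> \<Union>\<D>"
proof -
  define \<Gamma> where "\<Gamma> = Neg ` {\<phi> \<in> formulas L G Y A. type_set L G Y A \<phi> \<in> \<C>}"
  have \<Gamma>: "\<Gamma> \<subseteq> formulas L G Y A" by (auto simp: \<Gamma>_def)
  have "\<not> finitely_satisfiable G \<Gamma>"
  proof
    assume "finitely_satisfiable G \<Gamma>"
    then obtain p where p: "p \<in> types L G Y A" "\<Gamma> \<subseteq> p" using ex_type_extending[OF \<Gamma>] by blast
    then obtain c where c: "c \<in> \<C>" "p \<in> c" using cov by blast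
    then obtain \<phi> where \<phi>: "\<phi> \<in> formulas L G Y A" "c = type_set L G Y A \<phi>" using C by blast
    then have "Neg \<phi> \<in> p" "\<phi> \<in> p" using c p by (auto simp: \<Gamma>_def type_set_def)
    then show False using types_Neg_iff[OF p(1) \<phi>(1)] by simp
  qed
  then obtain \<Phi> where \<Phi>: "finite \<Phi>" "\<Phi> \<subseteq> \<Gamma>" "\<forall>e\<in>assignments G. \<exists>\<theta>\<in>\<Phi>. \<not> sat G e \<theta>"
    by (rule not_finitely_satisfiableE)
  obtain \<Psi> where \<Psi>: "finite \<Psi>" "\<Psi> \<subseteq> {\<phi> \<in> formulas L G Y A. type_set L G Y A \<phi> \<in> \<C>}" "\<Phi> = Neg ` \<Psi>"
    using finite_subset_image[OF \<Phi>(1) \<Phi>(2)[unfolded \<Gamma>_def]] by (elim exE conjE)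
  have "types L G Y A \<subseteq> \<Union>(type_set L G Y A ` \<Psi>)"
  proof
    fix p assume p: "p \<in> types L G Y A"
    show "p \<in> \<Union>(type_set L G Y A ` \<Psi>)"
    proof (rule ccontr)
      assume "p \<notin> \<Union>(type_set L G Y A ` \<Psi>)"
      then have "\<phi> \<notin> p" if "\<phi> \<in> \<Psi>" for \<phi> using that p by (auto simp: type_set_def)
      then have "Neg \<phi> \<in> p" if "\<phi> \<in> \<Psi>" for \<phi> using that types_Neg_iff[OF p, of \<phi>] \<Psi> by auto
      then have "\<Phi> \<subseteq> p" using \<Psi> by auto
      moreover have "finitely_satisfiable G p" using p by (simp add: types_iff)
      ultimately have "\<exists>e\<in>assignments G. \<forall>\<theta>\<in>\<Phi>. sat G e \<theta>"
        using \<Phi>(1) by (intro finitely_satisfiableD[of G p])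
      then show False using \<Phi>(3) by auto
    qed
  qed
  then show ?thesis using \<Psi> by (intro exI[of _ "type_set L G Y A ` \<Psi>"]) auto
qed

section \<open>Saturated groups\<close>

locale saturated_group =
  fixes L :: "('s, 'f, 'r) language" and G :: "('s, 'f, 'r, 'm) model" and \<kappa> :: "'k rel"
  assumes struct: "is_structure L G"
    and card: "Card_order \<kappa>" "infinite (Field \<kappa>)"
    and saturated: "saturated \<kappa> L G"
    and group: "group_expansion L G"
begin

abbreviation x where "x \<equiv> xvar L"
abbreviation V where "V \<equiv> univ G"
abbreviation F where "F A \<equiv> formulas L G {x} A"
abbreviation g where "g \<equiv> gelems L G"
abbreviation gm (infixl "\<cdot>" 70) where "a \<cdot> b \<equiv> gmul L G a b"
abbreviation holds where "holds a \<phi> \<equiv> sat G (\<lambda>_. a) \<phi>"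

definition small where "small A \<longleftrightarrow> A \<subseteq> V \<and> |A| <o \<kappa>"

lemma mul_sorts: "farity L (mul L) = [gsort L, gsort L]" "fsort L (mul L) = gsort L"
  using group by (auto simp: group_expansion_def)

lemma mult_closed: "a \<in> g \<Longrightarrow> b \<in> g \<Longrightarrow> a \<cdot> b \<in> g"
  using gmul_closed[OF mul_sorts struct] .

lemma mult_assoc: "a \<in> g \<Longrightarrow> b \<in> g \<Longrightarrow> c \<in> g \<Longrightarrow> a \<cdot> b \<cdot> c = a \<cdot> (b \<cdot> c)"
proof -
  obtain e where "Group.group \<lparr>carrier = g, mult = gmul L G, one = e\<rparr>"
    using group by (auto simp: group_expansion_def)
  then interpret Group.group "\<lparr>carrier = g, mult = gmul L G, one = e\<rparr>" .
  show "a \<in> g \<Longrightarrow> b \<in> g \<Longrightarrow> c \<in> g \<Longrightarrow> a \<cdot> b \<cdot> c = a \<cdot> (b \<cdot> c)" using m_assoc by simp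
qed

lemma g_V: "a \<in> g \<Longrightarrow> a \<in> V" by (rule sort_elems_univ)

lemma small_Un: "small A \<Longrightarrow> small B \<Longrightarrow> small (A \<union> B)"
  unfolding small_def using card by (auto intro!: card_of_Un_ordLess_infinite_Field)

lemma finite_small: "finite A \<Longrightarrow> A \<subseteq> V \<Longrightarrow> small A"
  unfolding small_def using card(2) finite_ordLess_infinite[OF card_of_Well_order card_order_on_well_order_on[OF card(1)]]
  by (auto simp: Field_card_of)

lemma small_subset: "small A \<Longrightarrow> A \<subseteq> V" by (simp add: small_def)

lemma params_small: "\<phi> \<in> F V \<Longrightarrow> small (params \<phi>)"
  by (rule finite_small) (auto simp: finite_params formulas_def)

lemma F_mono: "\<phi> \<in> F A \<Longrightarrow> A \<subseteq> B \<Longrightarrow> \<phi> \<in> F B" by (auto simp: formulas_def)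

lemma shift_F: "\<phi> \<in> F A \<Longrightarrow> d \<in> g \<Longrightarrow> shift L d \<phi> \<in> F (insert d A)"
  by (rule shift_formulas[OF mul_sorts])

lemma shift_F_V: "\<phi> \<in> F V \<Longrightarrow> d \<in> g \<Longrightarrow> shift L d \<phi> \<in> F V"
  using shift_F[of \<phi> V d] g_V[of d] by (simp add: insert_absorb)

lemma holds_shift: "\<phi> \<in> F A \<Longrightarrow> holds a (shift L d \<phi>) \<longleftrightarrow> holds (a \<cdot> d) \<phi>"
  by (rule sat_shift)

lemma ex_conj_F:
  assumes "finite \<Phi>" "\<Phi> \<subseteq> F A"
  shows "\<exists>\<psi>\<in>F A. \<forall>a. holds a \<psi> \<longleftrightarrow> (\<forall>\<phi>\<in>\<Phi>. holds a \<phi>)"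
  using ex_finite_conj[OF assms] struct by blast

lemma finitely_satisfiable_F:
  assumes "\<Gamma> \<subseteq> F A" "\<And>\<Phi>. finite \<Phi> \<Longrightarrow> \<Phi> \<subseteq> \<Gamma> \<Longrightarrow> \<exists>a\<in>g. \<forall>\<phi>\<in>\<Phi>. holds a \<phi>"
  shows "finitely_satisfiable G \<Gamma>"
  unfolding finitely_satisfiable_def
proof safe
  fix \<Phi> assume \<Phi>: "finite \<Phi>" "\<Phi> \<subseteq> \<Gamma>"
  from assms(2)[OF this] obtain a where a: "a \<in> g" "\<forall>\<phi>\<in>\<Phi>. holds a \<phi>" by blast
  obtain e where e: "e \<in> assignments G" "e x = a" using ex_assignment_point[OF struct a(1)] by blast
  have "sat G e \<phi>" if "\<phi> \<in> \<Phi>" for \<phi>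
    using sat_point'[of \<phi> L G A e a G] e a \<Phi> assms(1) that by blast
  then show "\<exists>e\<in>assignments G. \<forall>\<phi>\<in>\<Phi>. sat G e \<phi>" using e by blast
qed

lemma realize_small:
  assumes "small A" "\<Gamma> \<subseteq> F A" "\<And>\<Phi>. finite \<Phi> \<Longrightarrow> \<Phi> \<subseteq> \<Gamma> \<Longrightarrow> \<exists>a\<in>g. \<forall>\<phi>\<in>\<Phi>. holds a \<phi>"
  shows "\<exists>a\<in>g. \<forall>\<phi>\<in>\<Gamma>. holds a \<phi>"
proof -
  have "\<exists>e\<in>assignments G. \<forall>\<phi>\<in>\<Gamma>. sat G e \<phi>"
    using assms finitely_satisfiable_F[OF assms(2,3)]
    by (intro saturated_realize[OF saturated, of A "{x}"]) (auto simp: small_def)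
  then obtain e where e: "e \<in> assignments G" "\<forall>\<phi>\<in>\<Gamma>. sat G e \<phi>" by blast
  have "holds (e x) \<phi>" if "\<phi> \<in> \<Gamma>" for \<phi>
    using sat_point[of \<phi> L G A G e] e that assms(2) by blast
  then show ?thesis using assignments_gelems[OF e(1)] by blast
qed

lemma type_satisfiable:
  assumes "p \<in> xtypes L G A" "finite \<Phi>" "\<Phi> \<subseteq> p"
  shows "\<exists>a\<in>g. \<forall>\<phi>\<in>\<Phi>. holds a \<phi>"
proof -
  have "finitely_satisfiable G p" using assms by (simp add: types_iff)
  from finitely_satisfiableD[OF this assms(2,3)]
  obtain e where e: "e \<in> assignments G" "\<forall>\<phi>\<in>\<Phi>. sat G e \<phi>" by blast
  have "holds (e x) \<phi>" if "\<phi> \<in> \<Phi>" for \<phi>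
    using sat_point[of \<phi> L G A G e] e that assms by (auto simp: types_iff)
  then show ?thesis using assignments_gelems[OF e(1)] by blast
qed

definition realizes_over where
  "realizes_over a p A \<longleftrightarrow> a \<in> g \<and> (\<forall>\<phi>\<in>F A. holds a \<phi> \<longleftrightarrow> \<phi> \<in> p)"

lemma ex_realizes_over:
  assumes p: "p \<in> xtypes L G B" and A: "small A" "A \<subseteq> B"
  shows "\<exists>a. realizes_over a p A"
proof -
  have sub: "\<exists>a\<in>g. \<forall>\<phi>\<in>p \<inter> F A. holds a \<phi>"
  proof (rule realize_small[OF A(1)])
    fix \<Phi> assume "finite \<Phi>" "\<Phi> \<subseteq> p \<inter> F A"
    then show "\<exists>a\<in>g. \<forall>\<phi>\<in>\<Phi>. holds a \<phi>" by (intro type_satisfiable[OF p]) auto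
  qed auto
  then obtain a where a: "a \<in> g" "\<forall>\<phi>\<in>p \<inter> F A. holds a \<phi>" by blast
  have "holds a \<phi> \<longleftrightarrow> \<phi> \<in> p" if \<phi>: "\<phi> \<in> F A" for \<phi>
  proof (cases "\<phi> \<in> p")
    case False
    then have "Neg \<phi> \<in> p \<inter> F A" using \<phi> types_Neg_iff[OF p, of \<phi>] F_mono[OF \<phi> A(2)] by simp
    then have "holds a (Neg \<phi>)" using a(2) by blast
    then show ?thesis using False by simp
  qed (use a \<phi> in auto)
  then show ?thesis using a by (auto simp: realizes_over_def)
qed

lemma realizes_over_subset: "realizes_over a p A \<Longrightarrow> B \<subseteq> A \<Longrightarrow> realizes_over a p B"
  unfolding realizes_over_def using F_mono by blast

lemma realizes_over_g: "realizes_over a p A \<Longrightarrow> a \<in> g"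
  by (simp add: realizes_over_def)

end

section \<open>Keisler measures and generic elements\<close>

locale keisler = saturated_group +
  fixes \<mu> :: "('a, 'b, 'c, 'd) fm \<Rightarrow> real"
  assumes keisler: "keisler_measure L G V \<mu>"
begin

lemma mu_nonneg: "\<phi> \<in> F V \<Longrightarrow> 0 \<le> \<mu> \<phi>"
  using keisler unfolding keisler_measure_def by blast

lemma mu_total:
  assumes "\<phi> \<in> F V" "\<And>a. a \<in> g \<Longrightarrow> holds a \<phi>"
  shows "\<mu> \<phi> = 1"
proof -
  have "solutions L G \<phi> = g" using assms by (auto simp: solutions_def)
  then show ?thesis using assms keisler unfolding keisler_measure_def by blast
qed

lemma mu_cong:
  assumes "\<phi> \<in> F V" "\<psi> \<in> F V" "\<And>a. a \<in> g \<Longrightarrow> holds a \<phi> \<longleftrightarrow> holds a \<psi>"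
  shows "\<mu> \<phi> = \<mu> \<psi>"
proof -
  have "solutions L G \<phi> = solutions L G \<psi>" using assms by (auto simp: solutions_def)
  then show ?thesis using assms keisler unfolding keisler_measure_def by blast
qed

lemma mu_disjoint:
  assumes "\<phi> \<in> F V" "\<psi> \<in> F V" "\<And>a. a \<in> g \<Longrightarrow> holds a \<phi> \<Longrightarrow> holds a \<psi> \<Longrightarrow> False"
  shows "\<mu> (Disj \<phi> \<psi>) = \<mu> \<phi> + \<mu> \<psi>"
proof -
  have "solutions L G \<phi> \<inter> solutions L G \<psi> = {}" using assms by (auto simp: solutions_def)
  then show ?thesis using assms keisler unfolding keisler_measure_def by blast
qed

lemma mu_split:
  assumes "\<phi> \<in> F V" "\<psi> \<in> F V"
  shows "\<mu> \<phi> = \<mu> (Conj \<phi> \<psi>) + \<mu> (Conj \<phi> (Neg \<psi>))"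
proof -
  have "\<mu> \<phi> = \<mu> (Disj (Conj \<phi> \<psi>) (Conj \<phi> (Neg \<psi>)))" using assms by (intro mu_cong) auto
  also have "\<dots> = \<mu> (Conj \<phi> \<psi>) + \<mu> (Conj \<phi> (Neg \<psi>))" using assms by (intro mu_disjoint) auto
  finally show ?thesis .
qed

lemma mu_mono:
  assumes "\<phi> \<in> F V" "\<psi> \<in> F V" "\<And>a. a \<in> g \<Longrightarrow> holds a \<phi> \<Longrightarrow> holds a \<psi>"
  shows "\<mu> \<phi> \<le> \<mu> \<psi>"
proof -
  have "\<mu> \<phi> = \<mu> (Conj \<psi> \<phi>)" using assms by (intro mu_cong) auto
  also have "\<dots> \<le> \<mu> \<psi>" using mu_split[OF assms(2,1)] mu_nonneg[of "Conj \<psi> (Neg \<phi>)"] assms by simp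
  finally show ?thesis .
qed

lemma mu_le_1: "\<phi> \<in> F V \<Longrightarrow> \<mu> \<phi> \<le> 1"
  using mu_mono[of \<phi> "truth L"] mu_total[of "truth L"] struct by simp

text \<open>Removing a null set from a set of positive measure keeps its measure.\<close>
lemma avoid_null:
  assumes "finite N" "N \<subseteq> F V" "\<And>\<phi>. \<phi> \<in> N \<Longrightarrow> \<mu> \<phi> = 0" "\<psi> \<in> F V" "0 < \<mu> \<psi>"
  shows "\<exists>a\<in>g. holds a \<psi> \<and> (\<forall>\<phi>\<in>N. \<not> holds a \<phi>)"
  using assms
proof (induction N arbitrary: \<psi>)
  case empty
  have "\<mu> \<psi> = 0" if "\<And>a. a \<in> g \<Longrightarrow> \<not> holds a \<psi>"
  proof -
    have "\<mu> (Disj \<psi> \<psi>) = \<mu> \<psi> + \<mu> \<psi>" using that empty by (intro mu_disjoint) auto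
    moreover have "\<mu> (Disj \<psi> \<psi>) = \<mu> \<psi>" using empty by (intro mu_cong) auto
    ultimately show ?thesis by simp
  qed
  then show ?case using empty by force
next
  case (insert \<phi> N)
  have "\<mu> (Conj \<psi> \<phi>) \<le> \<mu> \<phi>" using insert.prems by (intro mu_mono) auto
  then have "0 < \<mu> (Conj \<psi> (Neg \<phi>))" using insert.prems mu_split[of \<psi> \<phi>] by auto
  then have "\<exists>a\<in>g. holds a (Conj \<psi> (Neg \<phi>)) \<and> (\<forall>\<phi>\<in>N. \<not> holds a \<phi>)"
    using insert.prems by (intro insert.IH) auto
  then show ?case by auto
qed

abbreviation S where "S \<equiv> supp L G V \<mu>"

lemma S_types: "p \<in> S \<Longrightarrow> p \<in> xtypes L G V" and S_pos: "p \<in> S \<Longrightarrow> \<phi> \<in> p \<Longrightarrow> 0 < \<mu> \<phi>"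
  by (auto simp: supp_def)

text \<open>
  A complete type avoiding all null formulas lies in the support, so it suffices that \<open>\<Gamma>\<close> together with
  the negations of all null formulas is finitely satisfiable.
\<close>
lemma ex_S_extending:
  assumes \<Gamma>: "\<Gamma> \<subseteq> F V"
    and pos: "\<And>\<Phi>. finite \<Phi> \<Longrightarrow> \<Phi> \<subseteq> \<Gamma> \<Longrightarrow> \<exists>\<psi>\<in>F V. 0 < \<mu> \<psi> \<and> (\<forall>a\<in>g. holds a \<psi> \<longrightarrow> (\<forall>\<phi>\<in>\<Phi>. holds a \<phi>))"
  shows "\<exists>p\<in>S. \<Gamma> \<subseteq> p"
proof -
  let ?N = "{\<phi> \<in> F V. \<mu> \<phi> = 0}"
  have "finitely_satisfiable G (\<Gamma> \<union> Neg ` ?N)"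
  proof (rule finitely_satisfiable_F)
    show "\<Gamma> \<union> Neg ` ?N \<subseteq> F V" using \<Gamma> by auto
    fix \<Phi> assume \<Phi>: "finite \<Phi>" "\<Phi> \<subseteq> \<Gamma> \<union> Neg ` ?N"
    have "finite (\<Phi> - \<Gamma>)" "\<Phi> - \<Gamma> \<subseteq> Neg ` ?N" using \<Phi> by auto
    from finite_subset_image[OF this] obtain N where N: "N \<subseteq> ?N" "finite N" "\<Phi> - \<Gamma> = Neg ` N"
      by (elim exE conjE)
    have "finite (\<Phi> \<inter> \<Gamma>)" "\<Phi> \<inter> \<Gamma> \<subseteq> \<Gamma>" using \<Phi> by auto
    from pos[OF this] obtain \<psi> where \<psi>: "\<psi> \<in> F V" "0 < \<mu> \<psi>"
      "\<forall>a\<in>g. holds a \<psi> \<longrightarrow> (\<forall>\<phi>\<in>\<Phi> \<inter> \<Gamma>. holds a \<phi>)" by (elim bexE conjE)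
    have "\<exists>a\<in>g. holds a \<psi> \<and> (\<forall>\<phi>\<in>N. \<not> holds a \<phi>)"
      by (rule avoid_null) (use N \<psi> in auto)
    then obtain a where a: "a \<in> g" "holds a \<psi>" "\<forall>\<phi>\<in>N. \<not> holds a \<phi>" by (elim bexE conjE)
    have "holds a \<phi>" if "\<phi> \<in> \<Phi>" for \<phi>
    proof (cases "\<phi> \<in> \<Gamma>")
      case False
      then have "\<phi> \<in> Neg ` N" using N that by auto
      then show ?thesis using a by auto
    qed (use that a \<psi> in auto)
    then show "\<exists>a\<in>g. \<forall>\<phi>\<in>\<Phi>. holds a \<phi>" using a by blast
  qed
  moreover have "\<Gamma> \<union> Neg ` ?N \<subseteq> F V" using \<Gamma> by auto
  ultimately obtain p where p: "p \<in> xtypes L G V" "\<Gamma> \<union> Neg ` ?N \<subseteq> p"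
    using ex_type_extending[of "\<Gamma> \<union> Neg ` ?N" L G "{x}" V] by blast
  have "0 < \<mu> \<phi>" if "\<phi> \<in> p" for \<phi>
  proof (rule ccontr)
    have \<phi>: "\<phi> \<in> F V" using p that by (auto simp: types_iff)
    assume "\<not> 0 < \<mu> \<phi>"
    then have "\<phi> \<in> ?N" using mu_nonneg[OF \<phi>] \<phi> by simp
    then have "Neg \<phi> \<in> p" using p by blast
    then show False using types_Neg_iff[OF p(1) \<phi>] that by simp
  qed
  then show ?thesis using p by (auto simp: supp_def)
qed

lemma ex_S_containing:
  assumes "\<phi> \<in> F V" "0 < \<mu> \<phi>"
  shows "\<exists>p\<in>S. \<phi> \<in> p"
  using ex_S_extending[of "{\<phi>}"] assms by blast

text \<open>
  The elements realizing over \<open>A\<close> some type of the support. They let the argument be carried out with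
  elements of \<open>G\<close> and formulas in place of types and topology.
\<close>
definition generic where
  "generic A = {a \<in> g. \<forall>\<phi>\<in>F A. holds a \<phi> \<longrightarrow> 0 < \<mu> \<phi>}"

lemma generic_g: "a \<in> generic A \<Longrightarrow> a \<in> g" by (simp add: generic_def)

lemma generic_subset: "a \<in> generic A \<Longrightarrow> B \<subseteq> A \<Longrightarrow> a \<in> generic B"
  unfolding generic_def using F_mono by blast

lemma realizes_S_generic: "p \<in> S \<Longrightarrow> realizes_over a p A \<Longrightarrow> a \<in> generic A"
  using S_pos by (auto simp: generic_def realizes_over_def)

lemma generic_realizes_S:
  assumes a: "a \<in> generic A" and A: "A \<subseteq> V"
  shows "\<exists>p\<in>S. realizes_over a p A"
proof -
  let ?\<Gamma> = "{\<phi> \<in> F A. holds a \<phi>}"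
  have "\<exists>p\<in>S. ?\<Gamma> \<subseteq> p"
  proof (rule ex_S_extending)
    show "?\<Gamma> \<subseteq> F V" using A F_mono by blast
    fix \<Phi> assume \<Phi>: "finite \<Phi>" "\<Phi> \<subseteq> ?\<Gamma>"
    then obtain \<psi> where \<psi>: "\<psi> \<in> F A" "\<forall>a. holds a \<psi> \<longleftrightarrow> (\<forall>\<phi>\<in>\<Phi>. holds a \<phi>)"
      using ex_conj_F[of \<Phi> A] by auto
    then have "holds a \<psi>" using \<Phi> by auto
    then have "0 < \<mu> \<psi>" using \<psi> a by (auto simp: generic_def)
    then show "\<exists>\<psi>\<in>F V. 0 < \<mu> \<psi> \<and> (\<forall>a\<in>g. holds a \<psi> \<longrightarrow> (\<forall>\<phi>\<in>\<Phi>. holds a \<phi>))"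
      using \<psi> F_mono[OF \<psi>(1) A] by blast
  qed
  then obtain p where p: "p \<in> S" "?\<Gamma> \<subseteq> p" by blast
  have "holds a \<phi> \<longleftrightarrow> \<phi> \<in> p" if \<phi>: "\<phi> \<in> F A" for \<phi>
  proof (cases "holds a \<phi>")
    case False
    then have "Neg \<phi> \<in> p" using \<phi> p by auto
    then show ?thesis using False types_Neg_iff[OF S_types[OF p(1)], of \<phi>] F_mono[OF \<phi> A] by simp
  qed (use p \<phi> in auto)
  then show ?thesis using p a by (auto simp: realizes_over_def generic_def)
qed

lemma generic_extend:
  assumes "a \<in> generic A" "A \<subseteq> B" "small B"
  shows "\<exists>b\<in>generic B. \<forall>\<phi>\<in>F A. holds b \<phi> \<longleftrightarrow> holds a \<phi>"
proof -
  have "A \<subseteq> V" using assms small_subset by blast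
  then obtain p where p: "p \<in> S" "realizes_over a p A" using generic_realizes_S assms by blast
  obtain b where b: "realizes_over b p B"
    using ex_realizes_over[OF S_types[OF p(1)] assms(3)] small_subset[OF assms(3)] by blast
  then have "\<forall>\<phi>\<in>F A. holds b \<phi> \<longleftrightarrow> holds a \<phi>"
    using p(2) assms(2) F_mono unfolding realizes_over_def by blast
  then show ?thesis using realizes_S_generic[OF p(1) b] by blast
qed

lemma ex_generic: assumes "small A" shows "generic A \<noteq> {}"
proof -
  have "0 < \<mu> (truth L)" using mu_total[of "truth L"] struct by simp
  then obtain p where p: "p \<in> S" using ex_S_containing[of "truth L"] by auto
  obtain b where "realizes_over b p A"
    using ex_realizes_over[OF S_types[OF p] assms] small_subset[OF assms] by blast
  then show ?thesis using realizes_S_generic[OF p] by blast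
qed

end



lemma (in saturated_group) realizing_type:
  assumes a: "a \<in> g"
  shows "\<exists>p\<in>xtypes L G A. \<forall>\<phi>\<in>F A. \<phi> \<in> p \<longleftrightarrow> holds a \<phi>"
proof -
  obtain e where e: "e \<in> assignments G" "e x = a" using ex_assignment_point[OF struct a] by blast
  show ?thesis
  proof (intro bexI[of _ "tp L G {x} A e"] ballI)
    fix \<phi> assume \<phi>: "\<phi> \<in> F A"
    show "\<phi> \<in> tp L G {x} A e \<longleftrightarrow> holds a \<phi>"
      using \<phi> sat_point'[of \<phi> L G A e a G, OF \<phi> e(2)] by (simp add: tp_def)
  qed (rule tp_in_types[OF e(1)])
qed

context keisler
begin

section \<open>The regular Borel measure of a Keisler measure\<close>

text \<open>The measure of a clopen set of types, which is independent of the formula that defines the set.\<close>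
definition set_measure where
  "set_measure A b = \<mu> (SOME \<phi>. \<phi> \<in> F A \<and> b = type_set L G {x} A \<phi>)"

lemma set_measure_eq:
  assumes A: "A \<subseteq> V" and \<phi>: "\<phi> \<in> F A"
  shows "set_measure A (type_set L G {x} A \<phi>) = \<mu> \<phi>"
proof -
  let ?\<psi> = "SOME \<psi>. \<psi> \<in> F A \<and> type_set L G {x} A \<phi> = type_set L G {x} A \<psi>"
  have \<psi>: "?\<psi> \<in> F A" "type_set L G {x} A \<phi> = type_set L G {x} A ?\<psi>"
    using someI[of "\<lambda>\<psi>. \<psi> \<in> F A \<and> type_set L G {x} A \<phi> = type_set L G {x} A \<psi>" \<phi>] \<phi> by auto
  have "holds a ?\<psi> \<longleftrightarrow> holds a \<phi>" if "a \<in> g" for a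
  proof -
    obtain p where "p \<in> xtypes L G A" "\<forall>\<phi>\<in>F A. \<phi> \<in> p \<longleftrightarrow> holds a \<phi>"
      using realizing_type[OF \<open>a \<in> g\<close>] by blast
    then show ?thesis using \<psi> \<phi> unfolding type_set_def by blast
  qed
  then show ?thesis
    unfolding set_measure_def using F_mono[OF \<psi>(1) A] F_mono[OF \<phi> A] by (intro mu_cong) auto
qed

lemma stone_premeasure_types:
  assumes A: "A \<subseteq> V"
  shows "stone_premeasure (xtypes L G A) (type_set L G {x} A ` F A) (set_measure A)"
proof -
  interpret algebra "xtypes L G A" "type_set L G {x} A ` F A" by (rule algebra_type_sets[OF struct])
  show ?thesis
  proof
    fix \<C> assume "\<C> \<subseteq> type_set L G {x} A ` F A" "xtypes L G A \<subseteq> \<Union>\<C>"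
    then show "\<exists>\<D>\<subseteq>\<C>. finite \<D> \<and> xtypes L G A \<subseteq> \<Union>\<D>" by (rule compact_types)
  next
    fix b assume "b \<in> type_set L G {x} A ` F A"
    then obtain \<phi> where \<phi>: "\<phi> \<in> F A" "b = type_set L G {x} A \<phi>" by auto
    then show "0 \<le> set_measure A b" using A mu_nonneg F_mono set_measure_eq by auto
    fix c assume "c \<in> type_set L G {x} A ` F A" and disj: "b \<inter> c = {}"
    then obtain \<psi> where \<psi>: "\<psi> \<in> F A" "c = type_set L G {x} A \<psi>" by auto
    have D: "Disj \<phi> \<psi> \<in> F A" using \<phi> \<psi> by simp
    have "b \<union> c = type_set L G {x} A (Disj \<phi> \<psi>)"
      using \<phi> \<psi> by (auto simp: type_set_Neg type_set_Conj) (auto simp: type_set_def)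
    then have "set_measure A (b \<union> c) = \<mu> (Disj \<phi> \<psi>)" using set_measure_eq[OF A D] by simp
    also have "\<dots> = \<mu> \<phi> + \<mu> \<psi>"
    proof (rule mu_disjoint)
      fix a assume "a \<in> g" "holds a \<phi>" "holds a \<psi>"
      moreover obtain p where "p \<in> xtypes L G A" "\<forall>\<phi>\<in>F A. \<phi> \<in> p \<longleftrightarrow> holds a \<phi>"
        using realizing_type[OF \<open>a \<in> g\<close>] by blast
      ultimately have "p \<in> b \<inter> c" using \<phi> \<psi> by (auto simp: type_set_def)
      then show False using disj by simp
    qed (use \<phi> \<psi> F_mono A in blast)+
    finally show "set_measure A (b \<union> c) = set_measure A b + set_measure A c"
      using \<phi> \<psi> set_measure_eq[OF A] by simp
  next
    have "set_measure A (type_set L G {x} A (truth L)) = 1"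
      using mu_total[of "truth L"] struct by (subst set_measure_eq[OF A]) auto
    then show "set_measure A (xtypes L G A) = 1" by (simp add: type_set_truth[OF struct])
  qed
qed

lemma borel_measure_eq_stone_measure:
  assumes A: "A \<subseteq> V"
  shows "borel_measure L G A \<mu> = stone_premeasure.stone_measure (xtypes L G A) (type_set L G {x} A ` F A) (set_measure A)"
proof -
  interpret M: stone_premeasure "xtypes L G A" "type_set L G {x} A ` F A" "set_measure A"
    by (rule stone_premeasure_types[OF A])
  let ?P = "\<lambda>m. prob_space m \<and> sets m = sets (sigma (xtypes L G A) M.opens) \<and> regular M.X m \<and>
    (\<forall>b\<in>type_set L G {x} A ` F A. measure m b = set_measure A b)"
  have P: "?P M.stone_measure"
    using M.prob_space_stone_measure M.regular_stone_measure M.measure_basic M.opens_Pow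
    by (simp add: M.sets_stone_measure)
  have "borel_measure L G A \<mu> = (THE m. ?P m)"
    unfolding borel_measure_def borel_types_def type_topology_eq
    by (simp add: type_set_def[symmetric] set_measure_eq[OF A])
  also have "\<dots> = M.stone_measure"
    by (rule the_equality[of ?P, OF P]) (rule M.stone_measure_unique, auto)
  finally show ?thesis .
qed

lemma sets_borel_measure: "A \<subseteq> V \<Longrightarrow> sets (borel_measure L G A \<mu>) = sets (borel_types L G A)"
  and prob_space_borel_measure: "A \<subseteq> V \<Longrightarrow> prob_space (borel_measure L G A \<mu>)"
  and measure_type_set: "A \<subseteq> V \<Longrightarrow> \<phi> \<in> F A \<Longrightarrow> measure (borel_measure L G A \<mu>) (type_set L G {x} A \<phi>) = \<mu> \<phi>"
  and type_set_measurable: "A \<subseteq> V \<Longrightarrow> \<phi> \<in> F A \<Longrightarrow> type_set L G {x} A \<phi> \<in> sets (borel_measure L G A \<mu>)"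
  and supp_measurable: "A \<subseteq> V \<Longrightarrow> supp L G A \<mu> \<in> sets (borel_measure L G A \<mu>)"
  and AE_supp: "A \<subseteq> V \<Longrightarrow> AE q in borel_measure L G A \<mu>. q \<in> supp L G A \<mu>"
proof -
  assume A: "A \<subseteq> V"
  interpret M: stone_premeasure "xtypes L G A" "type_set L G {x} A ` F A" "set_measure A"
    by (rule stone_premeasure_types[OF A])
  note eq = borel_measure_eq_stone_measure[OF A]
  show sets: "sets (borel_measure L G A \<mu>) = sets (borel_types L G A)"
    using M.opens_Pow unfolding eq M.sets_stone_measure borel_types_def type_topology_eq
    by (rule sets_measure_of[symmetric])
  show "prob_space (borel_measure L G A \<mu>)"
    unfolding eq by (rule M.prob_space_stone_measure)
  have space: "space (borel_measure L G A \<mu>) = xtypes L G A"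
    unfolding eq by (rule M.space_stone_measure)
  show ms: "type_set L G {x} A \<phi> \<in> sets (borel_measure L G A \<mu>)" if "\<phi> \<in> F A" for \<phi>
    using that unfolding eq M.sets_stone_measure by (auto intro!: sigma_sets.Basic M.openin_basic)
  show "measure (borel_measure L G A \<mu>) (type_set L G {x} A \<phi>) = \<mu> \<phi>" if "\<phi> \<in> F A" for \<phi>
  proof -
    have "emeasure M.stone_measure (type_set L G {x} A \<phi>) = ennreal (\<mu> \<phi>)"
      using that by (subst M.emeasure_basic) (auto simp: set_measure_eq[OF A])
    then show ?thesis using that mu_nonneg F_mono[OF _ A] unfolding eq by (simp add: measure_def)
  qed
  \<comment> \<open>The complement of the support is open; its measure is the supremum over the clopen sets inside it,
    and these are null, since a clopen set of positive measure meets the support.\<close>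
  let ?W = "\<Union>(type_set L G {x} A ` {\<phi> \<in> F A. \<mu> \<phi> = 0})"
  have W: "?W = xtypes L G A - supp L G A \<mu>"
  proof -
    have "0 < \<mu> \<phi> \<longleftrightarrow> \<mu> \<phi> \<noteq> 0" if "\<phi> \<in> F A" for \<phi> using mu_nonneg[OF F_mono[OF that A]] by auto
    moreover have "\<phi> \<in> F A" if "p \<in> xtypes L G A" "\<phi> \<in> p" for p \<phi> using that by (auto simp: types_iff)
    ultimately have "p \<in> supp L G A \<mu> \<longleftrightarrow> p \<in> xtypes L G A \<and> (\<forall>\<phi>\<in>F A. \<phi> \<in> p \<longrightarrow> \<mu> \<phi> \<noteq> 0)" for p
      unfolding supp_def by (cases "p \<in> xtypes L G A") auto
    then have "(p \<in> xtypes L G A - supp L G A \<mu>) \<longleftrightarrow> p \<in> ?W" for p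
      by (cases "p \<in> xtypes L G A") (auto simp: type_set_def)
    then show ?thesis by blast
  qed
  have op: "openin M.X ?W" by (rule openin_Union) (auto intro: M.openin_basic)
  then have Ws: "?W \<in> sets (borel_measure L G A \<mu>)"
    unfolding eq M.sets_stone_measure by auto
  have sub: "supp L G A \<mu> \<subseteq> xtypes L G A" by (auto simp: supp_def)
  then have "supp L G A \<mu> = space (borel_measure L G A \<mu>) - ?W"
    unfolding W space by (simp add: double_diff)
  then show "supp L G A \<mu> \<in> sets (borel_measure L G A \<mu>)"
    using sets.compl_sets[OF Ws] by (simp only:)
  have "emeasure (borel_measure L G A \<mu>) ?W = 0"
  proof -
    have "set_measure A b = 0" if b: "b \<in> type_set L G {x} A ` F A" "b \<subseteq> ?W" for b
    proof -
      obtain \<phi> where \<phi>: "\<phi> \<in> F A" "b = type_set L G {x} A \<phi>" using b by auto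
      have "\<not> 0 < \<mu> \<phi>"
      proof
        assume "0 < \<mu> \<phi>"
        then obtain p where p: "p \<in> S" "\<phi> \<in> p" using ex_S_containing[of \<phi>] \<phi> F_mono A by blast
        have pA: "p \<inter> F A \<in> xtypes L G A"
        proof -
          have "finitely_satisfiable G p" "\<forall>\<phi>\<in>F V. \<phi> \<in> p \<or> Neg \<phi> \<in> p"
            using S_types[OF p(1)] by (auto simp: types_iff)
          then show ?thesis using F_mono[OF _ A] finitely_satisfiable_mono[of G p "p \<inter> F A"]
            by (auto simp: types_iff)
        qed
        then have "p \<inter> F A \<in> supp L G A \<mu>" using S_pos[OF p(1)] by (auto simp: supp_def)
        moreover have "p \<inter> F A \<in> b" using pA p \<phi> by (auto simp: type_set_def)
        ultimately show False using b(2) W by blast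
      qed
      then show ?thesis using \<phi> mu_nonneg[of \<phi>] F_mono[OF _ A] set_measure_eq[OF A] by force
    qed
    then have "M.inner ?W \<le> 0"
      unfolding M.inner_def by (intro SUP_least) auto
    then show ?thesis unfolding eq M.emeasure_open[OF op] by simp
  qed
  then show "AE q in borel_measure L G A \<mu>. q \<in> supp L G A \<mu>"
    using Ws by (intro AE_I[of _ _ ?W]) (auto simp: W space)
qed

end



section \<open>Definable measures and averaging\<close>

lemma (in saturated_group) small_model_small: "small_model \<kappa> L G N \<Longrightarrow> small N"
  by (simp add: small_model_def elementary_sub_def small_def)

locale definable_keisler = keisler +
  fixes M
  assumes small_M: "small M"
    and mu_plug: "\<And>Y \<phi> b b'. finite Y \<Longrightarrow> x \<notin> Y \<Longrightarrow> \<phi> \<in> formulas L G (insert x Y) M \<Longrightarrow>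
      b \<in> assignments G \<Longrightarrow> b' \<in> assignments G \<Longrightarrow> tp L G Y M b = tp L G Y M b' \<Longrightarrow>
      \<mu> (plug L b \<phi>) = \<mu> (plug L b' \<phi>)"
    and mu_continuous: "\<And>Y \<phi>. finite Y \<Longrightarrow> x \<notin> Y \<Longrightarrow> \<phi> \<in> formulas L G (insert x Y) M \<Longrightarrow>
      continuous_map (type_topology L G Y M) (top_of_set {0..1})
        (\<lambda>q. \<mu> (plug L (SOME b. b \<in> assignments G \<and> tp L G Y M b = q) \<phi>))"
begin

abbreviation val where "val d \<phi> \<equiv> \<mu> (shift L d \<phi>)"

text \<open>
  Continuity of \<open>d \<mapsto> \<mu> (\<phi>(x \<cdot> d))\<close> in terms of formulas: a strict inequality between this function and a
  constant that holds at \<open>d\<close> is forced by a formula true at \<open>d\<close>. An affine function of the value is used,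
  here and below, so that one statement serves for upper and for lower bounds.
\<close>
lemma open_condition:
  assumes \<phi>: "\<phi> \<in> F V" and d: "d \<in> g" and pos: "0 < \<alpha> * val d \<phi> + \<beta>"
  shows "\<exists>\<theta>\<in>F (M \<union> params \<phi>). holds d \<theta> \<and> (\<forall>d'\<in>g. holds d' \<theta> \<longrightarrow> 0 < \<alpha> * val d' \<phi> + \<beta>)"
proof -
  obtain Y y \<psi> c where fam: "shift_family L G \<phi> Y y \<psi> c"
    using ex_shift_family[OF mul_sorts struct \<phi> order_refl] by blast
  note Y = shift_familyD(1-4)[OF fam] and \<psi> = shift_familyD(5)[OF fam] and c = shift_familyD(6)[OF fam]
    and sat\<psi> = shift_familyD(7)[OF fam] and pull = shift_familyD(8)[OF fam]
  have cd: "c(y := d) \<in> assignments G" if "d \<in> g" for d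
    using c that Y by (intro assignments_upd) auto
  have mu_eq: "\<mu> (plug L (c(y := d)) \<psi>) = val d \<phi>" if d: "d \<in> g" for d
  proof (rule mu_cong)
    have "plug L (c(y := d)) \<psi> \<in> F ({} \<union> (c(y := d)) ` Y)" by (rule plug_formulas[OF \<psi> cd[OF d]])
    moreover have "(c(y := d)) v \<in> V" for v using assignments_sort[OF cd[OF d], of v] sort_elems_univ by metis
    then have "{} \<union> (c(y := d)) ` Y \<subseteq> V" unfolding image_subset_iff Un_empty_left by blast
    ultimately show "plug L (c(y := d)) \<psi> \<in> F V" by (rule F_mono)
    show "shift L d \<phi> \<in> F V" by (rule shift_F_V[OF \<phi> d])
    show "holds a (plug L (c(y := d)) \<psi>) \<longleftrightarrow> holds a (shift L d \<phi>)" if "a \<in> g" for a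
      using sat\<psi>[OF struct c d that] holds_shift[OF \<phi>] by simp
  qed
  have \<psi>M: "\<psi> \<in> formulas L G (insert x Y) M" by (rule formulas_mono[OF \<psi>]) auto
  let ?T = "type_topology L G Y M"
  define f where "f q = \<mu> (plug L (SOME b. b \<in> assignments G \<and> tp L G Y M b = q) \<psi>)" for q
  have f_tp: "f (tp L G Y M (c(y := d))) = val d \<phi>" if d: "d \<in> g" for d
  proof -
    let ?q = "tp L G Y M (c(y := d))"
    let ?b = "SOME b. b \<in> assignments G \<and> tp L G Y M b = ?q"
    have "c(y := d) \<in> assignments G \<and> tp L G Y M (c(y := d)) = ?q"
      using cd[OF d] by (intro conjI refl)
    then have "?b \<in> assignments G \<and> tp L G Y M ?b = ?q"
      by (rule someI[where P = "\<lambda>b. b \<in> assignments G \<and> tp L G Y M b = ?q"])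
    then have "\<mu> (plug L ?b \<psi>) = \<mu> (plug L (c(y := d)) \<psi>)"
      using Y \<psi>M cd[OF d] by (intro mu_plug) auto
    then show ?thesis by (simp add: f_def mu_eq[OF d])
  qed
  have "continuous_map ?T (top_of_set {0..1}) f"
    unfolding f_def by (rule mu_continuous[OF Y(1,2) \<psi>M])
  moreover have "openin (top_of_set {0..1}) ({0..1} \<inter> {t. 0 < \<alpha> * t + \<beta>})"
    by (intro openin_open_Int open_Collect_less continuous_intros)
  ultimately have "openin ?T {q \<in> topspace ?T. f q \<in> {0..1} \<inter> {t. 0 < \<alpha> * t + \<beta>}}"
    by (rule openin_continuous_map_preimage)
  then have op: "openin (topology_generated_by (type_set L G Y M ` formulas L G Y M))
      {q \<in> topspace ?T. f q \<in> {0..1} \<inter> {t. 0 < \<alpha> * t + \<beta>}}"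
    by (simp add: type_topology_eq)
  have top: "topspace ?T = types L G Y M" by (rule topspace_type_topology[OF struct])
  let ?q = "tp L G Y M (c(y := d))"
  have "?q \<in> {q \<in> topspace ?T. f q \<in> {0..1} \<inter> {t. 0 < \<alpha> * t + \<beta>}}"
    using top tp_in_types[OF cd[OF d]] pos f_tp[OF d] mu_nonneg mu_le_1 shift_F_V[OF \<phi> d] by auto
  then obtain u where u: "u \<in> type_set L G Y M ` formulas L G Y M" "?q \<in> u"
      "u \<subseteq> {q \<in> topspace ?T. f q \<in> {0..1} \<inter> {t. 0 < \<alpha> * t + \<beta>}}"
    using op[unfolded algebra.openin_generated_iff[OF algebra_type_sets[OF struct]], THEN conjunct2, THEN bspec]
    by blast
  then obtain \<theta> where \<theta>: "\<theta> \<in> formulas L G Y M" "u = type_set L G Y M \<theta>" by auto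
  obtain \<theta>' where \<theta>': "\<theta>' \<in> F (M \<union> params \<phi>)"
    "\<And>d. d \<in> g \<Longrightarrow> holds d \<theta>' \<longleftrightarrow> sat G (c(y := d)) \<theta>"
    using pull[OF \<theta>(1)] c by blast
  have mem: "tp L G Y M (c(y := d)) \<in> u \<longleftrightarrow> holds d \<theta>'" if "d \<in> g" for d
    using \<theta> \<theta>'(2)[OF that] tp_in_types[OF cd[OF that], of L Y M] by (auto simp: type_set_def tp_def)
  show ?thesis
  proof (intro bexI[of _ \<theta>'] conjI ballI impI)
    show "holds d \<theta>'" using mem[OF d] u by simp
    fix d' assume d': "d' \<in> g" "holds d' \<theta>'"
    then have "tp L G Y M (c(y := d')) \<in> u" using mem by simp
    then show "0 < \<alpha> * val d' \<phi> + \<beta>" using u(3) f_tp[OF d'(1)] by auto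
  qed (rule \<theta>')
qed

text \<open>Otherwise a constant separates the two values, and \<open>open_condition\<close> separates the two types.\<close>
lemma mu_shift_cong:
  assumes \<phi>: "\<phi> \<in> F V" and d: "d \<in> g" "d' \<in> g"
    and eq: "\<And>\<theta>. \<theta> \<in> F (M \<union> params \<phi>) \<Longrightarrow> holds d \<theta> \<longleftrightarrow> holds d' \<theta>"
  shows "val d \<phi> = val d' \<phi>"
proof -
  have "\<not> val d \<phi> < val d' \<phi>"
  proof
    assume "val d \<phi> < val d' \<phi>"
    then have "0 < (-1) * val d \<phi> + val d' \<phi>" by simp
    from open_condition[OF \<phi> d(1) this] eq d(2) show False by fastforce
  qed
  moreover have "\<not> val d' \<phi> < val d \<phi>"
  proof
    assume "val d' \<phi> < val d \<phi>"
    then have "0 < 1 * val d \<phi> + (- val d' \<phi>)" by simp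
    from open_condition[OF \<phi> d(1) this] eq d(2) show False by fastforce
  qed
  ultimately show ?thesis by simp
qed

context
  fixes \<psi> N
  assumes \<psi>: "\<psi> \<in> F V" and star: "star_borel_at \<kappa> L G \<mu> \<mu> \<psi> N"
begin

lemma N_small: "small N" "N \<subseteq> V"
  using star small_model_small small_subset by (auto simp: star_borel_at_def)

lemma realizes_iff:
  assumes "q \<in> xtypes L G N" "d \<in> g"
  shows "realizes G (\<lambda>_. d) q \<longleftrightarrow> realizes_over d q N"
proof
  assume r: "realizes G (\<lambda>_. d) q"
  have "holds d \<phi> \<longleftrightarrow> \<phi> \<in> q" if \<phi>: "\<phi> \<in> F N" for \<phi>
    using r types_Neg_iff[OF assms(1) \<phi>] unfolding realizes_def by (metis sat.simps(3))
  then show "realizes_over d q N" using assms by (simp add: realizes_over_def)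
next
  assume "realizes_over d q N"
  then show "realizes G (\<lambda>_. d) q"
    using assms unfolding realizes_over_def realizes_def types_iff by blast
qed

lemma fiber_value_eq:
  assumes q: "q \<in> supp L G N \<mu>" and d: "realizes_over d q N"
  shows "fiber_value L G \<mu> \<psi> q = val d \<psi>"
proof -
  have qt: "q \<in> xtypes L G N" using q by (simp add: supp_def)
  let ?d = "SOME d. d \<in> g \<and> realizes G (\<lambda>_. d) q"
  have dr: "d \<in> g \<and> realizes G (\<lambda>_. d) q" using d realizes_iff[OF qt] realizes_over_g by blast
  then have "?d \<in> g \<and> realizes G (\<lambda>_. ?d) q" by (rule someI)
  then show ?thesis using star q dr unfolding star_borel_at_def fiber_value_def by blast
qed

lemma generic_N_supp:
  assumes e: "e \<in> generic N"
  shows "\<exists>q\<in>supp L G N \<mu>. realizes_over e q N"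
proof -
  obtain q where q: "q \<in> xtypes L G N" "\<forall>\<phi>\<in>F N. \<phi> \<in> q \<longleftrightarrow> holds e \<phi>"
    using realizing_type[OF generic_g[OF e]] by blast
  then have "q \<in> supp L G N \<mu>" using e by (auto simp: supp_def generic_def types_iff)
  then show ?thesis using q generic_g[OF e] by (auto simp: realizes_over_def)
qed

lemma supp_N_generic:
  assumes q: "q \<in> supp L G N \<mu>" and B: "small B" "N \<subseteq> B"
  shows "\<exists>e\<in>generic B. realizes_over e q N"
proof -
  have qt: "q \<in> xtypes L G N" and pos: "\<And>\<phi>. \<phi> \<in> q \<Longrightarrow> 0 < \<mu> \<phi>" using q by (auto simp: supp_def)
  obtain d where d: "realizes_over d q N" using ex_realizes_over[OF qt N_small(1)] by blast
  then have "d \<in> generic N" using pos by (auto simp: generic_def realizes_over_def)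
  from generic_extend[OF this B(2,1)] obtain e where e: "e \<in> generic B" "\<forall>\<phi>\<in>F N. holds e \<phi> \<longleftrightarrow> holds d \<phi>"
    by blast
  then have "realizes_over e q N" using d generic_g[OF e(1)] by (simp add: realizes_over_def)
  then show ?thesis using e by blast
qed

text \<open>
  The model \<open>N\<close> that computes the convolution is unrelated to the model \<open>M\<close> over which \<open>\<mu>\<close> is definable.
  Still the inequality is forced by a formula over \<open>N\<close>: the formulas over \<open>M \<union> params \<psi>\<close> forcing it
  cover all realizations of the type of \<open>e0\<close> over \<open>N\<close>, as the value depends on this type only, and by
  saturation a finite part of that type already implies a disjunction of finitely many of them.
\<close>
lemma open_condition_N:
  assumes e0: "e0 \<in> generic N" and pos: "0 < \<alpha> * val e0 \<psi> + \<beta>"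
  shows "\<exists>\<theta>\<in>F N. holds e0 \<theta> \<and> (\<forall>e\<in>g. holds e \<theta> \<longrightarrow> 0 < \<alpha> * val e \<psi> + \<beta>)"
proof -
  define A where "A = N \<union> (M \<union> params \<psi>)"
  have A: "small A" unfolding A_def by (intro small_Un N_small small_M params_small \<psi>)
  define good where "good = {\<theta> \<in> F A. \<forall>e\<in>g. holds e \<theta> \<longrightarrow> 0 < \<alpha> * val e \<psi> + \<beta>}"
  define t0 where "t0 = {\<phi> \<in> F N. holds e0 \<phi>}"
  have "\<not> (\<exists>e\<in>g. \<forall>\<phi>\<in>t0 \<union> Neg ` good. holds e \<phi>)"
  proof
    assume "\<exists>e\<in>g. \<forall>\<phi>\<in>t0 \<union> Neg ` good. holds e \<phi>"
    then obtain e where e': "e \<in> g" "\<forall>\<phi>\<in>t0 \<union> Neg ` good. holds e \<phi>" by (elim bexE)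
    have e: "e \<in> g" "\<And>\<phi>. \<phi> \<in> t0 \<Longrightarrow> holds e \<phi>" "\<And>\<phi>. \<phi> \<in> good \<Longrightarrow> \<not> holds e \<phi>"
      using e' bspec[OF e'(2), of "Neg _"] by auto
    obtain q where q: "q \<in> supp L G N \<mu>" "realizes_over e0 q N" using generic_N_supp[OF e0] by blast
    have "holds e \<phi> \<longleftrightarrow> holds e0 \<phi>" if "\<phi> \<in> F N" for \<phi>
      using e(2)[of \<phi>] e(2)[of "Neg \<phi>"] that by (auto simp: t0_def)
    then have "realizes_over e q N" using q(2) e(1) by (simp add: realizes_over_def)
    then have "val e \<psi> = val e0 \<psi>" using fiber_value_eq q by metis
    then have "0 < \<alpha> * val e \<psi> + \<beta>" using pos by simp
    from open_condition[OF \<psi> e(1) this] obtain \<theta> where \<theta>: "\<theta> \<in> F (M \<union> params \<psi>)" "holds e \<theta>"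
      "\<forall>d'\<in>g. holds d' \<theta> \<longrightarrow> 0 < \<alpha> * val d' \<psi> + \<beta>" by blast
    moreover have "\<theta> \<in> F A" by (rule F_mono[OF \<theta>(1)]) (auto simp: A_def)
    ultimately have "\<theta> \<in> good" by (simp add: good_def)
    then show False using e(3) \<theta>(2) by blast
  qed
  moreover have "t0 \<union> Neg ` good \<subseteq> F A"
    using F_mono[of _ N A] by (auto simp: t0_def good_def A_def)
  ultimately have "\<exists>\<Phi>. finite \<Phi> \<and> \<Phi> \<subseteq> t0 \<union> Neg ` good \<and> \<not> (\<exists>a\<in>g. \<forall>\<phi>\<in>\<Phi>. holds a \<phi>)"
    using realize_small[OF A, of "t0 \<union> Neg ` good"] by blast
  then obtain \<Phi> where \<Phi>: "finite \<Phi>" "\<Phi> \<subseteq> t0 \<union> Neg ` good" "\<not> (\<exists>a\<in>g. \<forall>\<phi>\<in>\<Phi>. holds a \<phi>)"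
    by (elim exE conjE)
  have "finite (\<Phi> \<inter> t0)" "\<Phi> \<inter> t0 \<subseteq> F N" using \<Phi> by (auto simp: t0_def)
  from ex_conj_F[OF this] obtain \<theta> where \<theta>: "\<theta> \<in> F N" "\<And>a. holds a \<theta> \<longleftrightarrow> (\<forall>\<phi>\<in>\<Phi> \<inter> t0. holds a \<phi>)"
    by (elim bexE) auto
  show ?thesis
  proof (intro bexI[of _ \<theta>] conjI ballI impI)
    show "holds e0 \<theta>" using \<theta>(2) by (auto simp: t0_def)
    fix e assume e: "e \<in> g" "holds e \<theta>"
    then obtain \<phi> where \<phi>: "\<phi> \<in> \<Phi>" "\<not> holds e \<phi>" using \<Phi>(3) by auto
    then have "\<phi> \<notin> t0" using \<theta>(2) e(2) by auto
    then obtain \<phi>' where "\<phi>' \<in> good" "\<phi> = Neg \<phi>'" using \<Phi>(2) \<phi>(1) by auto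
    then show "0 < \<alpha> * val e \<psi> + \<beta>" using \<phi>(2) e(1) by (auto simp: good_def)
  qed (rule \<theta>)
qed

text \<open>
  The integral formula for \<open>\<mu> \<psi>\<close> turned into a statement on generic elements. A function that is
  nonnegative almost everywhere has integral \<open>0\<close> only if it vanishes almost everywhere, but near a generic
  element where it is positive it is positive on a clopen set of positive measure.
\<close>
lemma averaging_aux:
  assumes int: "(\<integral>q. fiber_value L G \<mu> \<psi> q \<partial>restrict_space (borel_measure L G N \<mu>) (supp L G N \<mu>)) = \<mu> \<psi>"
    and B: "small B" "N \<subseteq> B" and ge: "\<And>e. e \<in> generic B \<Longrightarrow> 0 \<le> \<alpha> * val e \<psi> + \<beta>"
  shows "0 \<le> \<alpha> * \<mu> \<psi> + \<beta>"
    and "e0 \<in> generic N \<Longrightarrow> 0 < \<alpha> * val e0 \<psi> + \<beta> \<Longrightarrow> 0 < \<alpha> * \<mu> \<psi> + \<beta>"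
proof -
  let ?m = "borel_measure L G N \<mu>" and ?S = "supp L G N \<mu>"
  interpret m: prob_space ?m by (rule prob_space_borel_measure[OF N_small(2)])
  define f where "f q = indicator ?S q *\<^sub>R fiber_value L G \<mu> \<psi> q" for q
  have S: "?S \<in> sets ?m" by (rule supp_measurable[OF N_small(2)])
  have fib: "\<exists>e\<in>generic B. realizes_over e q N \<and> f q = val e \<psi>" if "q \<in> ?S" for q
    using supp_N_generic[OF that B] fiber_value_eq[OF that] that by (auto simp: f_def)
  have f01: "0 \<le> f q" "f q \<le> 1" for q
  proof -
    have "0 \<le> f q \<and> f q \<le> 1"
    proof (cases "q \<in> ?S")
      case True
      then obtain e where "e \<in> generic B" "f q = val e \<psi>" using fib by blast
      then show ?thesis using mu_nonneg mu_le_1 shift_F_V[OF \<psi> generic_g] by simp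
    qed (simp add: f_def)
    then show "0 \<le> f q" "f q \<le> 1" by auto
  qed
  have "fiber_value L G \<mu> \<psi> \<in> borel_measurable (restrict_space (borel_types L G N) ?S)"
    using star by (simp add: star_borel_at_def)
  also have "borel_measurable (restrict_space (borel_types L G N) ?S) = borel_measurable (restrict_space ?m ?S)"
    by (intro measurable_cong_sets sets_restrict_space_cong) (simp_all add: sets_borel_measure[OF N_small(2)])
  finally have "f \<in> borel_measurable ?m"
    using S unfolding f_def by (subst (asm) borel_measurable_restrict_space_iff) auto
  then have intf: "integrable ?m f"
    using f01 by (intro m.integrable_const_bound[of _ 1]) auto
  have "(\<integral>q. f q \<partial>?m) = \<mu> \<psi>"
    unfolding int[symmetric] f_def using S by (intro integral_restrict_space[symmetric]) auto
  then have intg: "(\<integral>q. \<alpha> * f q + \<beta> \<partial>?m) = \<alpha> * \<mu> \<psi> + \<beta>"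
    using intf by (simp add: m.prob_space)
  have AEge: "AE q in ?m. 0 \<le> \<alpha> * f q + \<beta>"
    using AE_supp[OF N_small(2)]
  proof eventually_elim
    case (elim q)
    then show ?case using fib[of q] ge by auto
  qed
  then show ge0: "0 \<le> \<alpha> * \<mu> \<psi> + \<beta>"
    unfolding intg[symmetric] by (rule integral_nonneg_AE)
  assume e0: "e0 \<in> generic N" and pos: "0 < \<alpha> * val e0 \<psi> + \<beta>"
  show "0 < \<alpha> * \<mu> \<psi> + \<beta>"
  proof (rule ccontr)
    assume "\<not> 0 < \<alpha> * \<mu> \<psi> + \<beta>"
    then have "(\<integral>q. \<alpha> * f q + \<beta> \<partial>?m) = 0" using ge0 intg by simp
    then have AE0: "AE q in ?m. \<alpha> * f q + \<beta> = 0"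
      using AEge intf by (subst (asm) integral_nonneg_eq_0_iff_AE) auto
    obtain \<theta> where \<theta>: "\<theta> \<in> F N" "holds e0 \<theta>" "\<forall>e\<in>g. holds e \<theta> \<longrightarrow> 0 < \<alpha> * val e \<psi> + \<beta>"
      using open_condition_N[OF e0 pos] by blast
    have "AE q in ?m. q \<notin> type_set L G {x} N \<theta>"
      using AE_supp[OF N_small(2)] AE0
    proof eventually_elim
      case (elim q)
      obtain e where e: "e \<in> generic B" "realizes_over e q N" "f q = val e \<psi>"
        using fib[OF elim(1)] by blast
      then have "\<not> holds e \<theta>" using \<theta>(3) generic_g[OF e(1)] elim(2) by force
      then show ?case using e(2) \<theta>(1) by (auto simp: realizes_over_def type_set_def)
    qed
    then have "measure ?m (type_set L G {x} N \<theta>) = 0"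
      using type_set_measurable[OF N_small(2) \<theta>(1)] m.prob_eq_0 by auto
    then have "\<mu> \<theta> = 0" using measure_type_set[OF N_small(2) \<theta>(1)] by simp
    moreover have "0 < \<mu> \<theta>" using e0 \<theta> by (auto simp: generic_def)
    ultimately show False by simp
  qed
qed

end

end



section \<open>Elementary extensions\<close>

lemma has_sort_cong:
  "(\<And>a. a \<in> tm_params t \<Longrightarrow> so a = so' a) \<Longrightarrow> has_sort L so t s \<longleftrightarrow> has_sort L so' t s"
proof (induction t arbitrary: s)
  case (App f ts)
  have "has_sort L so t s \<longleftrightarrow> has_sort L so' t s" if "t \<in> set ts" for t s
    using App that by (intro App.IH) auto
  then show ?case by (simp add: list_all2_conv_all_nth)
qed auto

lemma well_sorted_cong:
  "(\<And>a. a \<in> params \<phi> \<Longrightarrow> so a = so' a) \<Longrightarrow> well_sorted L so \<phi> \<longleftrightarrow> well_sorted L so' \<phi>"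
proof (induction \<phi>)
  case (Eq t u)
  have "has_sort L so t s \<longleftrightarrow> has_sort L so' t s" "has_sort L so u s \<longleftrightarrow> has_sort L so' u s" for s
    using Eq by (auto intro!: has_sort_cong)
  then show ?case by simp
next
  case (Rel r ts)
  have "has_sort L so t s \<longleftrightarrow> has_sort L so' t s" if "t \<in> set ts" for t s
    using Rel that by (intro has_sort_cong) auto
  then show ?case by (simp add: list_all2_conv_all_nth)
qed auto

lemma formulas_cong:
  assumes "\<And>a. a \<in> A \<Longrightarrow> sort_of G a = sort_of H a"
  shows "formulas L G Y A = formulas L H Y A"
  unfolding formulas_def using well_sorted_cong[of _ "sort_of G" "sort_of H" L] assms by blast

lemma ex_closure:
  fixes \<psi> :: "('s, 'f, 'r, 'm) fm"
  assumes "finite Y" "\<psi> \<in> formulas L G (Y \<union> Z) A"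
  shows "\<exists>\<theta>\<in>formulas L G Z A. \<forall>(H :: ('s, 'f, 'r, 'm) model) e. e \<in> assignments H \<longrightarrow>
    (sat H e \<theta> \<longleftrightarrow> (\<exists>e'\<in>assignments H. (\<forall>v. v \<notin> Y \<longrightarrow> e' v = e v) \<and> sat H e' \<psi>))"
  using assms
proof (induction Y arbitrary: Z)
  case empty
  have "(\<exists>e'\<in>assignments H. (\<forall>v. e' v = e v) \<and> sat H e' \<psi>) \<longleftrightarrow> sat H e \<psi>"
    if "e \<in> assignments H" for H :: "('s, 'f, 'r, 'm) model" and e
    using that by (metis ext)
  then show ?case using empty by (intro bexI[of _ \<psi>]) auto
next
  case (insert y Y)
  have "\<psi> \<in> formulas L G (Y \<union> insert y Z) A" using insert.prems by simp
  from insert.IH[OF this] obtain \<theta> where \<theta>: "\<theta> \<in> formulas L G (insert y Z) A"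
    and sat\<theta>: "\<And>(H :: ('s, 'f, 'r, 'm) model) e. e \<in> assignments H \<Longrightarrow>
      (sat H e \<theta> \<longleftrightarrow> (\<exists>e'\<in>assignments H. (\<forall>v. v \<notin> Y \<longrightarrow> e' v = e v) \<and> sat H e' \<psi>))" by blast
  have "sat H e (Ex y \<theta>) \<longleftrightarrow> (\<exists>e'\<in>assignments H. (\<forall>v. v \<notin> insert y Y \<longrightarrow> e' v = e v) \<and> sat H e' \<psi>)"
    if e: "e \<in> assignments H" for H :: "('s, 'f, 'r, 'm) model" and e
  proof
    assume "sat H e (Ex y \<theta>)"
    then obtain a where a: "a \<in> sort_elems H (fst y)" "sat H (e(y := a)) \<theta>" by auto
    then obtain e' where "e' \<in> assignments H" "\<forall>v. v \<notin> Y \<longrightarrow> e' v = (e(y := a)) v" "sat H e' \<psi>"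
      using sat\<theta>[OF assignments_upd[OF e a(1)]] by blast
    then show "\<exists>e'\<in>assignments H. (\<forall>v. v \<notin> insert y Y \<longrightarrow> e' v = e v) \<and> sat H e' \<psi>"
      by (intro bexI[of _ e']) auto
  next
    assume "\<exists>e'\<in>assignments H. (\<forall>v. v \<notin> insert y Y \<longrightarrow> e' v = e v) \<and> sat H e' \<psi>"
    then obtain e' where e': "e' \<in> assignments H" "\<forall>v. v \<notin> insert y Y \<longrightarrow> e' v = e v" "sat H e' \<psi>" by blast
    have a: "e' y \<in> sort_elems H (fst y)" by (rule assignments_sort[OF e'(1)])
    have "sat H (e(y := e' y)) \<theta>"
      unfolding sat\<theta>[OF assignments_upd[OF e a]] using e' by (intro bexI[of _ e']) auto
    then show "sat H e (Ex y \<theta>)" using a by auto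
  qed
  then show ?case using \<theta> by (intro bexI[of _ "Ex y \<theta>"]) (auto simp: formulas_Ex)
qed

text \<open>The parameters of all formulas in \<open>\<Phi>\<close> are named at once by variables that no formula in \<open>\<Phi>\<close> binds.\<close>
lemma ex_common_tuple:
  fixes \<Phi> :: "('s, 'f, 'r, 'm) fm set"
  assumes K: "is_structure L K" and \<Phi>: "finite \<Phi>" "\<Phi> \<subseteq> formulas L K {xvar L} (univ K)"
  shows "\<exists>Y b h. finite Y \<and> xvar L \<notin> Y \<and> b \<in> assignments K \<and>
    (\<forall>\<phi>\<in>\<Phi>. h \<phi> \<in> formulas L G (insert (xvar L) Y) {} \<and>
      (\<forall>(H :: ('s, 'f, 'r, 'm) model) a. sat H (\<lambda>_. a) (plug L b (h \<phi>)) \<longleftrightarrow> sat H (\<lambda>_. a) \<phi>))"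
proof -
  let ?x = "xvar L"
  define F where "F = \<Union>(params ` \<Phi>)"
  have F: "finite F" "F \<subseteq> univ K" using \<Phi> finite_params by (auto simp: F_def formulas_def)
  let ?V = "\<Union>(bv ` \<Phi>) \<union> {?x}"
  have "finite ?V" using \<Phi> finite_bv by auto
  from ex_fresh_naming[OF F(1) this] obtain k
    where k: "inj_on k F" "k ` F \<inter> ?V = {}" "\<And>c. fst (k c) = sort_of K c" by blast
  obtain c0 where c0: "c0 \<in> assignments K" using ex_assignment[OF K] by blast
  from ex_naming_assignment[OF k(1) k(3) F(2) c0]
  obtain c where c: "c \<in> assignments K" and ck': "\<forall>u\<in>F. c (k u) = u" by blast
  have ck: "c (k u) = u" if "u \<in> F" for u using ck' that by blast
  have abs: "abstract k \<phi> \<in> formulas L G (insert ?x (k ` F)) {}" if "\<phi> \<in> \<Phi>" for \<phi>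
  proof -
    have \<phi>: "well_sorted L (sort_of K) \<phi>" "fv \<phi> \<subseteq> {?x}" "params \<phi> \<subseteq> F"
      using that \<Phi> by (auto simp: F_def formulas_def)
    then have "fv (abstract k \<phi>) \<subseteq> insert ?x (k ` F)" using fv_abstract[of k \<phi>] by blast
    then show ?thesis
      using k(3) \<phi>(1) by (auto simp: params_abstract intro!: formulasI well_sorted_abstract)
  qed
  have eq: "sat H (\<lambda>_. a) (plug L c (abstract k \<phi>)) \<longleftrightarrow> sat H (\<lambda>_. a) \<phi>"
    if \<phi>: "\<phi> \<in> \<Phi>" for H :: "('s, 'f, 'r, 'm) model" and a \<phi>
  proof -
    have "sat H (\<lambda>_. a) (plug L c (abstract k \<phi>)) \<longleftrightarrow> sat H (c(?x := a)) (abstract k \<phi>)"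
      by (simp add: sat_plug)
    also have "\<dots> \<longleftrightarrow> sat H (c(?x := a)) \<phi>"
    proof (rule sat_abstract)
      fix u assume "u \<in> params \<phi>"
      then have u: "u \<in> F" using \<phi> by (auto simp: F_def)
      then have "k u \<noteq> ?x" using k(2) by blast
      then show "(c(?x := a)) (k u) = u" using ck[OF u] by simp
    next
      show "k ` params \<phi> \<inter> bv \<phi> = {}" using k(2) \<phi> by (fastforce simp: F_def)
    qed
    also have "\<dots> \<longleftrightarrow> sat H (\<lambda>_. a) \<phi>"
      using \<Phi> \<phi> by (intro sat_point'[of \<phi> L K "univ K"]) auto
    finally show ?thesis .
  qed
  show ?thesis
    using F k abs eq c by (intro exI[of _ "k ` F"] exI[of _ c] exI[of _ "abstract k"]) auto
qed

lemma types_point_entails: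
  assumes p: "p \<in> xtypes L H A" and \<phi>: "\<phi> \<in> p" and \<phi>': "\<phi>' \<in> formulas L H {xvar L} A"
    and imp: "\<And>a. a \<in> gelems L H \<Longrightarrow> sat H (\<lambda>_. a) \<phi> \<Longrightarrow> sat H (\<lambda>_. a) \<phi>'"
  shows "\<phi>' \<in> p"
proof (rule types_entails[OF p \<phi>', of "{\<phi>}"])
  fix e assume e: "e \<in> assignments H" and "\<And>\<psi>. \<psi> \<in> {\<phi>} \<Longrightarrow> sat H e \<psi>"
  then have "sat H e \<phi>" by blast
  moreover have "\<phi> \<in> formulas L H {xvar L} A" using p \<phi> by (auto simp: types_iff)
  ultimately have "sat H (\<lambda>_. e (xvar L)) \<phi>" using sat_point[of \<phi> L H A H e] by blast
  then have "sat H (\<lambda>_. e (xvar L)) \<phi>'" using imp assignments_gelems[OF e] by blast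
  then show "sat H e \<phi>'" using sat_point[OF \<phi>'] by blast
qed (use \<phi> in auto)

locale monster_extension = saturated_group +
  fixes U :: "('a, 'b, 'c, 'd) model" and \<kappa>' :: "'l rel"
  assumes card_U: "Card_order \<kappa>'" "infinite (Field \<kappa>')"
    and saturated_U: "saturated \<kappa>' L U"
    and elem: "elementary_sub L G U"
    and small_G: "|V| <o \<kappa>'"
begin

lemma struct_U: "is_structure L U"
  and V_U: "V \<subseteq> univ U"
  and sort_GU: "a \<in> V \<Longrightarrow> sort_of G a = sort_of U a"
  using elem by (auto simp: elementary_sub_def)

lemma sort_elems_GU: "a \<in> sort_elems G s \<Longrightarrow> a \<in> sort_elems U s"
  using V_U sort_GU by (auto simp: sort_elems_def)

lemma assignments_GU: "e \<in> assignments G \<Longrightarrow> e \<in> assignments U"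
  using sort_elems_GU by (auto simp: assignments_def)

lemma formulas_GU: "A \<subseteq> V \<Longrightarrow> formulas L U Y A = formulas L G Y A"
  using sort_GU by (intro formulas_cong) auto

text \<open>Elementarity, stated for formulas of the language, extends to parameters by reading these as values of
  fresh variables.\<close>
lemma sat_GU:
  assumes \<phi>: "\<phi> \<in> formulas L G Y V" and e: "e \<in> assignments G"
  shows "sat U e \<phi> \<longleftrightarrow> sat G e \<phi>"
proof -
  have fin: "finite (params \<phi>)" "finite (fv \<phi> \<union> bv \<phi>)" by (simp_all add: finite_params finite_fv finite_bv)
  from ex_fresh_naming[OF this] obtain k where k: "inj_on k (params \<phi>)"
    "k ` params \<phi> \<inter> (fv \<phi> \<union> bv \<phi>) = {}" "\<And>c. fst (k c) = sort_of G c" by blast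
  have "params \<phi> \<subseteq> V" using \<phi> by (auto simp: formulas_def)
  from ex_naming_assignment[OF k(1) k(3) this e]
  obtain e' where e': "e' \<in> assignments G" and ek: "\<forall>u\<in>params \<phi>. e' (k u) = u"
    and off: "\<forall>v. v \<notin> k ` params \<phi> \<longrightarrow> e' v = e v" by blast
  have abs: "abstract k \<phi> \<in> formulas L G UNIV {}"
    using \<phi> k(3) by (auto simp: formulas_def params_abstract intro!: well_sorted_abstract)
  have eq: "sat H e \<phi> \<longleftrightarrow> sat H e' (abstract k \<phi>)" for H :: "('a, 'b, 'c, 'd) model"
  proof -
    have "sat H e \<phi> \<longleftrightarrow> sat H e' \<phi>" using k(2) off by (intro sat_cong) (metis IntI UnI1 empty_iff)
    also have "\<dots> \<longleftrightarrow> sat H e' (abstract k \<phi>)"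
      using ek k(2) by (intro sat_abstract[symmetric]) auto
    finally show ?thesis .
  qed
  show ?thesis unfolding eq using elem abs e' by (auto simp: elementary_sub_def)
qed

lemma holds_GU:
  assumes \<phi>: "\<phi> \<in> F V" and a: "a \<in> g"
  shows "sat U (\<lambda>_. a) \<phi> \<longleftrightarrow> holds a \<phi>"
proof -
  obtain e where e: "e \<in> assignments G" "e x = a" using ex_assignment_point[OF struct a] by blast
  show ?thesis using sat_GU[OF \<phi> e(1)] sat_point'[OF \<phi>, of e a] e(2) by simp
qed

text \<open>
  The type of \<open>b\<close> over \<open>M\<close> is finitely satisfiable in \<open>G\<close> by elementarity, hence realized in \<open>G\<close> by
  saturation.
\<close>
lemma tuple_realize:
  assumes "finite Y" and M: "small M" and b: "b \<in> assignments U"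
  shows "\<exists>c\<in>assignments G. tp L U Y M b = tp L G Y M c"
proof -
  let ?p = "tp L U Y M b"
  have MV: "M \<subseteq> V" by (rule small_subset[OF M])
  have sub: "?p \<subseteq> formulas L G Y M" using formulas_GU[OF MV] by (auto simp: tp_def)
  have "finitely_satisfiable G ?p"
    unfolding finitely_satisfiable_def
  proof safe
    fix \<Phi> assume \<Phi>: "finite \<Phi>" "\<Phi> \<subseteq> ?p"
    then obtain \<psi> where \<psi>: "\<psi> \<in> formulas L G Y M"
      "\<And>(H :: ('a, 'b, 'c, 'd) model) e. is_structure L H \<Longrightarrow> (sat H e \<psi> \<longleftrightarrow> (\<forall>\<phi>\<in>\<Phi>. sat H e \<phi>))"
      using ex_finite_conj[of \<Phi> L G Y M] sub by blast
    have "\<psi> \<in> formulas L G (Y \<union> {}) M" using \<psi>(1) by simp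
    from ex_closure[OF \<open>finite Y\<close> this] obtain \<theta> where \<theta>: "\<theta> \<in> formulas L G {} M"
      "\<And>(H :: ('a, 'b, 'c, 'd) model) e. e \<in> assignments H \<Longrightarrow>
        (sat H e \<theta> \<longleftrightarrow> (\<exists>e'\<in>assignments H. (\<forall>v. v \<notin> Y \<longrightarrow> e' v = e v) \<and> sat H e' \<psi>))" by blast
    have "sat U b \<psi>" using \<psi>(2)[OF struct_U] \<Phi> by (auto simp: tp_def)
    then have "sat U b \<theta>" using \<theta>(2)[OF b] b by auto
    obtain e where e: "e \<in> assignments G" using ex_assignment[OF struct] by blast
    have "sat U e \<theta>" using \<open>sat U b \<theta>\<close> \<theta>(1) sat_cong[of \<theta> b e U] by (auto simp: formulas_def)
    then have "sat G e \<theta>" using sat_GU[OF _ e, of \<theta> "{}"] formulas_mono[OF \<theta>(1) order_refl MV] by simp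
    then obtain e' where "e' \<in> assignments G" "sat G e' \<psi>" using \<theta>(2)[OF e] by blast
    then show "\<exists>e\<in>assignments G. \<forall>\<phi>\<in>\<Phi>. sat G e \<phi>" using \<psi>(2)[OF struct] by blast
  qed
  then obtain c where c: "c \<in> assignments G" "\<forall>\<phi>\<in>?p. sat G c \<phi>"
    using saturated_realize[OF saturated, of M Y ?p] sub M \<open>finite Y\<close> by (auto simp: small_def)
  have "sat G c \<phi> \<longleftrightarrow> sat U b \<phi>" if \<phi>: "\<phi> \<in> formulas L G Y M" for \<phi>
  proof (cases "sat U b \<phi>")
    case True
    then have "\<phi> \<in> ?p" using \<phi> formulas_GU[OF MV, of Y] by (simp add: tp_def)
    then show ?thesis using c(2) True by blast
  next
    case False
    then have "Neg \<phi> \<in> ?p" using \<phi> formulas_GU[OF MV, of Y] by (simp add: tp_def)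
    then have "sat G c (Neg \<phi>)" using c(2) by blast
    then show ?thesis using False by simp
  qed
  then have "?p = tp L G Y M c" using formulas_GU[OF MV, of Y] by (auto simp: tp_def)
  then show ?thesis using c(1) by blast
qed


section \<open>Invariant extensions and products of types\<close>

lemma plug_F:
  assumes "\<psi> \<in> formulas L G (insert x Y) {}" "c \<in> assignments G"
  shows "plug L c \<psi> \<in> F V"
proof -
  have "plug L c \<psi> \<in> F ({} \<union> c ` Y)" by (rule plug_formulas[OF assms])
  moreover have "c v \<in> V" for v using assignments_sort[OF assms(2), of v] sort_elems_univ by metis
  then have "{} \<union> c ` Y \<subseteq> V" unfolding image_subset_iff Un_empty_left by blast
  ultimately show ?thesis by (rule F_mono)
qed

lemma plug_U:
  assumes "\<psi> \<in> formulas L G (insert x Y) {}" "b \<in> assignments U"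
  shows "plug L b \<psi> \<in> formulas L U {x} (univ U)"
proof -
  have "\<psi> \<in> formulas L U (insert x Y) {}" using assms(1) formulas_GU[of "{}"] by simp
  then have "plug L b \<psi> \<in> formulas L U {x} ({} \<union> b ` Y)" by (rule plug_formulas[OF _ assms(2)])
  moreover have "b v \<in> univ U" for v using assignments_sort[OF assms(2), of v] sort_elems_univ by metis
  then have "{} \<union> b ` Y \<subseteq> univ U" unfolding image_subset_iff Un_empty_left by blast
  ultimately show ?thesis by (rule formulas_mono[OF _ order_refl])
qed

context
  fixes p M
  assumes p: "p \<in> xtypes L G V" and M: "small M" and inv: "invariant L G M p"
begin

text \<open>
  The \<open>M\<close>-invariant extension of \<open>p\<close> to \<open>U\<close> is forced: whether \<open>\<psi>(x; b)\<close> belongs to it is decided by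
  whether \<open>\<psi>(x; c)\<close> belongs to \<open>p\<close>, for a tuple \<open>c\<close> of \<open>G\<close> with the type of \<open>b\<close> over \<open>M\<close>. A formula over
  \<open>U\<close> can be written as \<open>\<psi>(x; b)\<close> in many ways, and the lemmas up to \<open>mem_extension_iff\<close> show that all of them
  give the same answer.
\<close>
definition moved where
  "moved Y \<psi> b c \<longleftrightarrow> finite Y \<and> x \<notin> Y \<and> \<psi> \<in> formulas L G (insert x Y) {} \<and>
    b \<in> assignments U \<and> c \<in> assignments G \<and> tp L U Y M b = tp L G Y M c"

definition extension where
  "extension = {\<phi> \<in> formulas L U {x} (univ U). \<exists>Y \<psi> b c. moved Y \<psi> b c \<and>
    (\<forall>a\<in>gelems L U. sat U (\<lambda>_. a) (plug L b \<psi>) \<longleftrightarrow> sat U (\<lambda>_. a) \<phi>) \<and> plug L c \<psi> \<in> p}"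

lemma invD:
  assumes "finite Y" "x \<notin> Y" "\<psi> \<in> formulas L G (insert x Y) {}" "c \<in> assignments G" "c' \<in> assignments G"
    "tp L G Y M c = tp L G Y M c'"
  shows "plug L c \<psi> \<in> p \<longleftrightarrow> plug L c' \<psi> \<in> p"
  using inv assms unfolding invariant_def by blast

lemma MV: "M \<subseteq> V" by (rule small_subset[OF M])

lemma tp_UG_iff:
  "tp L U Y M b = tp L G Y M c \<longleftrightarrow> (\<forall>\<theta>\<in>formulas L G Y M. sat U b \<theta> \<longleftrightarrow> sat G c \<theta>)"
  using formulas_GU[OF MV, of Y] by (auto simp: tp_def)

text \<open>
  With disjoint tuples of variables, \<open>b\<close> and \<open>b'\<close> form one tuple, whose type over \<open>M\<close> contains the formula
  saying that \<open>\<psi>(x; b)\<close> implies \<open>\<psi>'(x; b')\<close>. A realization of this type in \<open>G\<close> carries the implication to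
  \<open>p\<close>, and by invariance \<open>p\<close> sees no difference between it and \<open>c\<close>, \<open>c'\<close>.
\<close>
lemma moved_entails_disjoint:
  assumes 1: "moved Y \<psi> b c" and 2: "moved Y' \<psi>' b' c'" and disj: "Y \<inter> Y' = {}"
    and imp: "\<And>a. a \<in> gelems L U \<Longrightarrow> sat U (\<lambda>_. a) (plug L b \<psi>) \<Longrightarrow> sat U (\<lambda>_. a) (plug L b' \<psi>')"
    and mem: "plug L c \<psi> \<in> p"
  shows "plug L c' \<psi>' \<in> p"
proof -
  define b2 where "b2 v = (if v \<in> Y then b v else b' v)" for v
  have b2: "b2 \<in> assignments U"
    using 1 2 by (auto simp: moved_def assignments_def b2_def)
  obtain d where d: "d \<in> assignments G" "tp L U (Y \<union> Y') M b2 = tp L G (Y \<union> Y') M d"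
    using tuple_realize[OF _ M b2, of "Y \<union> Y'"] 1 2 by (auto simp: moved_def)
  have dth: "sat U b2 \<theta> \<longleftrightarrow> sat G d \<theta>" if "\<theta> \<in> formulas L G (Y \<union> Y') M" for \<theta>
    using d(2) that unfolding tp_UG_iff by blast
  have "tp L U Y M b = tp L G Y M d"
    unfolding tp_UG_iff
  proof
    fix \<theta> assume \<theta>: "\<theta> \<in> formulas L G Y M"
    have "sat U b \<theta> \<longleftrightarrow> sat U b2 \<theta>" using \<theta> by (intro sat_cong) (auto simp: b2_def formulas_def)
    then show "sat U b \<theta> \<longleftrightarrow> sat G d \<theta>" using dth[of \<theta>] formulas_mono[OF \<theta>] by blast
  qed
  then have m1: "plug L d \<psi> \<in> p" using 1 mem invD[of Y \<psi> c d] d(1) by (simp add: moved_def)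
  have "tp L U Y' M b' = tp L G Y' M d"
    unfolding tp_UG_iff
  proof
    fix \<theta> assume \<theta>: "\<theta> \<in> formulas L G Y' M"
    have "sat U b' \<theta> \<longleftrightarrow> sat U b2 \<theta>" using \<theta> disj by (intro sat_cong) (auto simp: b2_def formulas_def)
    then show "sat U b' \<theta> \<longleftrightarrow> sat G d \<theta>" using dth[of \<theta>] formulas_mono[OF \<theta>] by blast
  qed
  then have m2: "plug L d \<psi>' \<in> p \<longleftrightarrow> plug L c' \<psi>' \<in> p" using 2 invD[of Y' \<psi>' d c'] d(1) by (simp add: moved_def)
  let ?\<theta> = "Neg (Ex x (Conj \<psi> (Neg \<psi>')))"
  have \<theta>: "?\<theta> \<in> formulas L G (Y \<union> Y') M" using 1 2 by (auto simp: moved_def formulas_def)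
  have "sat U b2 ?\<theta>"
  proof -
    have "sat U (b2(x := a)) \<psi>'" if a: "a \<in> gelems L U" and s: "sat U (b2(x := a)) \<psi>" for a
    proof -
      have "sat U (b2(x := a)) \<psi> \<longleftrightarrow> sat U (b(x := a)) \<psi>"
        using 1 by (intro sat_cong) (auto simp: b2_def moved_def formulas_def)
      then have "sat U (\<lambda>_. a) (plug L b \<psi>)" using s by (simp add: sat_plug)
      then have "sat U (\<lambda>_. a) (plug L b' \<psi>')" by (rule imp[OF a])
      then have "sat U (b'(x := a)) \<psi>'" by (simp add: sat_plug)
      moreover have "sat U (b2(x := a)) \<psi>' \<longleftrightarrow> sat U (b'(x := a)) \<psi>'"
        using 2 disj by (intro sat_cong) (auto simp: b2_def moved_def formulas_def)
      ultimately show ?thesis by simp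
    qed
    then show ?thesis by (auto simp: xvar_def)
  qed
  then have "sat G d ?\<theta>" using dth[OF \<theta>] by blast
  then have "holds a (plug L d \<psi>')" if "a \<in> g" "holds a (plug L d \<psi>)" for a
    using that by (auto simp: sat_plug xvar_def)
  then have "plug L d \<psi>' \<in> p"
    using types_point_entails[OF p m1, of "plug L d \<psi>'"] plug_F[of \<psi>' Y' d] 2 d(1) by (auto simp: moved_def)
  then show ?thesis using m2 by simp
qed

text \<open>Fresh names for the variables of a tuple make two tuples disjoint, as the previous lemma demands.\<close>
lemma moved_rename:
  assumes 1: "moved Y \<psi> b c" and W: "finite W"
  shows "\<exists>Y' \<psi>' b' c'. moved Y' \<psi>' b' c' \<and> Y' \<inter> W = {} \<and>
    (\<forall>a\<in>gelems L U. sat U (\<lambda>_. a) (plug L b' \<psi>') \<longleftrightarrow> sat U (\<lambda>_. a) (plug L b \<psi>)) \<and>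
    (plug L c' \<psi>' \<in> p \<longleftrightarrow> plug L c \<psi> \<in> p)"
proof -
  have Y: "finite Y" "x \<notin> Y" and \<psi>: "\<psi> \<in> formulas L G (insert x Y) {}"
    and b: "b \<in> assignments U" and c: "c \<in> assignments G" and tp: "tp L U Y M b = tp L G Y M c"
    using 1 by (auto simp: moved_def)
  have "finite (insert x (W \<union> Y))" using Y W by simp
  from ex_fresh_naming[OF Y(1) this, of fst] obtain k
    where k: "inj_on k Y" "k ` Y \<inter> insert x (W \<union> Y) = {}" "\<And>v. fst (k v) = fst v" by blast
  define k' where "k' = inv_into Y k"
  have k'k: "k' (k v) = v" if "v \<in> Y" for v using that k(1) by (simp add: k'_def)
  have kY: "k v \<notin> Y" "k v \<noteq> x" if "v \<in> Y" for v using that k(2) by blast+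
  have "\<exists>\<psi>'\<in>formulas L G ((insert x Y - Y) \<union> k ` Y) {}. \<forall>(H :: ('a, 'b, 'c, 'd) model) e.
    e \<in> assignments H \<longrightarrow> (sat H e \<psi>' \<longleftrightarrow> sat H (\<lambda>v. if v \<in> Y then e (k v) else e v) \<psi>)"
    by (rule ex_rename[OF Y(1) _ _ \<psi>]) (use k kY in auto)
  then obtain \<psi>' where \<psi>': "\<psi>' \<in> formulas L G ((insert x Y - Y) \<union> k ` Y) {}"
    and sat\<psi>': "\<And>(H :: ('a, 'b, 'c, 'd) model) e. e \<in> assignments H \<Longrightarrow>
      (sat H e \<psi>' \<longleftrightarrow> sat H (\<lambda>v. if v \<in> Y then e (k v) else e v) \<psi>)" by blast
  define r where "r e v = (if v \<in> k ` Y then e (k' v) else e v)" for e :: "'a var \<Rightarrow> 'd" and v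
  have r: "r e \<in> assignments H" if "e \<in> assignments H" for e and H :: "('a, 'b, 'c, 'd) model"
    unfolding assignments_def
  proof safe
    fix s n
    show "r e (s, n) \<in> sort_elems H (fst (s, n))"
    proof (cases "(s, n) \<in> k ` Y")
      case True
      then obtain v where v: "(s, n) = k v" "v \<in> Y" by auto
      then show ?thesis using assignments_sort[OF that, of v] k'k[OF v(2)] k(3)[of v] by (simp add: r_def)
    next
      case False
      then show ?thesis using assignments_sort[OF that, of "(s, n)"] by (simp add: r_def)
    qed
  qed
  have plug_eq: "sat H (\<lambda>_. a) (plug L (r e) \<psi>') \<longleftrightarrow> sat H (\<lambda>_. a) (plug L e \<psi>)"
    if "e \<in> assignments H" "a \<in> gelems L H" for e a and H :: "('a, 'b, 'c, 'd) model"
  proof -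
    have ra: "(r e)(x := a) \<in> assignments H"
      using r[OF that(1)] that(2) by (intro assignments_upd) (auto simp: xvar_def)
    have "sat H (\<lambda>_. a) (plug L (r e) \<psi>') \<longleftrightarrow> sat H ((r e)(x := a)) \<psi>'" by (simp add: sat_plug)
    also have "\<dots> \<longleftrightarrow> sat H (\<lambda>v. if v \<in> Y then ((r e)(x := a)) (k v) else ((r e)(x := a)) v) \<psi>"
      by (rule sat\<psi>'[OF ra])
    also have "\<dots> \<longleftrightarrow> sat H (e(x := a)) \<psi>"
      using \<psi> kY k'k Y(2) by (intro sat_cong) (auto simp: r_def formulas_def)
    also have "\<dots> \<longleftrightarrow> sat H (\<lambda>_. a) (plug L e \<psi>)" by (simp add: sat_plug)
    finally show ?thesis .
  qed
  have tp': "tp L U (k ` Y) M (r b) = tp L G (k ` Y) M (r c)"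
    unfolding tp_UG_iff
  proof
    fix \<theta> assume \<theta>: "\<theta> \<in> formulas L G (k ` Y) M"
    have *: "\<exists>\<theta>'\<in>formulas L G ((k ` Y - k ` Y) \<union> k' ` k ` Y) M. \<forall>(H :: ('a, 'b, 'c, 'd) model) e.
      e \<in> assignments H \<longrightarrow> (sat H e \<theta>' \<longleftrightarrow> sat H (\<lambda>v. if v \<in> k ` Y then e (k' v) else e v) \<theta>)"
    proof (rule ex_rename[OF _ _ _ \<theta>])
      show "finite (k ` Y)" using Y by simp
      fix y assume "y \<in> k ` Y"
      then obtain v where v: "y = k v" "v \<in> Y" by auto
      then show "fst (k' y) = fst y" using k(3)[of v] k'k[of v] by simp
      show "k' y \<notin> k ` Y" using v k'k[of v] kY by auto
    qed
    have 1: "(k ` Y - k ` Y) \<union> k' ` k ` Y = Y" using k'k by (auto simp: image_image)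
    have 2: "(\<lambda>v. if v \<in> k ` Y then e (k' v) else e v) = r e" for e
      by (simp add: r_def fun_eq_iff)
    obtain \<theta>' where \<theta>': "\<theta>' \<in> formulas L G Y M"
      "\<And>(H :: ('a, 'b, 'c, 'd) model) e. e \<in> assignments H \<Longrightarrow> (sat H e \<theta>' \<longleftrightarrow> sat H (r e) \<theta>)"
      using *[unfolded 1 2] by (elim bexE) blast
    then show "sat U (r b) \<theta> \<longleftrightarrow> sat G (r c) \<theta>"
      using tp b c unfolding tp_UG_iff by blast
  qed
  have \<psi>'': "\<psi>' \<in> formulas L G (insert x (k ` Y)) {}"
    by (rule formulas_mono[OF \<psi>']) auto
  have "moved (k ` Y) \<psi>' (r b) (r c)"
    using \<psi>'' r[OF b] r[OF c] tp' k(2) Y by (auto simp: moved_def)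
  moreover have "plug L (r c) \<psi>' \<in> p \<longleftrightarrow> plug L c \<psi> \<in> p"
    using types_point_entails[OF p] plug_eq[OF c] plug_F[OF \<psi> c] plug_F[OF \<psi>'' r[OF c]] by blast
  moreover have "k ` Y \<inter> W = {}" using k(2) by auto
  moreover have "\<forall>a\<in>gelems L U. sat U (\<lambda>_. a) (plug L (r b) \<psi>') \<longleftrightarrow> sat U (\<lambda>_. a) (plug L b \<psi>)"
    using plug_eq[OF b] by blast
  ultimately show ?thesis by blast
qed

lemma moved_entails:
  assumes 1: "moved Y \<psi> b c" and 2: "moved Y' \<psi>' b' c'"
    and imp: "\<And>a. a \<in> gelems L U \<Longrightarrow> sat U (\<lambda>_. a) (plug L b \<psi>) \<Longrightarrow> sat U (\<lambda>_. a) (plug L b' \<psi>')"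
    and mem: "plug L c \<psi> \<in> p"
  shows "plug L c' \<psi>' \<in> p"
proof -
  have "finite Y" using 1 by (simp add: moved_def)
  from moved_rename[OF 2 this] obtain Y2 \<psi>2 b2 c2 where *: "moved Y2 \<psi>2 b2 c2" "Y2 \<inter> Y = {}"
    "\<forall>a\<in>gelems L U. sat U (\<lambda>_. a) (plug L b2 \<psi>2) \<longleftrightarrow> sat U (\<lambda>_. a) (plug L b' \<psi>')"
    "plug L c2 \<psi>2 \<in> p \<longleftrightarrow> plug L c' \<psi>' \<in> p" by blast
  have "plug L c2 \<psi>2 \<in> p"
    by (rule moved_entails_disjoint[OF 1 *(1) _ _ mem]) (use *(2,3) imp in auto)
  then show ?thesis using *(4) by simp
qed

lemma mem_extension_iff:
  assumes "moved Y \<psi> b c" "\<phi> \<in> formulas L U {x} (univ U)"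
    "\<And>a. a \<in> gelems L U \<Longrightarrow> sat U (\<lambda>_. a) (plug L b \<psi>) \<longleftrightarrow> sat U (\<lambda>_. a) \<phi>"
  shows "\<phi> \<in> extension \<longleftrightarrow> plug L c \<psi> \<in> p"
proof
  assume "\<phi> \<in> extension"
  then obtain Y' \<psi>' b' c' where "moved Y' \<psi>' b' c'" "plug L c' \<psi>' \<in> p"
    "\<forall>a\<in>gelems L U. sat U (\<lambda>_. a) (plug L b' \<psi>') \<longleftrightarrow> sat U (\<lambda>_. a) \<phi>" by (auto simp: extension_def)
  then show "plug L c \<psi> \<in> p"
    using assms by (intro moved_entails[of Y' \<psi>' b' c' Y \<psi> b c]) auto
next
  assume "plug L c \<psi> \<in> p"
  then show "\<phi> \<in> extension" using assms unfolding extension_def by blast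
qed

text \<open>One tuple serves for finitely many formulas, so finite satisfiability of the extension reduces to that of \<open>p\<close>.\<close>
lemma ex_moved:
  assumes "finite \<Phi>" "\<Phi> \<subseteq> formulas L U {x} (univ U)"
  shows "\<exists>Y b c h. \<forall>\<phi>\<in>\<Phi>. moved Y (h \<phi>) b c \<and>
    (\<forall>(H :: ('a, 'b, 'c, 'd) model) a. sat H (\<lambda>_. a) (plug L b (h \<phi>)) \<longleftrightarrow> sat H (\<lambda>_. a) \<phi>)"
proof -
  obtain Y b h where *: "finite Y" "x \<notin> Y" "b \<in> assignments U"
    "\<forall>\<phi>\<in>\<Phi>. h \<phi> \<in> formulas L G (insert x Y) {} \<and>
      (\<forall>(H :: ('a, 'b, 'c, 'd) model) a. sat H (\<lambda>_. a) (plug L b (h \<phi>)) \<longleftrightarrow> sat H (\<lambda>_. a) \<phi>)"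
    using ex_common_tuple[OF struct_U assms, of G] by (elim exE conjE)
  obtain c where "c \<in> assignments G" "tp L U Y M b = tp L G Y M c"
    using tuple_realize[OF *(1) M *(3)] by blast
  with * show ?thesis
    by (intro exI[of _ Y] exI[of _ b] exI[of _ c] exI[of _ h]) (simp add: moved_def)
qed

lemma extension_types: "extension \<in> xtypes L U (univ U)"
  unfolding types_iff
proof (intro conjI ballI)
  show sub: "extension \<subseteq> formulas L U {x} (univ U)" by (auto simp: extension_def)
  show "finitely_satisfiable U extension"
    unfolding finitely_satisfiable_def
  proof safe
    fix \<Phi> assume \<Phi>: "finite \<Phi>" "\<Phi> \<subseteq> extension"
    show "\<exists>e\<in>assignments U. \<forall>\<phi>\<in>\<Phi>. sat U e \<phi>"
    proof (cases "\<Phi> = {}")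
      case True
      then show ?thesis using ex_assignment[OF struct_U] by auto
    next
      case False
      obtain Y b c h where *: "\<forall>\<phi>\<in>\<Phi>. moved Y (h \<phi>) b c \<and>
        (\<forall>(H :: ('a, 'b, 'c, 'd) model) a. sat H (\<lambda>_. a) (plug L b (h \<phi>)) \<longleftrightarrow> sat H (\<lambda>_. a) \<phi>)"
        using ex_moved[OF \<Phi>(1)] \<Phi>(2) sub by (meson subset_trans)
      have mem: "plug L c (h \<phi>) \<in> p" if "\<phi> \<in> \<Phi>" for \<phi>
      proof -
        have "\<phi> \<in> extension \<longleftrightarrow> plug L c (h \<phi>) \<in> p"
          by (rule mem_extension_iff[of Y _ b]) (use * that \<Phi> sub in auto)
        then show ?thesis using \<Phi> that by auto
      qed
      have mv: "x \<notin> Y" "b \<in> assignments U" "c \<in> assignments G" "tp L U Y M b = tp L G Y M c"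
        using * False by (auto simp: moved_def)
      have "finite (h ` \<Phi>)" "h ` \<Phi> \<subseteq> formulas L G (insert x Y) {}" using * \<Phi> by (auto simp: moved_def)
      from ex_finite_conj[OF this] obtain \<psi> where \<psi>: "\<psi> \<in> formulas L G (insert x Y) {}"
        "\<And>(H :: ('a, 'b, 'c, 'd) model) e. is_structure L H \<Longrightarrow> (sat H e \<psi> \<longleftrightarrow> (\<forall>\<phi>\<in>h ` \<Phi>. sat H e \<phi>))"
        by (elim bexE) blast
      have "\<exists>a\<in>g. \<forall>\<phi>\<in>(\<lambda>\<phi>. plug L c (h \<phi>)) ` \<Phi>. holds a \<phi>"
        using \<Phi> mem by (intro type_satisfiable[OF p]) auto
      then obtain a where a: "a \<in> g" "\<forall>\<phi>\<in>\<Phi>. holds a (plug L c (h \<phi>))" by auto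
      then have "sat G (c(x := a)) \<psi>" using \<psi>(2)[OF struct] by (simp add: sat_plug)
      then have "sat G c (Ex x \<psi>)" using a(1) by (auto simp: xvar_def)
      moreover have "Ex x \<psi> \<in> formulas L G Y M" using \<psi>(1) by (auto simp: formulas_def)
      ultimately have "sat U b (Ex x \<psi>)" using mv(4) unfolding tp_UG_iff by blast
      then obtain a' where a': "a' \<in> gelems L U" "sat U (b(x := a')) \<psi>" by (auto simp: xvar_def)
      then have "sat U (\<lambda>_. a') \<phi>" if "\<phi> \<in> \<Phi>" for \<phi>
      proof -
        have "sat U (b(x := a')) (h \<phi>)" using \<psi>(2)[OF struct_U] a'(2) that by simp
        then have "sat U (\<lambda>_. a') (plug L b (h \<phi>))" by (simp add: sat_plug)
        then show ?thesis using * that by blast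
      qed
      moreover obtain e where e: "e \<in> assignments U" "e x = a'"
        using ex_assignment_point[OF struct_U a'(1)] by blast
      ultimately have "sat U e \<phi>" if "\<phi> \<in> \<Phi>" for \<phi>
        using that \<Phi>(2) sub sat_point'[of \<phi> L U "univ U" e a' U] by blast
      then show ?thesis using e(1) by blast
    qed
  qed
  fix \<phi> assume \<phi>: "\<phi> \<in> formulas L U {x} (univ U)"
  then obtain Y b c h where *: "moved Y (h \<phi>) b c"
    "\<And>(H :: ('a, 'b, 'c, 'd) model) a. sat H (\<lambda>_. a) (plug L b (h \<phi>)) \<longleftrightarrow> sat H (\<lambda>_. a) \<phi>"
    using ex_moved[of "{\<phi>}"] by auto
  have "moved Y (Neg (h \<phi>)) b c" using *(1) by (simp add: moved_def)
  then have 1: "Neg \<phi> \<in> extension \<longleftrightarrow> plug L c (Neg (h \<phi>)) \<in> p"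
    using \<phi> *(2) by (intro mem_extension_iff[of Y _ b]) (auto simp: sat_plug)
  have 2: "\<phi> \<in> extension \<longleftrightarrow> plug L c (h \<phi>) \<in> p"
    using \<phi> * by (intro mem_extension_iff[of Y _ b]) auto
  have "plug L c (h \<phi>) \<in> F V" using *(1) plug_F[of "h \<phi>" Y c] by (simp add: moved_def)
  then have "plug L c (h \<phi>) \<in> p \<or> Neg (plug L c (h \<phi>)) \<in> p" using p by (auto simp: types_iff)
  then show "\<phi> \<in> extension \<or> Neg \<phi> \<in> extension" using 1 2 by (simp add: plug_def)
qed

lemma extension_invariant: "invariant L U M extension"
  unfolding invariant_def
proof (intro allI impI ballI)
  fix Y \<psi> b b'
  assume Y: "finite Y \<and> x \<notin> Y" and \<psi>: "\<psi> \<in> formulas L U (insert x Y) {}"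
    and b: "b \<in> assignments U" and b': "b' \<in> assignments U" and eq: "tp L U Y M b = tp L U Y M b'"
  have \<psi>G: "\<psi> \<in> formulas L G (insert x Y) {}" using \<psi> formulas_GU[of "{}"] by simp
  obtain c where c: "c \<in> assignments G" "tp L U Y M b = tp L G Y M c"
    using tuple_realize[OF _ M b] Y by blast
  have "moved Y \<psi> b c" "moved Y \<psi> b' c" using Y \<psi>G b b' c eq by (auto simp: moved_def)
  then show "plug L b \<psi> \<in> extension \<longleftrightarrow> plug L b' \<psi> \<in> extension"
    using mem_extension_iff plug_U[OF \<psi>G] b b' by metis
qed

lemma extension_extends: "p \<subseteq> extension"
proof
  fix \<phi> assume mem: "\<phi> \<in> p"
  then have \<phi>: "\<phi> \<in> F V" using p by (auto simp: types_iff)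
  then obtain Y b h where *: "finite Y" "x \<notin> Y" "b \<in> assignments G"
    "h \<phi> \<in> formulas L G (insert x Y) {}"
    "\<And>(H :: ('a, 'b, 'c, 'd) model) a. sat H (\<lambda>_. a) (plug L b (h \<phi>)) \<longleftrightarrow> sat H (\<lambda>_. a) \<phi>"
    using ex_common_tuple[OF struct, of "{\<phi>}" G] by auto
  have "tp L U Y M b = tp L G Y M b"
    unfolding tp_UG_iff using sat_GU[OF _ *(3)] formulas_mono[OF _ order_refl MV] by blast
  then have "moved Y (h \<phi>) b b" using * assignments_GU by (simp add: moved_def)
  moreover have "\<phi> \<in> formulas L U {x} (univ U)"
    using \<phi> formulas_GU[OF order_refl, of "{x}"] V_U formulas_mono by blast
  moreover have "plug L b (h \<phi>) \<in> p"
    using types_point_entails[OF p mem plug_F[OF *(4,3)]] *(5) by blast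
  ultimately show "\<phi> \<in> extension" using mem_extension_iff *(5) by blast
qed

end

end



context monster_extension
begin

text \<open>
  As \<open>a\<close> realizes \<open>p'\<close> over \<open>b\<close>, the formula \<open>\<phi>\<close> holds at \<open>a \<cdot> b\<close> iff \<open>\<phi>(x \<cdot> b)\<close> is in \<open>p'\<close>; invariance of
  \<open>p'\<close> replaces \<open>b\<close> by an element \<open>d\<close> of \<open>G\<close> with the same type over \<open>M\<close> and the parameters of \<open>\<phi>\<close>.
\<close>
lemma product_witness_mem:
  assumes p: "p \<in> xtypes L G V" and q: "q \<in> xtypes L G V" and M: "small_model \<kappa> L G M"
    and p': "p' \<in> xtypes L U (univ U)" "invariant L U M p'" "p \<subseteq> p'"
    and b: "b \<in> gelems L U" "realizes U (\<lambda>_. b) q"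
    and a: "a \<in> gelems L U" "realizes U (\<lambda>_. a) (p' \<inter> formulas L U {x} (insert b V))"
    and \<phi>: "\<phi> \<in> F V" and d: "realizes_over d q (M \<union> params \<phi>)"
  shows "\<phi> \<in> tp L U {x} V (\<lambda>_. gmul L U a b) \<longleftrightarrow> shift L d \<phi> \<in> p"
proof -
  have MV: "M \<subseteq> V" using small_model_small[OF M] by (rule small_subset)
  have dg: "d \<in> g" using d by (rule realizes_over_g)
  have \<phi>U: "\<phi> \<in> formulas L U {x} V" using \<phi> formulas_GU[OF order_refl] by simp
  have sb: "shift L b \<phi> \<in> formulas L U {x} (insert b V)"
    by (rule shift_formulas[OF mul_sorts \<phi>U b(1)])
  have bVU: "insert b V \<subseteq> univ U" using sort_elems_univ[OF b(1)] V_U by simp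
  have sbU: "shift L b \<phi> \<in> formulas L U {x} (univ U)" by (rule formulas_mono[OF sb order_refl bVU])
  have sdV: "shift L d \<phi> \<in> F V" by (rule shift_F_V[OF \<phi> dg])
  then have sdU: "shift L d \<phi> \<in> formulas L U {x} (univ U)"
    using formulas_mono[OF _ order_refl V_U] formulas_GU[OF order_refl] by blast
  have "\<phi> \<in> tp L U {x} V (\<lambda>_. gmul L U a b) \<longleftrightarrow> sat U (\<lambda>_. a) (shift L b \<phi>)"
    using \<phi>U sat_shift[OF \<phi>, of U a b] by (simp add: tp_def)
  also have "\<dots> \<longleftrightarrow> shift L b \<phi> \<in> p'"
  proof
    assume "shift L b \<phi> \<in> p'"
    then show "sat U (\<lambda>_. a) (shift L b \<phi>)" using a(2) sb unfolding realizes_def by blast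
  next
    assume s: "sat U (\<lambda>_. a) (shift L b \<phi>)"
    show "shift L b \<phi> \<in> p'"
    proof (rule ccontr)
      assume "shift L b \<phi> \<notin> p'"
      then have "Neg (shift L b \<phi>) \<in> p' \<inter> formulas L U {x} (insert b V)"
        using types_Neg_iff[OF p'(1) sbU] sb by simp
      then have "sat U (\<lambda>_. a) (Neg (shift L b \<phi>))" using a(2) unfolding realizes_def by blast
      then show False using s by simp
    qed
  qed
  also have "\<dots> \<longleftrightarrow> shift L d \<phi> \<in> p'"
  proof -
    obtain Y y \<psi> c where fam: "shift_family L G \<phi> Y y \<psi> c"
      using ex_shift_family[OF mul_sorts struct \<phi> order_refl] by blast
    note Y = shift_familyD(1-4)[OF fam] and \<psi> = shift_familyD(5)[OF fam] and c = shift_familyD(6)[OF fam]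
      and sat\<psi> = shift_familyD(7)[OF fam] and pull = shift_familyD(8)[OF fam]
    have cU: "c \<in> assignments U" by (rule assignments_GU[OF c])
    have upd: "c(y := e) \<in> assignments U" if "e \<in> gelems L U" for e
      using cU that Y(4) by (intro assignments_upd) auto
    have eq: "shift L e \<phi> \<in> p' \<longleftrightarrow> plug L (c(y := e)) \<psi> \<in> p'"
      if e: "e \<in> gelems L U" "shift L e \<phi> \<in> formulas L U {x} (univ U)" for e
    proof -
      have iff: "sat U (\<lambda>_. a) (plug L (c(y := e)) \<psi>) \<longleftrightarrow> sat U (\<lambda>_. a) (shift L e \<phi>)"
        if "a \<in> gelems L U" for a
        using sat\<psi>[OF struct_U cU e(1) that] sat_shift[OF \<phi>] by simp
      have "plug L (c(y := e)) \<psi> \<in> formulas L U {x} (univ U)" by (rule plug_U[OF \<psi> upd[OF e(1)]])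
      then show ?thesis using types_point_entails[OF p'(1)] iff e(2) by blast
    qed
    have "tp L U Y M (c(y := b)) = tp L U Y M (c(y := d))"
    proof -
      have "sat U (c(y := b)) \<theta> \<longleftrightarrow> sat U (c(y := d)) \<theta>" if \<theta>: "\<theta> \<in> formulas L G Y M" for \<theta>
      proof -
        obtain \<theta>' where \<theta>': "\<theta>' \<in> F (M \<union> params \<phi>)"
          "\<And>(H :: ('a, 'b, 'c, 'd) model) d. c \<in> assignments H \<Longrightarrow> d \<in> gelems L H \<Longrightarrow>
            (sat H (\<lambda>_. d) \<theta>' \<longleftrightarrow> sat H (c(y := d)) \<theta>)"
          using pull[OF \<theta>] by blast
        have sub: "M \<union> params \<phi> \<subseteq> V" using MV \<phi> by (auto simp: formulas_def)
        have \<theta>V: "\<theta>' \<in> F V" by (rule F_mono[OF \<theta>'(1) sub])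
        have "sat U (\<lambda>_. b) \<theta>' \<longleftrightarrow> \<theta>' \<in> q"
          using b(2) types_Neg_iff[OF q \<theta>V] unfolding realizes_def by (metis sat.simps(3))
        also have "\<dots> \<longleftrightarrow> holds d \<theta>'" using d \<theta>'(1) by (auto simp: realizes_over_def)
        also have "\<dots> \<longleftrightarrow> sat U (\<lambda>_. d) \<theta>'" by (rule holds_GU[OF \<theta>V dg, symmetric])
        finally show ?thesis using \<theta>'(2)[OF cU] b(1) sort_elems_GU[OF dg] by blast
      qed
      then show ?thesis using formulas_GU[OF MV, of Y] by (auto simp: tp_def)
    qed
    moreover have "\<psi> \<in> formulas L U (insert x Y) {}" using \<psi> formulas_GU[of "{}"] by simp
    ultimately have "plug L (c(y := b)) \<psi> \<in> p' \<longleftrightarrow> plug L (c(y := d)) \<psi> \<in> p'"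
      using p'(2) Y upd[OF b(1)] upd[OF sort_elems_GU[OF dg]] unfolding invariant_def by blast
    then show ?thesis using eq[OF b(1) sbU] eq[OF sort_elems_GU[OF dg] sdU] by simp
  qed
  also have "\<dots> \<longleftrightarrow> shift L d \<phi> \<in> p"
    using p'(3) types_Neg_iff[OF p sdV] types_Neg_iff[OF p'(1) sdU] by blast
  finally show ?thesis .
qed

lemma card_insert_G: "|insert b V| <o \<kappa>'"
proof -
  have "finite (Field |{b}| )" by (simp add: Field_card_of)
  then have "|{b}| <o \<kappa>'"
    by (rule finite_ordLess_infinite[OF card_of_Well_order card_order_on_well_order_on[OF card_U(1)] _ card_U(2)])
  from card_of_Un_ordLess_infinite_Field[OF card_U(2,1) this small_G] show ?thesis by simp
qed

lemma realize_in_U: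
  assumes A: "A \<subseteq> univ U" "|A| <o \<kappa>'" and \<Gamma>: "\<Gamma> \<subseteq> formulas L U {x} A" "finitely_satisfiable U \<Gamma>"
  shows "\<exists>a\<in>gelems L U. realizes U (\<lambda>_. a) \<Gamma>"
proof -
  obtain e where e: "e \<in> assignments U" "\<forall>\<phi>\<in>\<Gamma>. sat U e \<phi>"
    using saturated_realize[OF saturated_U A _ \<Gamma>] by auto
  then have "realizes U (\<lambda>_. e x) \<Gamma>"
    using sat_point[of _ L U A U e] \<Gamma>(1) unfolding realizes_def by blast
  then show ?thesis using assignments_gelems[OF e(1)] by blast
qed

text \<open>
  The product computed inside \<open>G\<close>. The membership criterion mentions neither the extension of \<open>p\<close> nor the
  realizations in \<open>U\<close>, so it also shows that all choices in the product lead to the same type; two choices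
  made for different models are compared at a realization of \<open>q\<close> over both models.
\<close>
theorem type_prod_mem:
  assumes p: "p \<in> xtypes L G V" and q: "q \<in> xtypes L G V" and M: "small_model \<kappa> L G M"
    and inv: "invariant L G M p" "invariant L G M q"
    and \<phi>: "\<phi> \<in> F V" and d: "realizes_over d q (M \<union> params \<phi>)"
  shows "\<phi> \<in> type_prod \<kappa> L G U p q \<longleftrightarrow> shift L d \<phi> \<in> p"
proof -
  define W where "W r M p' a b \<longleftrightarrow>
        small_model \<kappa> L G M \<and> invariant L G M p \<and> invariant L G M q \<and>
        p' \<in> xtypes L U (univ U) \<and> invariant L U M p' \<and> p \<subseteq> p' \<and>
        b \<in> gelems L U \<and> realizes U (\<lambda>_. b) q \<and>
        a \<in> gelems L U \<and>
        realizes U (\<lambda>_. a) (p' \<inter> formulas L U {x} (insert b V)) \<and>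
        r = tp L U {x} V (\<lambda>_. gmul L U a b)" for r M p' a b
  have mem: "\<phi> \<in> r \<longleftrightarrow> shift L d \<phi> \<in> p"
    if "W r M p' a b" "\<phi> \<in> F V" "realizes_over d q (M \<union> params \<phi>)" for r M p' a b \<phi> d
    using that product_witness_mem[OF p q, of M p' b a \<phi> d] unfolding W_def by blast
  have unique: "r1 = r2" if 1: "W r1 M1 p1 a1 b1" and 2: "W r2 M2 p2 a2 b2" for r1 r2 M1 M2 p1 p2 a1 a2 b1 b2
  proof -
    have "\<phi> \<in> r1 \<longleftrightarrow> \<phi> \<in> r2" if \<phi>: "\<phi> \<in> F V" for \<phi>
    proof -
      have s: "small (M1 \<union> M2 \<union> params \<phi>)"
        using 1 2 unfolding W_def by (intro small_Un small_model_small params_small \<phi>) auto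
      obtain d where d: "realizes_over d q (M1 \<union> M2 \<union> params \<phi>)"
        using ex_realizes_over[OF q s small_subset[OF s]] by blast
      have "realizes_over d q (M1 \<union> params \<phi>)" "realizes_over d q (M2 \<union> params \<phi>)"
        by (rule realizes_over_subset[OF d]; auto)+
      then show ?thesis using mem[OF 1 \<phi>] mem[OF 2 \<phi>] by blast
    qed
    moreover have "r1 \<subseteq> F V" "r2 \<subseteq> F V"
      using 1 2 formulas_GU[OF order_refl, of "{x}"] unfolding W_def by (auto simp: tp_def)
    ultimately show ?thesis by blast
  qed
  have "\<exists>r p' a b. W r M p' a b"
  proof -
    have sM: "small M" by (rule small_model_small[OF M])
    let ?p' = "extension p M"
    note e = extension_types[OF p sM inv(1)] extension_invariant[OF p sM inv(1)] extension_extends[OF p sM inv(1)]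
    have fq: "finitely_satisfiable U q"
      unfolding finitely_satisfiable_def
    proof safe
      fix \<Phi> assume \<Phi>: "finite \<Phi>" "\<Phi> \<subseteq> q"
      have "finitely_satisfiable G q" using q by (simp add: types_iff)
      from finitely_satisfiableD[OF this \<Phi>] obtain e where e: "e \<in> assignments G" "\<forall>\<phi>\<in>\<Phi>. sat G e \<phi>" by blast
      have "\<Phi> \<subseteq> F V" using \<Phi> q by (auto simp: types_iff)
      then have "\<forall>\<phi>\<in>\<Phi>. sat U e \<phi>" using e sat_GU[OF _ e(1)] by blast
      then show "\<exists>e\<in>assignments U. \<forall>\<phi>\<in>\<Phi>. sat U e \<phi>" using assignments_GU[OF e(1)] by blast
    qed
    have "q \<subseteq> formulas L U {x} V" using q formulas_GU[OF order_refl] by (auto simp: types_iff)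
    from realize_in_U[OF V_U small_G this fq] obtain b where b: "b \<in> gelems L U" "realizes U (\<lambda>_. b) q" by blast
    have "insert b V \<subseteq> univ U" using sort_elems_univ[OF b(1)] V_U by simp
    moreover have "finitely_satisfiable U (?p' \<inter> formulas L U {x} (insert b V))"
      by (rule finitely_satisfiable_mono[of U ?p']) (use e(1) in \<open>auto simp: types_iff\<close>)
    ultimately obtain a where "a \<in> gelems L U" "realizes U (\<lambda>_. a) (?p' \<inter> formulas L U {x} (insert b V))"
      using realize_in_U[of "insert b V" "?p' \<inter> formulas L U {x} (insert b V)"] card_insert_G by auto
    then have "W (tp L U {x} V (\<lambda>_. gmul L U a b)) M ?p' a b"
      unfolding W_def using e M inv b by (intro conjI refl)
    then show ?thesis by (intro exI)
  qed
  then obtain r p' a b where w: "W r M p' a b" by blast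
  have "type_prod \<kappa> L G U p q = (THE r. \<exists>M p' a b. W r M p' a b)"
    unfolding type_prod_def W_def by simp
  also have "\<dots> = r"
    by (rule the_equality) (use w unique in blast)+
  finally show ?thesis using mem[OF w \<phi> d] by simp
qed

end

section \<open>Closed ideals of the support\<close>

locale idempotent_setting =
  definable_keisler L G \<kappa> \<mu> M + monster_extension L G \<kappa> U \<kappa>'
  for L :: "('s, 'f, 'r) language" and G :: "('s, 'f, 'r, 'm) model" and \<kappa> :: "'k rel" and \<mu> M
    and U :: "('s, 'f, 'r, 'm) model" and \<kappa>' :: "'l rel" +
  fixes M'
  assumes M': "small_model \<kappa> L G M'" and S_inv: "\<And>p. p \<in> S \<Longrightarrow> invariant L G M' p"
    and idem: "idempotent \<kappa> L G \<mu>"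
begin

text \<open>
  \<open>\<mu> \<psi>\<close> is an average of the values \<open>\<mu> (\<psi>(x \<cdot> e))\<close> at generic \<open>e\<close>: it satisfies the bounds that they satisfy,
  strictly if one of them does. The bounds may be checked over an arbitrarily large small set \<open>B\<close>, since every
  type of the support over \<open>N\<close> has a realization that is generic over \<open>B\<close>.
\<close>
definition averages where
  "averages N \<psi> \<longleftrightarrow> small N \<and> (\<forall>B \<alpha> \<beta>. small B \<longrightarrow> N \<subseteq> B \<longrightarrow> (\<forall>e\<in>generic B. 0 \<le> \<alpha> * val e \<psi> + \<beta>) \<longrightarrow>
    0 \<le> \<alpha> * \<mu> \<psi> + \<beta> \<and>
    (\<forall>e\<in>generic N. 0 < \<alpha> * val e \<psi> + \<beta> \<longrightarrow> 0 < \<alpha> * \<mu> \<psi> + \<beta>))"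

lemma averages_small: "averages N \<psi> \<Longrightarrow> small N"
  and averages_nonneg: "averages N \<psi> \<Longrightarrow> small B \<Longrightarrow> N \<subseteq> B \<Longrightarrow>
    (\<And>e. e \<in> generic B \<Longrightarrow> 0 \<le> \<alpha> * val e \<psi> + \<beta>) \<Longrightarrow> 0 \<le> \<alpha> * \<mu> \<psi> + \<beta>"
  and averages_pos: "averages N \<psi> \<Longrightarrow> small B \<Longrightarrow> N \<subseteq> B \<Longrightarrow>
    (\<And>e. e \<in> generic B \<Longrightarrow> 0 \<le> \<alpha> * val e \<psi> + \<beta>) \<Longrightarrow>
    e \<in> generic N \<Longrightarrow> 0 < \<alpha> * val e \<psi> + \<beta> \<Longrightarrow> 0 < \<alpha> * \<mu> \<psi> + \<beta>"
  by (simp_all add: averages_def) blast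

lemma ex_averages:
  assumes \<psi>: "\<psi> \<in> F V"
  shows "\<exists>N. averages N \<psi>"
proof -
  let ?N = "SOME N. star_borel_at \<kappa> L G \<mu> \<mu> \<psi> N"
  have "\<exists>N. star_borel_at \<kappa> L G \<mu> \<mu> \<psi> N"
    using idem \<psi> by (simp add: idempotent_def star_borel_def)
  then have star: "star_borel_at \<kappa> L G \<mu> \<mu> \<psi> ?N" by (rule someI_ex)
  have "convolution \<kappa> L G \<mu> \<mu> \<psi> = \<mu> \<psi>" using idem \<psi> by (simp add: idempotent_def)
  then have int: "(\<integral>q. fiber_value L G \<mu> \<psi> q \<partial>restrict_space (borel_measure L G ?N \<mu>) (supp L G ?N \<mu>)) = \<mu> \<psi>"
    unfolding convolution_def Let_def .
  show ?thesis
    unfolding averages_def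
  proof (intro exI[of _ ?N] conjI allI impI ballI)
    show "small ?N" by (rule N_small[OF \<psi> star])
    fix B \<alpha> \<beta>
    assume B: "small B" "?N \<subseteq> B" and ge: "\<forall>e\<in>generic B. 0 \<le> \<alpha> * val e \<psi> + \<beta>"
    note avg = averaging_aux[OF \<psi> star int B, of \<alpha> \<beta>]
    show "0 \<le> \<alpha> * \<mu> \<psi> + \<beta>" using ge by (intro avg(1)) simp
    show "0 < \<alpha> * \<mu> \<psi> + \<beta>" if "e \<in> generic ?N" "0 < \<alpha> * val e \<psi> + \<beta>" for e
      using ge by (intro avg(2)[OF _ that]) simp
  qed
qed

text \<open>
  The average \<open>\<mu> \<theta>\<close> of nonnegative values is positive if one value at a generic element is. Moving \<open>d\<close> to an
  element with the same type over \<open>A\<close> that is also generic over \<open>N\<close> does not change the value.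
\<close>
lemma mu_pos_of_shift:
  assumes \<theta>: "\<theta> \<in> F V" and A: "small A" "M \<union> params \<theta> \<subseteq> A" and d: "d \<in> generic A" and pos: "0 < val d \<theta>"
  shows "0 < \<mu> \<theta>"
proof -
  obtain N where avg: "averages N \<theta>" using ex_averages[OF \<theta>] by blast
  note sN = averages_small[OF avg]
  obtain d' where d': "d' \<in> generic (A \<union> N)" "\<forall>\<phi>\<in>F A. holds d' \<phi> \<longleftrightarrow> holds d \<phi>"
    using generic_extend[OF d, of "A \<union> N"] small_Un[OF A(1) sN] by auto
  have "val d' \<theta> = val d \<theta>"
    using mu_shift_cong[OF \<theta> generic_g[OF d'(1)] generic_g[OF d]] d'(2) F_mono[OF _ A(2)] by blast
  then have "0 < 1 * val d' \<theta> + 0" using pos by simp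
  moreover have "0 \<le> 1 * val e \<theta> + 0" if "e \<in> generic N" for e
    using mu_nonneg[OF shift_F_V[OF \<theta> generic_g[OF that]]] by simp
  ultimately have "0 < 1 * \<mu> \<theta> + 0"
    using generic_subset[OF d'(1), of N] by (intro averages_pos[OF avg sN order_refl, of 1 0 d']) auto
  then show ?thesis by simp
qed

text \<open>The support is closed under the product, in terms of realizations.\<close>
lemma generic_mult:
  assumes A: "small A" "M \<subseteq> A" and d: "d \<in> generic A" and e: "e \<in> generic (insert d A)"
  shows "e \<cdot> d \<in> generic A"
proof -
  note dg = generic_g[OF d] and eg = generic_g[OF e]
  have "0 < \<mu> \<theta>" if \<theta>: "\<theta> \<in> F A" "holds (e \<cdot> d) \<theta>" for \<theta>
  proof (rule mu_pos_of_shift[OF _ A(1) _ d])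
    show "\<theta> \<in> F V" by (rule F_mono[OF \<theta>(1) small_subset[OF A(1)]])
    show "M \<union> params \<theta> \<subseteq> A" using A(2) \<theta>(1) by (auto simp: formulas_def)
    have "holds e (shift L d \<theta>)" using \<theta> holds_shift by blast
    then show "0 < val d \<theta>" using e shift_F[OF \<theta>(1) dg] by (auto simp: generic_def)
  qed
  then show ?thesis using mult_closed[OF eg dg] by (auto simp: generic_def)
qed

text \<open>
  The supremum over the compact support is attained by continuity. In terms of elements: the formulas
  keeping the value away from the supremum on generic elements, among them all null formulas, can be avoided
  finitely many at a time, hence simultaneously, and an element avoiding all of them is generic and takes
  the supremum as its value.
\<close>
lemma ex_maximal_generic:
  assumes \<phi>: "\<phi> \<in> F V" and A: "small A" "M \<union> params \<phi> \<subseteq> A"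
  shows "\<exists>d\<in>generic A. \<forall>e\<in>generic A. val e \<phi> \<le> val d \<phi>"
proof -
  let ?f = "\<lambda>d. val d \<phi>"
  define m where "m = Sup (?f ` generic A)"
  have AV: "A \<subseteq> V" by (rule small_subset[OF A(1)])
  have bdd: "bdd_above (?f ` generic A)"
    using mu_le_1 shift_F_V[OF \<phi> generic_g] by (intro bdd_aboveI2[of _ _ 1]) blast
  have le: "?f e \<le> m" if "e \<in> generic A" for e
    unfolding m_def using bdd that by (intro cSup_upper) auto
  define \<Gamma> where "\<Gamma> = {\<theta> \<in> F A. \<exists>t<m. \<forall>e\<in>generic A. holds e \<theta> \<longrightarrow> ?f e \<le> t}"
  have "\<exists>a\<in>g. \<forall>\<phi>\<in>Neg ` \<Gamma>. holds a \<phi>"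
  proof (rule realize_small[OF A(1)])
    show "Neg ` \<Gamma> \<subseteq> F A" by (auto simp: \<Gamma>_def)
    fix \<Phi> assume "finite \<Phi>" "\<Phi> \<subseteq> Neg ` \<Gamma>"
    from finite_subset_image[OF this] obtain \<Psi> where \<Psi>: "\<Psi> \<subseteq> \<Gamma>" "finite \<Psi>" "\<Phi> = Neg ` \<Psi>"
      by (elim exE conjE)
    have "\<exists>t. \<forall>\<theta>\<in>\<Psi>. t \<theta> < m \<and> (\<forall>e\<in>generic A. holds e \<theta> \<longrightarrow> ?f e \<le> t \<theta>)"
      using \<Psi>(1) unfolding \<Gamma>_def by (intro bchoice) blast
    then obtain t where t: "\<And>\<theta>. \<theta> \<in> \<Psi> \<Longrightarrow> t \<theta> < m"
      "\<And>\<theta> e. \<theta> \<in> \<Psi> \<Longrightarrow> e \<in> generic A \<Longrightarrow> holds e \<theta> \<Longrightarrow> ?f e \<le> t \<theta>" by blast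
    let ?t = "Max (insert (m - 1) (t ` \<Psi>))"
    have "?t < m" using \<Psi>(2) t(1) by (subst Max_less_iff) auto
    then obtain e where e: "e \<in> generic A" "?t < ?f e"
      unfolding m_def using less_cSup_iff[OF _ bdd] ex_generic[OF A(1)] by auto
    have "\<not> holds e \<theta>" if "\<theta> \<in> \<Psi>" for \<theta>
    proof
      assume "holds e \<theta>"
      then have "?f e \<le> t \<theta>" using t(2) that e(1) by blast
      also have "\<dots> \<le> ?t" using \<Psi>(2) that by (intro Max_ge) auto
      finally show False using e(2) by simp
    qed
    then show "\<exists>a\<in>g. \<forall>\<phi>\<in>\<Phi>. holds a \<phi>" using generic_g[OF e(1)] \<Psi>(3) by auto
  qed
  then obtain d where d: "d \<in> g" "\<And>\<theta>. \<theta> \<in> \<Gamma> \<Longrightarrow> \<not> holds d \<theta>" by auto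
  have "d \<in> generic A"
  proof -
    have "0 < \<mu> \<theta>" if \<theta>: "\<theta> \<in> F A" "holds d \<theta>" for \<theta>
    proof (rule ccontr)
      assume "\<not> 0 < \<mu> \<theta>"
      then have "\<forall>e\<in>generic A. holds e \<theta> \<longrightarrow> ?f e \<le> m - 1" using \<theta>(1) by (auto simp: generic_def)
      then have "\<theta> \<in> \<Gamma>" unfolding \<Gamma>_def using \<theta>(1) by (auto intro!: exI[of _ "m - 1"])
      then show False using d(2) \<theta>(2) by blast
    qed
    then show ?thesis using d(1) by (auto simp: generic_def)
  qed
  moreover have "\<not> ?f d < m"
  proof
    assume "?f d < m"
    then obtain t where t: "?f d < t" "t < m" using dense by blast
    then have "0 < (-1) * ?f d + t" by simp
    from open_condition[OF \<phi> d(1) this] obtain \<theta> where \<theta>: "\<theta> \<in> F (M \<union> params \<phi>)" "holds d \<theta>"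
      "\<forall>d'\<in>g. holds d' \<theta> \<longrightarrow> 0 < (-1) * ?f d' + t" by blast
    have "\<theta> \<in> \<Gamma>" unfolding \<Gamma>_def
      using F_mono[OF \<theta>(1) A(2)] \<theta>(3) t(2) generic_g by (fastforce intro!: exI[of _ t])
    then show False using d(2) \<theta>(2) by blast
  qed
  ultimately show ?thesis using le by force
qed

text \<open>
  Let \<open>\<phi>\<close> have positive measure and belong to no type in \<open>I\<close>. The value \<open>\<mu> (\<phi>(x \<cdot> d))\<close> has a positive maximum
  at some generic \<open>d\<close>, realizing \<open>q\<close> say. This maximum is the average of the values at \<open>e \<cdot> d\<close>, none of
  which exceeds it. But if \<open>e\<close> realizes a type \<open>p\<close> in \<open>I\<close>, then \<open>e \<cdot> d\<close> realizes \<open>s = p * q\<close> in \<open>I\<close>, and the value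
  at \<open>e \<cdot> d\<close> is \<open>0\<close>: otherwise \<open>\<phi>(x \<cdot> e \<cdot> d)\<close> belongs to some \<open>p1\<close> in the support, so \<open>\<phi>\<close> belongs to \<open>p1 * s\<close>,
  which is in \<open>I\<close>.
\<close>
theorem closed_ideal_eq_support:
  assumes closed: "closedin (subtopology (type_topology L G {x} V) S) I"
    and ideal: "two_sided_ideal (type_prod \<kappa> L G U) S I"
  shows "I = S"
proof (rule ccontr)
  assume neq: "I \<noteq> S"
  have IS: "I \<subseteq> S" and I_ne: "I \<noteq> {}"
    and left: "\<And>p q. p \<in> S \<Longrightarrow> q \<in> I \<Longrightarrow> type_prod \<kappa> L G U p q \<in> I"
    and right: "\<And>p q. p \<in> S \<Longrightarrow> q \<in> I \<Longrightarrow> type_prod \<kappa> L G U q p \<in> I"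
    using ideal by (auto simp: two_sided_ideal_def)
  obtain p0 where p0: "p0 \<in> S" "p0 \<notin> I" using neq IS by blast
  have S_xt: "S \<subseteq> xtypes L G V" by (auto simp: supp_def)
  obtain C where C: "closedin (type_topology L G {x} V) C" "I = C \<inter> S"
    using closed unfolding closedin_subtopology by blast
  obtain \<phi> where \<phi>: "\<phi> \<in> F V" "\<phi> \<in> p0" and disj: "\<And>q. q \<in> I \<Longrightarrow> \<phi> \<notin> q"
  proof -
    interpret algebra "xtypes L G V" "type_set L G {x} V ` F V" by (rule algebra_type_sets[OF struct])
    note top = topspace_type_topology[OF struct, of "{x}" V]
    have "openin (topology_generated_by (type_set L G {x} V ` F V)) (xtypes L G V - C)"
      using C(1) unfolding closedin_def top by (simp add: type_topology_eq)
    moreover have "p0 \<in> xtypes L G V - C" using p0 C(2) S_xt by blast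
    ultimately have "\<exists>b\<in>type_set L G {x} V ` F V. p0 \<in> b \<and> b \<subseteq> xtypes L G V - C"
      unfolding openin_generated_iff by blast
    then obtain \<phi> where "\<phi> \<in> F V" "p0 \<in> type_set L G {x} V \<phi>" "type_set L G {x} V \<phi> \<subseteq> xtypes L G V - C"
      by blast
    moreover have "I \<subseteq> C" "I \<subseteq> xtypes L G V" using C(2) IS S_xt by blast+
    ultimately show thesis by (intro that[of \<phi>]) (auto simp: type_set_def)
  qed
  have pos: "0 < \<mu> \<phi>" using S_pos[OF p0(1) \<phi>(2)] .
  have sM': "small M'" by (rule small_model_small[OF M'])
  define A where "A = M \<union> M' \<union> params \<phi>"
  have A: "small A" unfolding A_def by (intro small_Un small_M sM' params_small \<phi>)
  have AM: "M \<subseteq> A" "M \<union> params \<phi> \<subseteq> A" "M' \<union> params \<phi> \<subseteq> A" by (auto simp: A_def)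
  have AV: "A \<subseteq> V" by (rule small_subset[OF A])
  obtain d where d: "d \<in> generic A" and max: "\<And>e. e \<in> generic A \<Longrightarrow> val e \<phi> \<le> val d \<phi>"
    using ex_maximal_generic[OF \<phi>(1) A AM(2)] by blast
  note dg = generic_g[OF d]
  have m_pos: "0 < val d \<phi>"
  proof (rule ccontr)
    assume "\<not> 0 < val d \<phi>"
    then have le: "0 \<le> (-1) * val e \<phi> + 0" if "e \<in> generic A" for e using max[OF that] by simp
    obtain N where avg: "averages N \<phi>" using ex_averages[OF \<phi>(1)] by blast
    have "0 \<le> (-1) * \<mu> \<phi> + 0"
    proof (rule averages_nonneg[OF avg])
      show "small (A \<union> N)" by (rule small_Un[OF A averages_small[OF avg]])
      fix e assume "e \<in> generic (A \<union> N)"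
      then have "e \<in> generic A" by (rule generic_subset) simp
      then show "0 \<le> (-1) * val e \<phi> + 0" by (rule le)
    qed simp
    then show False using pos by simp
  qed
  define \<psi> where "\<psi> = shift L d \<phi>"
  have \<psi>: "\<psi> \<in> F V" unfolding \<psi>_def by (rule shift_F_V[OF \<phi>(1) dg])
  have f\<psi>: "val e \<psi> = val (e \<cdot> d) \<phi>" if e: "e \<in> g" for e
  proof (rule mu_cong)
    show "shift L e \<psi> \<in> F V" by (rule shift_F_V[OF \<psi> e])
    show "shift L (e \<cdot> d) \<phi> \<in> F V" by (rule shift_F_V[OF \<phi>(1) mult_closed[OF e dg]])
    show "holds a (shift L e \<psi>) \<longleftrightarrow> holds a (shift L (e \<cdot> d) \<phi>)" if a: "a \<in> g" for a
      using holds_shift[OF \<psi>] holds_shift[OF \<phi>(1)] mult_assoc[OF a e dg] by (simp add: \<psi>_def)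
  qed
  obtain N where avg: "averages N \<psi>" using ex_averages[OF \<psi>] by blast
  note sN = averages_small[OF avg]
  define B where "B = insert d A \<union> N"
  have "small (insert d A)"
    using small_Un[OF A finite_small[of "{d}"]] g_V[OF dg] by simp
  then have B: "small B" "N \<subseteq> B" "insert d A \<subseteq> B"
    unfolding B_def by (rule small_Un[OF _ sN]) auto
  have ge: "0 \<le> (-1) * val e \<psi> + \<mu> \<psi>" if e: "e \<in> generic B" for e
  proof -
    have "e \<cdot> d \<in> generic A"
      by (rule generic_mult[OF A AM(1) d generic_subset[OF e B(3)]])
    then show ?thesis using max f\<psi>[OF generic_g[OF e]] by (simp add: \<psi>_def)
  qed
  obtain p where p: "p \<in> I" using I_ne by blast
  have pS: "p \<in> S" using p IS by blast
  obtain q where q: "q \<in> S" "realizes_over d q A" using generic_realizes_S[OF d AV] by blast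
  define s where "s = type_prod \<kappa> L G U p q"
  have sI: "s \<in> I" unfolding s_def by (rule right[OF q(1) p])
  have sS: "s \<in> S" using sI IS by blast
  obtain e where e: "realizes_over e p B"
    using ex_realizes_over[OF S_types[OF pS] B(1) small_subset[OF B(1)]] by blast
  note eg = realizes_over_g[OF e]
  have ed: "realizes_over (e \<cdot> d) s A"
    unfolding realizes_over_def
  proof (intro conjI ballI)
    show "e \<cdot> d \<in> g" by (rule mult_closed[OF eg dg])
    fix \<theta> assume \<theta>: "\<theta> \<in> F A"
    have \<theta>V: "\<theta> \<in> F V" by (rule F_mono[OF \<theta> AV])
    have "M' \<union> params \<theta> \<subseteq> A" using \<theta> AM(3) by (auto simp: formulas_def)
    then have "\<theta> \<in> s \<longleftrightarrow> shift L d \<theta> \<in> p"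
      unfolding s_def
      by (intro type_prod_mem[OF S_types[OF pS] S_types[OF q(1)] M' S_inv[OF pS] S_inv[OF q(1)] \<theta>V])
        (rule realizes_over_subset[OF q(2)])
    also have "\<dots> \<longleftrightarrow> holds e (shift L d \<theta>)"
      using e F_mono[OF shift_F[OF \<theta> dg] B(3)] by (auto simp: realizes_over_def)
    also have "\<dots> \<longleftrightarrow> holds (e \<cdot> d) \<theta>" by (rule holds_shift[OF \<theta>])
    finally show "holds (e \<cdot> d) \<theta> \<longleftrightarrow> \<theta> \<in> s" by simp
  qed
  have sedV: "shift L (e \<cdot> d) \<phi> \<in> F V" by (rule shift_F_V[OF \<phi>(1) mult_closed[OF eg dg]])
  have "\<not> 0 < val (e \<cdot> d) \<phi>"
  proof
    assume "0 < val (e \<cdot> d) \<phi>"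
    then obtain p1 where p1: "p1 \<in> S" "shift L (e \<cdot> d) \<phi> \<in> p1" using ex_S_containing[OF sedV] by blast
    have "\<phi> \<in> type_prod \<kappa> L G U p1 s"
      using type_prod_mem[OF S_types[OF p1(1)] S_types[OF sS] M' S_inv[OF p1(1)] S_inv[OF sS] \<phi>(1)
          realizes_over_subset[OF ed AM(3)]] p1(2) by blast
    then show False using disj left[OF p1(1) sI] by blast
  qed
  then have "0 < (-1) * val e \<psi> + \<mu> \<psi>" using f\<psi>[OF eg] m_pos by (simp add: \<psi>_def)
  moreover have "e \<in> generic N" using realizes_S_generic[OF pS e] generic_subset B(2) by blast
  ultimately have "0 < (-1) * \<mu> \<psi> + \<mu> \<psi>" by (intro averages_pos[OF avg B(1,2) ge])
  then show False by simp
qed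

end

theorem theorem4p7:
  fixes L :: "('s, 'f, 'r) language"
    and T :: "('s, 'f, 'r, 'm) fm set"
    and G U :: "('s, 'f, 'r, 'm) model"
    and \<kappa> :: "'k rel" and \<kappa>' :: "'l rel"
    and \<mu> :: "('s, 'f, 'r, 'm) fm \<Rightarrow> real"
    and I :: "('s, 'f, 'r, 'm) fm set set"
  assumes "monster L T \<kappa> G" and "group_expansion L G"
    and "monster L T \<kappa>' U" and "elementary_sub L G U" and "|univ G| <o \<kappa>'"
    and "keisler_measure L G (univ G) \<mu>"
    and "definable \<kappa> L G \<mu>" and "invariantly_supported \<kappa> L G \<mu>" and "idempotent \<kappa> L G \<mu>"
    and "closedin (subtopology (type_topology L G {xvar L} (univ G)) (supp L G (univ G) \<mu>)) I"
    and "two_sided_ideal (type_prod \<kappa> L G U) (supp L G (univ G) \<mu>) I"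
  shows "I = supp L G (univ G) \<mu>"
proof -
  \<comment> \<open>The variables of a single sort already give infinitely many formulas.\<close>
  have inf: "infinite (Field \<kappa>0)"
    if "Card_order \<kappa>0" "|formulas L H UNIV {}| <o \<kappa>0" for \<kappa>0 :: "'z rel" and H :: "('s, 'f, 'r, 'm) model"
  proof
    assume fin: "finite (Field \<kappa>0)"
    let ?v = "\<lambda>n. Eq (Var (gsort L, n)) (Var (gsort L, n)) :: ('s, 'f, 'r, 'm) fm"
    have "range ?v \<subseteq> formulas L H UNIV {}" by (auto simp: formulas_def)
    moreover have "infinite (range ?v)" by (rule range_inj_infinite) (auto simp: inj_def)
    ultimately have "infinite (formulas L H UNIV {})" using infinite_super by blast
    moreover have "|formulas L H UNIV {}| \<le>o |Field \<kappa>0|"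
      using that card_of_Field_ordIso ordLess_imp_ordLeq ordLeq_ordIso_trans ordIso_symmetric by blast
    ultimately show False using fin card_of_ordLeq_infinite by blast
  qed
  interpret keisler L G \<kappa> \<mu>
    using assms(1,2,6) inf[of \<kappa> G] by unfold_locales (auto simp: monster_def)
  interpret monster_extension L G \<kappa> U \<kappa>'
    using assms(3,4,5) inf[of \<kappa>' U] by unfold_locales (auto simp: monster_def)
  from assms(7)[unfolded definable_def] obtain M where M0: "small_model \<kappa> L G M \<and>
    (\<forall>Y. finite Y \<and> x \<notin> Y \<longrightarrow> (\<forall>\<phi>\<in>formulas L G (insert x Y) M.
      (\<forall>b \<in> assignments G. \<forall>b' \<in> assignments G.
         tp L G Y M b = tp L G Y M b' \<longrightarrow> \<mu> (plug L b \<phi>) = \<mu> (plug L b' \<phi>)) \<and>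
      continuous_map (type_topology L G Y M) (top_of_set {0..1})
        (\<lambda>q. \<mu> (plug L (SOME b. b \<in> assignments G \<and> tp L G Y M b = q) \<phi>))))" ..
  then have M: "small_model \<kappa> L G M" by simp
  have def: "(\<forall>b \<in> assignments G. \<forall>b' \<in> assignments G.
         tp L G Y M b = tp L G Y M b' \<longrightarrow> \<mu> (plug L b \<phi>) = \<mu> (plug L b' \<phi>)) \<and>
      continuous_map (type_topology L G Y M) (top_of_set {0..1})
        (\<lambda>q. \<mu> (plug L (SOME b. b \<in> assignments G \<and> tp L G Y M b = q) \<phi>))"
    if "finite Y" "x \<notin> Y" "\<phi> \<in> formulas L G (insert x Y) M" for Y \<phi>
    using bspec[OF mp[OF spec[OF conjunct2[OF M0]] conjI[OF that(1,2)]] that(3)] .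
  obtain M' where M': "small_model \<kappa> L G M'" "\<forall>p\<in>S. invariant L G M' p"
    using assms(8) unfolding invariantly_supported_def by blast
  interpret idempotent_setting L G \<kappa> \<mu> M U \<kappa>' M'
  proof
    show "small M" by (rule small_model_small[OF M])
    show "\<mu> (plug L b \<phi>) = \<mu> (plug L b' \<phi>)"
      if "finite Y" "x \<notin> Y" "\<phi> \<in> formulas L G (insert x Y) M" "b \<in> assignments G" "b' \<in> assignments G"
        "tp L G Y M b = tp L G Y M b'" for Y \<phi> b b'
      using def[OF that(1-3)] that(4-6) by blast
    show "continuous_map (type_topology L G Y M) (top_of_set {0..1})
        (\<lambda>q. \<mu> (plug L (SOME b. b \<in> assignments G \<and> tp L G Y M b = q) \<phi>))"
      if "finite Y" "x \<notin> Y" "\<phi> \<in> formulas L G (insert x Y) M" for Y \<phi>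
      using def[OF that] by blast
  qed (use M' assms(9) in auto)
  show ?thesis by (rule closed_ideal_eq_support[OF assms(10,11)])
qed

end
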